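(* Let $d\in\mathbb{N}$, $\alpha\in(0,1)$, $\beta\in(0,2)$, and let the spectral measure $\nu$ have a strictly positive density, such that $\omega_\nu$ is strictly positive and $(d+1+[\beta])$-times continuously differentiable on $\mathbb{S}^{d-1}$. Let $f:[0,\infty)\to[0,\infty)$ be locally Lipschitz continuous and non-decreasing, with $f(0)=0$ and $f>0$ on $(0,\infty)$, and of Osgood-type with exponent $k>1$. Define $q':=\frac{d}{\beta}(k-1)$ and assume $q'\ge1$. Suppose that $$\max\left(\frac d\beta,\;k,\;\frac{d(k-1)}{\beta}\right)<q<\frac{\alpha d k(k-1)}{\beta}.$$ Then there exists $\varepsilon>0$ such that for every non-negative $u_0\in L_{q'}(\mathbb{R}^d)$ with $|u_0|_{q'}\le\varepsilon$, the problem $$\partial_t^{\alpha}(u-u_0)+\Psi_\beta(-i\nabla)u=f(u),\quad t>0,\ x\in\mathbb{R}^d,$$ has a global integral solution $u\in L_{\infty,\mathrm{loc}}((0,\infty);L_q(\mathbb{R}^d))$.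
   Context: Notation: $|\cdot|_p$ is the norm of $L_p(\mathbb{R}^d)$; $g_\rho(t)=\frac{1}{\Gamma(\rho)}t^{\rho-1}$ for $\rho>0$, $t>0$; $\partial_t^\alpha v=\frac{d}{dt}\int_0^t g_{1-\alpha}(t-s)v(s)\,ds$ is the Riemann–Liouville derivative. $\Psi_\beta(-i\nabla)$ is the pseudo-differential operator with symbol $\psi_\beta(\xi)=|\xi|^\beta\omega_\nu(\xi/|\xi|)$, where $\omega_\nu(\theta)=\int_{\mathbb{S}^{d-1}}|\theta\cdot\eta|^\beta\,\nu(d\eta)$ for $\theta\in\mathbb{S}^{d-1}$ and $\nu$ is a (spectral) measure on $\mathbb{S}^{d-1}$. $[\beta]$ is the integer part of $\beta$. Kernels: $G(t,x)=(2\pi)^{-d}\int_{\mathbb{R}^d}e^{ix\cdot\xi}e^{-t\psi_\beta(\xi)}\,d\xi$ is the Green function of $\partial_t v+\Psi_\beta(-i\nabla)v=0$ with $G(0,\cdot)=\delta_0$. $G_\alpha(t,s)$ is the Green function of $\partial_t v(t,s)+\frac{d^\alpha}{ds^\alpha}v(t,s)=0$ with $G_\alpha(0,\cdot)=\delta_0$, where $\frac{d^\alpha}{ds^\alpha}h(s)=\frac{1}{\Gamma(-\alpha)}\int_0^\infty\frac{h(s-\tau)-h(s)}{\tau^{1+\alpha}}\,d\tau$; that is, $G_\alpha(t,\cdot)$ is the density on $(0,\infty)$ with $\int_0^\infty e^{-\lambda s}G_\alpha(t,s)\,ds=e^{-t\lambda^\alpha}$, $\lambda\ge0$. Then $$Z(t,x)=\frac1\alpha\int_0^\infty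 G(t^\alpha s,x)\,s^{-1-\frac1\alpha}\,G_\alpha(1,s^{-\frac1\alpha})\,ds,$$ and $Y$ is the unique solution of $Z(t,x)=\int_0^t g_{1-\alpha}(t-s)Y(s,x)\,ds$. Integral solution: given non-negative $u_0,f$, a function $u:[0,T)\times\mathbb{R}^d\to[0,\infty]$ is an integral solution of the problem if it is measurable, finite almost everywhere, and for almost every $(t,x)\in(0,T)\times\mathbb{R}^d$ satisfies $u(t,x)=\int_{\mathbb{R}^d}Z(t,x-y)u_0(y)\,dy+\int_0^t\int_{\mathbb{R}^d}Y(t-s,x-y)f(u(s,y))\,dy\,ds$. It is global if $T$ can be arbitrarily large. Osgood-type functions: for $k>1$ and a fixed $\phi_0>2^{1/(k-1)}$ put $\phi_i=\phi_{i-1}^k$ for $i\ge1$, and define $f^{[k]}:[0,\infty)\to[0,\infty)$ by $f^{[k]}(s)=(1-\phi_0^{1-k})s^k$ for $s\in[0,\phi_0]$; $f^{[k]}(s)=\phi_i-\phi_{i-1}$ for $s\in[\phi_{i-1},\phi_i/2]$, $i\ge1$; and, for $s\in(\phi_i/2,\phi_i)$, $i\ge1$, $f^{[k]}(s)$ is the affine interpolation between the values of $f^{[k]}$ at $\phi_i/2$ and $\phi_i$. A continuous $f:[0,\infty)\to[0,\infty)$ is of Osgood-type with exponent $k>1$ if (for such an $f^{[k]}$) there are constants $c,C>0$ with $c\,f^{[k]}(s)\le f(s)\le C\,f^{[k]}(s)$ for all $s\ge0$. $L_{\infty,\mathrm{loc}}((0,\infty);L_q(\mathbb{R}^d))$ is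 the space of (classes of) measurable functions $u$ such that $t\mapsto|u(t,\cdot)|_q$ is essentially bounded on compact subsets of $(0,\infty)$. *)

theory Defs
  imports "HOL-Analysis.Analysis"
begin

text \<open>The space is \<open>real^'n\<close>, so the dimension is \<open>CARD('n)\<close>.\<close>


subsection \<open>Smooth functions on the unit sphere\<close>

fun C_on :: "nat \<Rightarrow> 'a::real_normed_vector set \<Rightarrow> ('a \<Rightarrow> real) \<Rightarrow> bool" where
  "C_on 0 U F \<longleftrightarrow> continuous_on U F"
| "C_on (Suc m) U F \<longleftrightarrow> (\<forall>x\<in>U. F differentiable (at x)) \<and>
     (\<forall>v. C_on m U (\<lambda>x. frechet_derivative F (at x) v))"

text \<open>
  A function on the sphere, as a compact submanifold, is \<open>m\<close> times continuously differentiable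
  if it extends to such a function on an open neighbourhood of the sphere.
\<close>

definition C_on_sphere :: "nat \<Rightarrow> ('a::real_normed_vector \<Rightarrow> real) \<Rightarrow> bool" where
  "C_on_sphere m w \<longleftrightarrow>
     (\<exists>U F. open U \<and> sphere 0 1 \<subseteq> U \<and> C_on m U F \<and> (\<forall>\<theta>\<in>sphere 0 1. F \<theta> = w \<theta>))"


subsection \<open>The operator symbol\<close>

text \<open>
  Surface measure of \<open>A\<close> is \<open>d\<close> times the Lebesgue measure of the cone
  \<open>{r *\<^sub>R \<theta> | r \<theta>. 0 < r \<and> r \<le> 1 \<and> \<theta> \<in> A}\<close>, i.e. of the preimage of \<open>A\<close> under the radial
  projection of the punctured unit ball. For \<open>d = 1\<close> this is counting measure on \<open>{-1, 1}\<close>.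
\<close>

definition surface_measure :: "(real^'n) measure" where
  "surface_measure =
     scale_measure (of_nat CARD('n))
       (distr (restrict_space lborel (cball 0 1 - {0})) (restrict_space borel (sphere 0 1)) sgn)"

definition spectral_measure_pos_density :: "(real^'n) measure \<Rightarrow> bool" where
  "spectral_measure_pos_density \<nu> \<longleftrightarrow> finite_measure \<nu> \<and>
     (\<exists>h::real^'n \<Rightarrow> real. h \<in> borel_measurable surface_measure \<and> (\<forall>\<eta>\<in>sphere 0 1. h \<eta> > 0) \<and>
        \<nu> = density surface_measure (\<lambda>\<eta>. ennreal (h \<eta>)))"

definition omega :: "real \<Rightarrow> (real^'n) measure \<Rightarrow> real^'n \<Rightarrow> real" where
  "omega \<beta> \<nu> \<theta> = (\<integral>\<eta>. \<bar>\<theta> \<bullet> \<eta>\<bar> powr \<beta> \<partial>\<nu>)"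

definition symbol :: "real \<Rightarrow> (real^'n) measure \<Rightarrow> real^'n \<Rightarrow> real" where
  "symbol \<beta> \<nu> \<xi> = norm \<xi> powr \<beta> * omega \<beta> \<nu> (\<xi> /\<^sub>R norm \<xi>)"


subsection \<open>Kernels\<close>

text \<open>The integral is real because the symbol is even; \<open>Re\<close> only adjusts the type.\<close>

definition kernel_G :: "real \<Rightarrow> (real^'n) measure \<Rightarrow> real \<Rightarrow> real^'n \<Rightarrow> real" where
  "kernel_G \<beta> \<nu> t x =
     Re ((\<integral>\<xi>. exp (\<i> * complex_of_real (x \<bullet> \<xi>)) * complex_of_real (exp (- t * symbol \<beta> \<nu> \<xi>))
            \<partial>lborel) / (2 * pi) ^ CARD('n))"

definition g_frac :: "real \<Rightarrow> real \<Rightarrow> real" where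
  "g_frac \<rho> t = t powr (\<rho> - 1) / Gamma \<rho>"

text \<open>
  The Laplace transform determines \<open>G\<alpha> t\<close> up to null sets, and these do not
  affect the integral defining \<open>kernel_Z\<close>.
\<close>

definition stable_density :: "real \<Rightarrow> (real \<Rightarrow> real \<Rightarrow> real) \<Rightarrow> bool" where
  "stable_density \<alpha> G\<alpha> \<longleftrightarrow>
     (\<forall>t>0. G\<alpha> t \<in> borel_measurable borel \<and> (\<forall>s>0. G\<alpha> t s \<ge> 0) \<and>
        (\<forall>r\<ge>0. set_integrable lborel {0<..} (\<lambda>s. exp (- r * s) * G\<alpha> t s) \<and>
               (LINT s:{0<..}|lborel. exp (- r * s) * G\<alpha> t s) = exp (- t * r powr \<alpha>)))"

definition kernel_Z ::
  "real \<Rightarrow> real \<Rightarrow> (real^'n) measure \<Rightarrow> (real \<Rightarrow> real \<Rightarrow> real) \<Rightarrow> real \<Rightarrow> real^'n \<Rightarrow> real" where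
  "kernel_Z \<alpha> \<beta> \<nu> G\<alpha> t x =
     (1 / \<alpha>) * (LINT s:{0<..}|lborel.
        kernel_G \<beta> \<nu> (t powr \<alpha> * s) x * s powr (- 1 - 1 / \<alpha>) * G\<alpha> 1 (s powr (- 1 / \<alpha>)))"

text \<open>
  \<open>Z\<close> may be singular at \<open>x = 0\<close>. For \<open>x \<noteq> 0\<close> the equation determines \<open>Y (\<cdot>, x)\<close> almost
  everywhere, which is all that enters the notion of integral solution.
\<close>

definition is_kernel_Y ::
  "real \<Rightarrow> (real \<Rightarrow> real^'n \<Rightarrow> real) \<Rightarrow> (real \<Rightarrow> real^'n \<Rightarrow> real) \<Rightarrow> bool" where
  "is_kernel_Y \<alpha> Z Y \<longleftrightarrow>
     (\<lambda>(t, x). Y t x) \<in> borel_measurable borel \<and>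
     (\<forall>t>0. \<forall>x. x \<noteq> 0 \<longrightarrow>
        set_integrable lborel {0<..<t} (\<lambda>s. g_frac (1 - \<alpha>) (t - s) * Y s x) \<and>
        Z t x = (LINT s:{0<..<t}|lborel. g_frac (1 - \<alpha>) (t - s) * Y s x))"


subsection \<open>Integral solutions and function spaces\<close>

text \<open>The value at \<open>\<infinity>\<close> is only a convention: integral solutions are finite almost everywhere.\<close>

definition ext_fun :: "(real \<Rightarrow> real) \<Rightarrow> ennreal \<Rightarrow> ennreal" where
  "ext_fun f v = (if v = \<infinity> then \<infinity> else ennreal (f (enn2real v)))"

text \<open>
  The kernels and data are non-negative, so both terms are integrals with values in \<open>[0, \<infinity>]\<close>.
\<close>

definition integral_solution ::
  "(real \<Rightarrow> real^'n \<Rightarrow> real) \<Rightarrow> (real \<Rightarrow> real^'n \<Rightarrow> real) \<Rightarrow> (real \<Rightarrow> real) \<Rightarrow> (real^'n \<Rightarrow> real) \<Rightarrow>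
     real \<Rightarrow> (real \<Rightarrow> real^'n \<Rightarrow> ennreal) \<Rightarrow> bool" where
  "integral_solution Z Y f u0 T u \<longleftrightarrow>
     (\<lambda>(t, x). u t x) \<in> borel_measurable (restrict_space borel ({0..<T} \<times> UNIV)) \<and>
     (AE (t, x) in lborel. t \<in> {0<..<T} \<longrightarrow> u t x < \<infinity>) \<and>
     (AE (t, x) in lborel. t \<in> {0<..<T} \<longrightarrow>
        u t x = (\<integral>\<^sup>+y. ennreal (Z t (x - y) * u0 y) \<partial>lborel) +
                (\<integral>\<^sup>+s\<in>{0<..<t}. (\<integral>\<^sup>+y. ennreal (Y (t - s) (x - y)) * ext_fun f (u s y) \<partial>lborel)
                   \<partial>lborel))"

definition global_integral_solution ::
  "(real \<Rightarrow> real^'n \<Rightarrow> real) \<Rightarrow> (real \<Rightarrow> real^'n \<Rightarrow> real) \<Rightarrow> (real \<Rightarrow> real) \<Rightarrow> (real^'n \<Rightarrow> real) \<Rightarrow>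
     (real \<Rightarrow> real^'n \<Rightarrow> ennreal) \<Rightarrow> bool" where
  "global_integral_solution Z Y f u0 u \<longleftrightarrow> (\<forall>T>0. integral_solution Z Y f u0 T u)"

definition ennpowr :: "ennreal \<Rightarrow> real \<Rightarrow> ennreal" where
  "ennpowr v p = (if v = \<infinity> then \<infinity> else ennreal (enn2real v powr p))"

definition Lp_norm :: "real \<Rightarrow> (real^'n \<Rightarrow> ennreal) \<Rightarrow> ennreal" where
  "Lp_norm p w = ennpowr (\<integral>\<^sup>+x. ennpowr (w x) p \<partial>lborel) (1 / p)"

definition Linf_loc_Lp :: "real \<Rightarrow> (real \<Rightarrow> real^'n \<Rightarrow> ennreal) \<Rightarrow> bool" where
  "Linf_loc_Lp q u \<longleftrightarrow>
     (\<lambda>(t, x). u t x) \<in> borel_measurable (restrict_space borel ({0<..} \<times> UNIV)) \<and>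
     (\<forall>K. compact K \<and> K \<subseteq> {0<..} \<longrightarrow>
        (\<exists>C::real. AE t in lborel. t \<in> K \<longrightarrow> Lp_norm q (u t) \<le> ennreal C))"


subsection \<open>Osgood-type functions\<close>

primrec osgood_phi :: "real \<Rightarrow> real \<Rightarrow> nat \<Rightarrow> real" where
  "osgood_phi k \<phi>0 0 = \<phi>0"
| "osgood_phi k \<phi>0 (Suc i) = osgood_phi k \<phi>0 i powr k"

text \<open>
  With \<open>\<phi> = osgood_phi k \<phi>0\<close>, the index \<open>i\<close> is \<open>0\<close> for \<open>s \<le> \<phi> 0\<close>, and otherwise
  \<open>s \<in> {\<phi> (i - 1)<..\<phi> i}\<close>. The last branch interpolates between the values
  \<open>\<phi> i - \<phi> (i - 1)\<close> at \<open>\<phi> i / 2\<close> and \<open>\<phi> (i + 1) - \<phi> i\<close> at \<open>\<phi> i\<close>.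
\<close>

definition osgood_fun :: "real \<Rightarrow> real \<Rightarrow> real \<Rightarrow> real" where
  "osgood_fun k \<phi>0 s =
     (let \<phi> = osgood_phi k \<phi>0; i = (LEAST i. s \<le> \<phi> i) in
      if i = 0 then (1 - \<phi>0 powr (1 - k)) * s powr k
      else if s \<le> \<phi> i / 2 then \<phi> i - \<phi> (i - 1)
      else (\<phi> i - \<phi> (i - 1)) +
           ((\<phi> (i + 1) - \<phi> i) - (\<phi> i - \<phi> (i - 1))) * ((s - \<phi> i / 2) / (\<phi> i / 2)))"

definition osgood_type :: "real \<Rightarrow> (real \<Rightarrow> real) \<Rightarrow> bool" where
  "osgood_type k f \<longleftrightarrow> continuous_on {0..} f \<and> (\<forall>s\<ge>0. f s \<ge> 0) \<and>
     (\<exists>\<phi>0 c C. \<phi>0 > 2 powr (1 / (k - 1)) \<and> c > 0 \<and> C > 0 \<and>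
        (\<forall>s\<ge>0. c * osgood_fun k \<phi>0 s \<le> f s \<and> f s \<le> C * osgood_fun k \<phi>0 s))"

end

theory Submission
  imports Defs "HOL-Probability.Probability" "HOL-Real_Asymp.Real_Asymp"
begin

text \<open>
  The solution is the limit of the monotone iteration \<open>u\<^sub>0 = 0\<close>,
  \<open>u\<^sub>n\<^sub>+\<^sub>1 = Z * u0 + Y * f(u\<^sub>n)\<close>, all of whose terms are non-negative. Since
  \<open>f(s) \<le> C s\<^sup>k\<close>, the weighted bound \<open>|u\<^sub>n(t)|\<^sub>q \<le> M t powr (- \<theta>)\<close> with
  \<open>\<theta> = \<alpha> d / \<beta> (1 / q' - 1 / q)\<close> is invariant under the iteration if \<open>u0\<close> is small in
  \<open>L\<^sub>q\<^sub>'\<close>; the exponents match because the problem is scale invariant in \<open>L\<^sub>q\<^sub>'\<close>.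

  The kernel estimates need only \<open>G \<ge> 0\<close>, \<open>|G(t)|\<^sub>1 \<le> 1\<close> and
  \<open>|G(t)|\<^sub>\<infinity> \<le> C t powr (- d / \<beta>)\<close>. The first two hold because \<open>exp (- t \<psi>)\<close> is a limit of
  characteristic functions of compound Poisson laws. With \<open>p = G\<^sub>\<alpha>(1, \<cdot>)\<close>, the kernels are the averages
  \<open>Z(t, x) = \<integral> G((t / \<tau>) powr \<alpha>, x) p(\<tau>) d\<tau>\<close> and
  \<open>Y(t, x) = \<alpha> t powr (\<alpha> - 1) \<integral> G((t / \<tau>) powr \<alpha>, x) \<tau> powr (- \<alpha>) p(\<tau>) d\<tau>\<close>, and the bounds
  follow from the moments of \<open>p\<close> of order less than \<open>\<alpha>\<close>. The formula for \<open>Y\<close> rests on the identity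
  \<open>(g\<^sub>1\<^sub>-\<^sub>\<alpha> * p)(t) = t p(t) / \<alpha>\<close>, which is read off from Laplace transforms, and on the uniqueness
  of solutions of Abel's integral equation.
\<close>

subsection \<open>Integrals over the half line\<close>

text \<open>Integrals are taken in [0, \<infinity>] wherever possible: Tonelli then costs only
  measurability, and kernels may be infinite on null sets. Two objects do not fit.
  \<open>kernel_Z\<close> is a Bochner integral, which is 0 where it diverges, so it is
  \<open>enn2real\<close> of the true average. \<open>Y\<close> is any measurable solution of its
  Abel equation, of unknown sign; it is compared with the explicit kernel up to null sets, after
  splitting it into positive and negative parts. The range of q reflects three conditions. Passing
  from \<open>L\<^sub>r\<close> to \<open>L\<^sub>q\<close> costs a factor t powr (- \<alpha>
  \<kappa>) with \<kappa> = d / \<beta> (1 / r - 1 / q), and a moment of p of order \<alpha>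
  \<kappa> for Z, \<alpha> \<kappa> - \<alpha> for Y. For Y one has r = q / k, so q > k gives r
  \<ge> 1, and \<kappa> = q' / q < 1 makes its singularity in time integrable. For Z one has r = q',
  and q < \<alpha> k q' forces k \<kappa> < 1: the moment is finite, and the weight t powr (- k
  \<theta>) of \<open>f(u)\<close> is integrable at 0.\<close>

lemma nn_integral_exp_substitution:
  fixes F :: "real \<Rightarrow> ennreal"
  assumes [measurable]: "F \<in> borel_measurable borel"
  shows "(\<integral>\<^sup>+s\<in>{0<..}. F s \<partial>lborel) = (\<integral>\<^sup>+v. F (exp v) * ennreal (exp v) \<partial>lborel)"
proof -
  \<comment> \<open>The substitution is made on the compact intervals \<open>{- L n..L n}\<close>
    and extended by monotone convergence. The summand 1 keeps the interval from being degenerate at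
    n = 0.\<close>
  define L :: "nat \<Rightarrow> real" where "L n = 1 + real n" for n
  have cov: "\<exists>n. \<bar>y\<bar> \<le> L n" for y
    unfolding L_def using real_arch_simple[of "\<bar>y\<bar>"] by (metis add_increasing zero_le_one)
  have Lmono: "L m \<le> L n" if "m \<le> n" for m n using that by (simp add: L_def)
  have inc: "incseq (\<lambda>n x. F x * indicator {exp (- L n)..exp (L n)} x)"
    by (auto simp: incseq_def le_fun_def indicator_def) (smt (verit) Lmono exp_le_cancel_iff)+
  have inc': "incseq (\<lambda>n v. F (exp v) * ennreal (exp v) * indicator {- L n..L n} v)"
    by (auto simp: incseq_def le_fun_def indicator_def) (smt (verit) Lmono)+
  have "F s * indicator {0<..} s = (SUP n. F s * indicator {exp (- L n)..exp (L n)} s)" for s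
  proof (cases "s > 0")
    case True
    obtain n where n: "\<bar>ln s\<bar> \<le> L n" using cov by blast
    hence "s \<in> {exp (- L n)..exp (L n)}"
      using True by (smt (verit) atLeastAtMost_iff exp_le_cancel_iff exp_ln)
    hence "F s * indicator {0<..} s \<le> F s * indicator {exp (- L n)..exp (L n)} s"
      using True by simp
    hence "F s * indicator {0<..} s \<le> (SUP n. F s * indicator {exp (- L n)..exp (L n)} s)"
      by (meson SUP_upper2 UNIV_I)
    moreover have "(SUP n. F s * indicator {exp (- L n)..exp (L n)} s) \<le> F s * indicator {0<..} s"
      using True by (intro SUP_least) (auto simp: indicator_def)
    ultimately show ?thesis by (rule antisym)
  next
    case False
    hence "s \<notin> {exp (- L n)..exp (L n)}" for n
      using exp_gt_zero[of "- L n"] by (auto simp del: exp_gt_zero)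
    thus ?thesis using False by simp
  qed
  note SUP1 = this
  have SUP2: "(SUP n. F (exp v) * ennreal (exp v) * indicator {- L n..L n} v) = F (exp v) * ennreal (exp v)" for v
  proof (rule antisym)
    obtain n where "\<bar>v\<bar> \<le> L n" using cov by blast
    hence "F (exp v) * ennreal (exp v) \<le> F (exp v) * ennreal (exp v) * indicator {- L n..L n} v"
      by (auto simp: abs_le_iff)
    thus "F (exp v) * ennreal (exp v) \<le> (SUP n. F (exp v) * ennreal (exp v) * indicator {- L n..L n} v)"
      by (meson SUP_upper2 UNIV_I)
  qed (auto intro!: SUP_least simp: indicator_def)
  have sub: "(\<integral>\<^sup>+s. F s * indicator {exp (- L n)..exp (L n)} s \<partial>lborel)
      = (\<integral>\<^sup>+v. F (exp v) * ennreal (exp v) * indicator {- L n..L n} v \<partial>lborel)" for n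
    by (rule nn_integral_substitution_aux) (auto simp: L_def intro!: derivative_eq_intros continuous_intros)
  have "(\<integral>\<^sup>+s\<in>{0<..}. F s \<partial>lborel)
      = (SUP n. \<integral>\<^sup>+s. F s * indicator {exp (- L n)..exp (L n)} s \<partial>lborel)"
    unfolding SUP1 using inc by (intro nn_integral_monotone_convergence_SUP) auto
  also have "\<dots> = (\<integral>\<^sup>+v. (SUP n. F (exp v) * ennreal (exp v) * indicator {- L n..L n} v) \<partial>lborel)"
    unfolding sub using inc' by (intro nn_integral_monotone_convergence_SUP[symmetric]) auto
  also have "\<dots> = (\<integral>\<^sup>+v. F (exp v) * ennreal (exp v) \<partial>lborel)"
    by (simp only: SUP2)
  finally show ?thesis .
qed

text \<open>In logarithmic coordinates the power map is multiplication by \<gamma>, so both signs of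
  \<gamma> are treated at once; a negative one reverses the half line and leaves only its absolute
  value.\<close>

lemma nn_integral_power_substitution:
  fixes F :: "real \<Rightarrow> ennreal"
  assumes [measurable]: "F \<in> borel_measurable borel" and "\<gamma> \<noteq> 0"
  shows "(\<integral>\<^sup>+s\<in>{0<..}. F s \<partial>lborel)
    = (\<integral>\<^sup>+\<tau>\<in>{0<..}. F (\<tau> powr \<gamma>) * ennreal (\<bar>\<gamma>\<bar> * \<tau> powr (\<gamma> - 1)) \<partial>lborel)"
proof -
  have "(\<integral>\<^sup>+s\<in>{0<..}. F s \<partial>lborel) = (\<integral>\<^sup>+v. F (exp v) * ennreal (exp v) \<partial>lborel)"
    by (rule nn_integral_exp_substitution) simp
  also have "\<dots> = \<bar>\<gamma>\<bar> * (\<integral>\<^sup>+v. F (exp (0 + \<gamma> * v)) * ennreal (exp (0 + \<gamma> * v)) \<partial>lborel)"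
    using assms(2) by (intro nn_integral_real_affine) auto
  also have "\<dots> = (\<integral>\<^sup>+v. ennreal \<bar>\<gamma>\<bar> * (F (exp (\<gamma> * v)) * ennreal (exp (\<gamma> * v))) \<partial>lborel)"
    by (subst nn_integral_cmult) auto
  also have "\<dots> = (\<integral>\<^sup>+v. F (exp v powr \<gamma>) * ennreal (\<bar>\<gamma>\<bar> * exp v powr (\<gamma> - 1)) * ennreal (exp v) \<partial>lborel)"
  proof (intro nn_integral_cong, goal_cases)
    case (1 v)
    have "\<bar>\<gamma>\<bar> * exp v powr (\<gamma> - 1) * exp v = \<bar>\<gamma>\<bar> * exp (\<gamma> * v)"
      by (simp add: powr_def algebra_simps flip: exp_add)
    hence "ennreal (\<bar>\<gamma>\<bar> * exp v powr (\<gamma> - 1)) * ennreal (exp v) = ennreal \<bar>\<gamma>\<bar> * ennreal (exp (\<gamma> * v))"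
      by (simp flip: ennreal_mult)
    moreover have "exp v powr \<gamma> = exp (\<gamma> * v)" by (simp add: powr_def)
    ultimately show ?case by (simp only: mult.assoc mult.left_commute)
  qed
  also have "\<dots> = (\<integral>\<^sup>+\<tau>\<in>{0<..}. F (\<tau> powr \<gamma>) * ennreal (\<bar>\<gamma>\<bar> * \<tau> powr (\<gamma> - 1)) \<partial>lborel)"
    by (rule nn_integral_exp_substitution[symmetric]) simp
  finally show ?thesis .
qed

lemma nn_integral_scale_half_line:
  fixes F :: "real \<Rightarrow> ennreal"
  assumes [measurable]: "F \<in> borel_measurable borel" and "c > 0"
  shows "(\<integral>\<^sup>+s\<in>{0<..}. F s \<partial>lborel) = ennreal c * (\<integral>\<^sup>+s\<in>{0<..}. F (c * s) \<partial>lborel)"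
  using assms(2)
  by (subst nn_integral_real_affine[of _ c 0]) (auto simp: zero_less_mult_iff indicator_def intro!: nn_integral_cong)

lemma nn_integral_powr_exp:
  assumes "a > 0" "c > 0"
  shows "(\<integral>\<^sup>+s\<in>{0<..}. ennreal (s powr (a - 1) * exp (- c * s)) \<partial>lborel) = ennreal (Gamma a * c powr (- a))"
proof -
  have *: "(\<integral>\<^sup>+s\<in>{0<..}. ennreal (s powr (a - 1) * exp (- s)) \<partial>lborel) = ennreal (Gamma a)"
    unfolding Gamma_conv_nn_integral_real[OF assms(1)]
    by (intro nn_integral_cong) (auto simp: indicator_def exp_minus field_simps)
  have eq: "(c * s) powr (a - 1) * exp (- (c * s)) = c powr (a - 1) * (s powr (a - 1) * exp (- c * s))"
    if "s > 0" for s using that assms by (simp add: powr_mult)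
  have "ennreal (Gamma a) = ennreal c * (\<integral>\<^sup>+s\<in>{0<..}. ennreal ((c * s) powr (a - 1) * exp (- (c * s))) \<partial>lborel)"
    unfolding *[symmetric] using assms by (intro nn_integral_scale_half_line) auto
  also have "(\<integral>\<^sup>+s\<in>{0<..}. ennreal ((c * s) powr (a - 1) * exp (- (c * s))) \<partial>lborel)
    = (\<integral>\<^sup>+s. ennreal (c powr (a - 1)) * (ennreal (s powr (a - 1) * exp (- c * s)) * indicator {0<..} s) \<partial>lborel)"
    by (intro nn_integral_cong) (auto simp: indicator_def eq simp flip: ennreal_mult)
  also have "\<dots> = ennreal (c powr (a - 1)) * (\<integral>\<^sup>+s\<in>{0<..}. ennreal (s powr (a - 1) * exp (- c * s)) \<partial>lborel)"
    by (subst nn_integral_cmult) auto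
  finally have "ennreal (c powr - a) * ennreal (Gamma a) = ennreal (c powr - a) * (ennreal c * (ennreal (c powr (a - 1)) *
      (\<integral>\<^sup>+s\<in>{0<..}. ennreal (s powr (a - 1) * exp (- c * s)) \<partial>lborel)))" by simp
  also have "\<dots> = ennreal (c powr - a * (c * c powr (a - 1))) *
      (\<integral>\<^sup>+s\<in>{0<..}. ennreal (s powr (a - 1) * exp (- c * s)) \<partial>lborel)"
    using assms by (simp add: ennreal_mult mult.assoc)
  also have "c powr - a * (c * c powr (a - 1)) = 1"
    using assms by (simp add: powr_diff powr_minus)
  finally show ?thesis using assms by (simp add: ennreal_mult mult.commute)
qed

text \<open>Near 0 the first bound leaves s powr (b - a - 1), integrable because a < b; near
  \<infinity> the second leaves s powr (- a - 1), integrable because a > 0. It serves 1 - exp (- (s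
  powr \<alpha>)) with b = \<alpha> and 1 - cos s with b = 2.\<close>

lemma nn_integral_powr_tails:
  fixes h :: "real \<Rightarrow> real"
  assumes "a < b" "0 < a" and [measurable]: "h \<in> borel_measurable borel"
    and h: "\<And>s. s > 0 \<Longrightarrow> 0 \<le> h s" "\<And>s. s > 0 \<Longrightarrow> h s \<le> C * s powr b" "\<And>s. s > 0 \<Longrightarrow> h s \<le> C"
    and "C \<ge> 0"
  shows "(\<integral>\<^sup>+s\<in>{0<..}. ennreal (h s * s powr (- a - 1)) \<partial>lborel) < \<infinity>"
proof -
  have 1: "(\<integral>\<^sup>+s. ennreal (C * s powr (b - a - 1)) * indicator {0..1} s \<partial>lborel) < \<infinity>"
  proof -
    have "((\<lambda>s. s powr (b - a - 1)) has_integral (1 powr (b - a - 1 + 1) / (b - a - 1 + 1))) {0..1}"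
      using assms by (intro has_integral_powr_from_0) auto
    hence "((\<lambda>s. C * s powr (b - a - 1)) has_integral C * (1 powr (b - a - 1 + 1) / (b - a - 1 + 1))) {0..1}"
      by (rule has_integral_mult_right)
    from nn_integral_has_integral_lebesgue[OF _ this] have
      "(\<integral>\<^sup>+s. ennreal (indicator {0..1} s * (C * s powr (b - a - 1))) \<partial>lborel) = ennreal (C * (1 powr (b - a - 1 + 1) / (b - a - 1 + 1)))"
      using assms by auto
    hence "(\<integral>\<^sup>+s. ennreal (indicator {0..1} s * (C * s powr (b - a - 1))) \<partial>lborel) < \<infinity>" by simp
    thus ?thesis by (simp add: ennreal_mult' mult.commute ennreal_indicator)
  qed
  have 2: "(\<integral>\<^sup>+s. ennreal (C * s powr (- a - 1)) * indicator {1..} s \<partial>lborel) < \<infinity>"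
  proof -
    have "(\<integral>\<^sup>+s. ennreal (C * s powr (- a - 1)) * indicator {1..} s \<partial>lborel) = 0 - (- C / a * 1 powr (- a))"
    proof (rule nn_integral_FTC_atLeast)
      fix x :: real assume "1 \<le> x"
      thus "((\<lambda>x. - C / a * x powr - a) has_real_derivative C * x powr (- a - 1)) (at x)"
        using assms by (auto intro!: derivative_eq_intros)
    next
      have "((\<lambda>x::real. x powr - a) \<longlongrightarrow> 0) at_top"
        using assms by (intro tendsto_neg_powr filterlim_ident) auto
      thus "((\<lambda>x::real. - C / a * x powr - a) \<longlongrightarrow> 0) at_top"
        by (rule tendsto_mult_right_zero)
    qed (use assms in auto)
    thus ?thesis by simp
  qed
  have "(\<integral>\<^sup>+s\<in>{0<..}. ennreal (h s * s powr (- a - 1)) \<partial>lborel)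
     \<le> (\<integral>\<^sup>+s. ennreal (C * s powr (b - a - 1)) * indicator {0..1} s
        + ennreal (C * s powr (- a - 1)) * indicator {1..} s \<partial>lborel)"
  proof (intro nn_integral_mono, goal_cases)
    case (1 s)
    show ?case
    proof (cases "s \<le> 0")
      case False
      have "s powr b * s powr (- a - 1) = s powr (b - a - 1)" using False by (simp add: algebra_simps flip: powr_add)
      hence "h s * s powr (- a - 1) \<le> C * s powr (b - a - 1)"
        using mult_right_mono[OF h(2)[of s], of "s powr (- a - 1)"] False by (simp add: mult.assoc)
      moreover have "h s * s powr (- a - 1) \<le> C * s powr (- a - 1)"
        using mult_right_mono[OF h(3)[of s], of "s powr (- a - 1)"] False by simp
      ultimately show ?thesis using False
        by (cases s "1::real" rule: linorder_cases)
          (auto simp: indicator_def intro: ennreal_leI add_increasing)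
    qed simp
  qed
  also have "\<dots> < \<infinity>"
    using 1 2 by (subst nn_integral_add) auto
  finally show ?thesis .
qed

subsection \<open>Jensen, Minkowski and Young inequalities\<close>

lemma ennpowr_ennreal [simp]: "0 \<le> x \<Longrightarrow> ennpowr (ennreal x) p = ennreal (x powr p)"
  by (simp add: ennpowr_def)

lemma ennpowr_top [simp]: "ennpowr \<top> p = \<top>"
  by (simp add: ennpowr_def)

lemma ennpowr_0 [simp]: "ennpowr 0 p = 0"
  by (simp add: ennpowr_def)

lemma measurable_ennpowr [measurable]:
  assumes [measurable]: "h \<in> borel_measurable M"
  shows "(\<lambda>x. ennpowr (h x) p) \<in> borel_measurable M"
  unfolding ennpowr_def by measurable

lemma ennpowr_mono: "0 \<le> p \<Longrightarrow> x \<le> y \<Longrightarrow> ennpowr x p \<le> ennpowr y p"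
  by (cases x; cases y) (auto simp: powr_mono2 ennreal_leI top_unique)

text \<open>The conventions at the end points, 0 to 0 and \<infinity> to \<infinity> for every
  exponent, even p \<le> 0, are what lets this and the two exponent laws below hold without sign
  conditions.\<close>

lemma ennpowr_mult: "ennpowr (x * y) p = ennpowr x p * ennpowr y p"
proof (cases x; cases y)
  fix a b assume *: "x = ennreal a" "0 \<le> a" "y = ennreal b" "0 \<le> b"
  have "ennpowr (x * y) p = ennpowr (ennreal (a * b)) p" using * by (simp add: ennreal_mult)
  also have "\<dots> = ennreal (a powr p * b powr p)" using * by (simp only: ennpowr_ennreal mult_nonneg_nonneg powr_mult)
  finally show ?thesis using * by (simp add: ennreal_mult)
qed (auto simp: ennreal_mult_top ennreal_top_mult)

lemma ennpowr_ennpowr: "ennpowr (ennpowr x p) r = ennpowr x (p * r)"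
  by (cases x) (auto simp: powr_powr)

lemma ennpowr_1 [simp]: "ennpowr x 1 = x"
  by (cases x) auto

lemma ennpowr_add: "ennpowr x (p + r) = ennpowr x p * ennpowr x r"
  by (cases x) (auto simp: powr_add ennreal_mult)

lemma ennpowr_le_iff:
  assumes "0 < p"
  shows "ennpowr x p \<le> y \<longleftrightarrow> x \<le> ennpowr y (1 / p)"
  using ennpowr_mono[of "1 / p" "ennpowr x p" y] ennpowr_mono[of p x "ennpowr y (1 / p)"] assms
  by (auto simp: ennpowr_ennpowr)

text \<open>For p > 0 the power is an order isomorphism of [0, \<infinity>] with inverse exponent 1
  / p, so it preserves arbitrary suprema.\<close>

lemma ennpowr_SUP:
  assumes "0 < p"
  shows "ennpowr (SUP i\<in>I. v i) p = (SUP i\<in>I. ennpowr (v i) p)"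
proof (rule antisym)
  have "v i \<le> ennpowr (SUP i\<in>I. ennpowr (v i) p) (1 / p)" if "i \<in> I" for i
    using that assms by (subst ennpowr_le_iff[symmetric]) (auto intro: SUP_upper)
  thus "ennpowr (SUP i\<in>I. v i) p \<le> (SUP i\<in>I. ennpowr (v i) p)"
    using assms by (simp add: ennpowr_le_iff SUP_le_iff)
  show "(SUP i\<in>I. ennpowr (v i) p) \<le> ennpowr (SUP i\<in>I. v i) p"
    using assms by (intro SUP_least ennpowr_mono SUP_upper) auto
qed

lemma ennpowr_eq_top_iff [simp]: "ennpowr x p = \<top> \<longleftrightarrow> x = \<top>"
  by (cases x) auto

text \<open>From x + y \<le> 2 max x y. It replaces the triangle inequality of
  \<open>L\<^sub>q\<close> in the iteration, at the price of a factor 2 in the smallness condition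
  \<open>small\<close>.\<close>

lemma ennpowr_add_le:
  assumes "0 < p"
  shows "ennpowr (x + y) p \<le> ennreal (2 powr p) * (ennpowr x p + ennpowr y p)"
proof -
  have "x + y \<le> 2 * max x y" by (simp add: mult_2 add_mono)
  hence "ennpowr (x + y) p \<le> ennpowr (ennreal 2 * max x y) p"
    using assms by (intro ennpowr_mono) auto
  also have "\<dots> = ennreal (2 powr p) * ennpowr (max x y) p"
    by (simp only: ennpowr_mult ennpowr_ennreal)
  also have "ennpowr (max x y) p \<le> ennpowr x p + ennpowr y p"
    by (auto simp: max_def add_increasing add_increasing2)
  finally show ?thesis by (simp add: mult_left_mono)
qed

text \<open>Integrate the tangent of the convex power at the mean c. Its constant (q - 1) c powr q
  is non-negative and stands on the larger side, so total mass at most 1 suffices; for G no more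
  than this is proved.\<close>

lemma ennpowr_Jensen:
  assumes [measurable]: "w \<in> borel_measurable M" "h \<in> borel_measurable M"
    and w: "(\<integral>\<^sup>+a. w a \<partial>M) \<le> 1" and q: "1 \<le> q"
  shows "ennpowr (\<integral>\<^sup>+a. w a * h a \<partial>M) q \<le> (\<integral>\<^sup>+a. w a * ennpowr (h a) q \<partial>M)"
proof (cases "(\<integral>\<^sup>+a. w a * ennpowr (h a) q \<partial>M)")
  case (real H)
  \<comment> \<open>Makes the mean c finite, so that the final inequality can be moved to the reals
    and terms in c powr q cancelled.\<close>
  have "h a \<le> 1 + ennpowr (h a) q" for a
  proof (cases "h a")
    case (real z)
    have "z \<le> 1 + z powr q"
    proof (cases "z \<le> 1")
      case False
      hence "z powr 1 \<le> z powr q" using q by (intro powr_mono) auto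
      thus ?thesis using False by simp
    qed (simp add: add_increasing2)
    thus ?thesis using real by (simp flip: ennreal_1 ennreal_plus)
  qed simp
  hence "(\<integral>\<^sup>+a. w a * h a \<partial>M) \<le> (\<integral>\<^sup>+a. w a + w a * ennpowr (h a) q \<partial>M)"
    by (intro nn_integral_mono) (metis distrib_left mult.right_neutral mult_left_mono zero_le)
  also have "\<dots> = (\<integral>\<^sup>+a. w a \<partial>M) + ennreal H"
    by (subst nn_integral_add) (auto simp: real)
  also have "\<dots> \<le> 1 + ennreal H" using w by (rule add_right_mono)
  also have "\<dots> < \<top>" by simp
  finally obtain c where c: "(\<integral>\<^sup>+a. w a * h a \<partial>M) = ennreal c" "0 \<le> c"
    by (cases "\<integral>\<^sup>+a. w a * h a \<partial>M") auto
  show ?thesis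
  proof (cases "c = 0")
    case False
    hence "c > 0" using c by simp
    \<comment> \<open>The tangent of z powr q at z = c. It is the weighted arithmetic-geometric mean
      inequality for z powr q and c powr q with weights 1 / q and 1 - 1 / q.\<close>
    have tangent: "ennreal (q * c powr (q - 1)) * h a \<le> ennpowr (h a) q + ennreal ((q - 1) * c powr q)" for a
    proof (cases "h a")
      case (real z)
      have "z * c powr (q - 1) \<le> (1 / q) * z powr q + (1 - 1 / q) * c powr q"
      proof (cases "z = 0")
        case False
        have "(z powr q) powr (1 / q) * (c powr q) powr (1 - 1 / q) \<le> (1 / q) * z powr q + (1 - 1 / q) * c powr q"
          using q \<open>c > 0\<close> False by (intro Youngs_inequality_0) auto
        moreover have "(z powr q) powr (1 / q) = z" "(c powr q) powr (1 - 1 / q) = c powr (q - 1)"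
          using q real by (simp_all add: powr_powr right_diff_distrib)
        ultimately show ?thesis by simp
      qed (use q in simp)
      hence "q * (z * c powr (q - 1)) \<le> q * ((1 / q) * z powr q + (1 - 1 / q) * c powr q)"
        using q by (intro mult_left_mono) auto
      also have "\<dots> = z powr q + (q - 1) * c powr q"
        using q by (simp add: distrib_left left_diff_distrib right_diff_distrib flip: mult.assoc)
      finally have "q * c powr (q - 1) * z \<le> z powr q + (q - 1) * c powr q"
        by (simp add: mult_ac)
      thus ?thesis using real q by (simp flip: ennreal_mult ennreal_plus)
    qed simp
    have "ennreal (q * c powr (q - 1)) * ennreal c
        = (\<integral>\<^sup>+a. w a * (ennreal (q * c powr (q - 1)) * h a) \<partial>M)"
      unfolding c(1)[symmetric] by (subst nn_integral_cmult[symmetric]) (auto simp: mult_ac)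
    also have "\<dots> \<le> (\<integral>\<^sup>+a. w a * (ennpowr (h a) q + ennreal ((q - 1) * c powr q)) \<partial>M)"
      by (intro nn_integral_mono mult_left_mono tangent) auto
    also have "\<dots> = (\<integral>\<^sup>+a. w a * ennpowr (h a) q \<partial>M) + (\<integral>\<^sup>+a. w a \<partial>M) * ennreal ((q - 1) * c powr q)"
      by (simp add: distrib_left nn_integral_add nn_integral_multc)
    also have "\<dots> \<le> ennreal H + 1 * ennreal ((q - 1) * c powr q)"
      unfolding real by (intro add_left_mono mult_right_mono w) auto
    also have "\<dots> = ennreal (H + (q - 1) * c powr q)"
      using q \<open>0 \<le> H\<close> by (simp add: ennreal_plus)
    finally have "ennreal (q * c powr (q - 1) * c) \<le> ennreal (H + (q - 1) * c powr q)"
      using q c(2) by (simp add: ennreal_mult)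
    hence "q * c powr (q - 1) * c \<le> H + (q - 1) * c powr q"
      using q \<open>0 \<le> H\<close> by (subst (asm) ennreal_le_iff) auto
    moreover have "c powr (q - 1) * c = c powr q"
      using \<open>c > 0\<close> by (simp add: powr_diff)
    hence "q * c powr (q - 1) * c = q * c powr q" by (simp only: mult.assoc)
    ultimately have "c powr q \<le> H" by (simp add: left_diff_distrib)
    thus ?thesis using c real by (simp add: ennreal_leI)
  qed (use c in simp)
qed simp

text \<open>Jensen for the weight \<open>n a / N\<close> on \<open>A\<close>, applied to
  \<open>F a x * (N / n a)\<close>. The majorant n of the norms is an input, positive so that it can
  be divided by; no duality argument is then needed.\<close>

lemma nn_integral_Minkowski:
  fixes n :: "'a \<Rightarrow> real"
  assumes "sigma_finite_measure M" "sigma_finite_measure L"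
    and F[measurable]: "(\<lambda>(a, x). F a x) \<in> borel_measurable (M \<Otimes>\<^sub>M L)"
    and A[measurable]: "A \<in> sets M" and n[measurable]: "n \<in> borel_measurable M"
    and pos: "\<And>a. a \<in> A \<Longrightarrow> n a > 0" and N: "N > 0" "(\<integral>\<^sup>+a\<in>A. ennreal (n a) \<partial>M) \<le> ennreal N"
    and q: "1 \<le> q"
    and bd: "AE a in M. a \<in> A \<longrightarrow> (\<integral>\<^sup>+x. ennpowr (F a x) q \<partial>L) \<le> ennreal (n a powr q)"
  shows "(\<integral>\<^sup>+x. ennpowr (\<integral>\<^sup>+a\<in>A. F a x \<partial>M) q \<partial>L) \<le> ennreal (N powr q)"
proof -
  interpret pair_sigma_finite M L using assms by (simp add: pair_sigma_finite_def)
  define w where "w a = ennreal (n a / N) * indicator A a" for a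
  have [measurable]: "w \<in> borel_measurable M" unfolding w_def by measurable
  have "(\<integral>\<^sup>+a. w a \<partial>M) = (\<integral>\<^sup>+a. ennreal (1 / N) * (ennreal (n a) * indicator A a) \<partial>M)"
    unfolding w_def using N pos
    by (intro nn_integral_cong) (auto simp: indicator_def less_imp_le simp flip: ennreal_mult)
  also have "\<dots> \<le> ennreal (1 / N) * ennreal N"
    using N by (subst nn_integral_cmult) (auto intro: mult_left_mono)
  also have "\<dots> = 1" using N by (simp flip: ennreal_mult)
  finally have w1: "(\<integral>\<^sup>+a. w a \<partial>M) \<le> 1" .
  have split: "F a x * indicator A a = w a * (F a x * ennreal (N / n a))" for a x
  proof (cases "a \<in> A")
    case True
    hence "ennreal (n a / N) * ennreal (N / n a) = 1"
      using pos[of a] N by (simp flip: ennreal_mult)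
    thus ?thesis using True by (simp add: w_def mult.left_commute)
  qed (simp add: w_def)
  have weight: "w a * ennpowr (F a x * ennreal (N / n a)) q
    = ennreal ((N / n a) powr (q - 1)) * indicator A a * ennpowr (F a x) q" for a x
  proof (cases "a \<in> A")
    case True
    hence "n a / N * (N / n a) powr q = (N / n a) powr (q - 1)"
      using pos[of a] N by (simp add: powr_diff)
    hence "ennreal (n a / N) * ennreal ((N / n a) powr q) = ennreal ((N / n a) powr (q - 1))"
      using pos[of a] N True by (simp flip: ennreal_mult)
    thus ?thesis using True pos[of a] N by (simp add: w_def ennpowr_mult) (metis mult.assoc mult.commute)
  qed (simp add: w_def)
  have "(\<integral>\<^sup>+x. ennpowr (\<integral>\<^sup>+a\<in>A. F a x \<partial>M) q \<partial>L)
      \<le> (\<integral>\<^sup>+x. (\<integral>\<^sup>+a. w a * ennpowr (F a x * ennreal (N / n a)) q \<partial>M) \<partial>L)"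
    unfolding split by (intro nn_integral_mono ennpowr_Jensen w1 q) auto
  also have "\<dots> = (\<integral>\<^sup>+a. (\<integral>\<^sup>+x. ennreal ((N / n a) powr (q - 1)) * indicator A a * ennpowr (F a x) q \<partial>L) \<partial>M)"
    unfolding weight by (rule Fubini') measurable
  also have "\<dots> = (\<integral>\<^sup>+a. ennreal ((N / n a) powr (q - 1)) * indicator A a * (\<integral>\<^sup>+x. ennpowr (F a x) q \<partial>L) \<partial>M)"
    by (intro nn_integral_cong nn_integral_cmult) auto
  also have "\<dots> \<le> (\<integral>\<^sup>+a. ennreal (N powr (q - 1)) * (ennreal (n a) * indicator A a) \<partial>M)"
  proof (rule nn_integral_mono_AE, use bd in eventually_elim)
    fix a assume *: "a \<in> A \<longrightarrow> (\<integral>\<^sup>+x. ennpowr (F a x) q \<partial>L) \<le> ennreal (n a powr q)"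
    show "ennreal ((N / n a) powr (q - 1)) * indicator A a * (\<integral>\<^sup>+x. ennpowr (F a x) q \<partial>L)
      \<le> ennreal (N powr (q - 1)) * (ennreal (n a) * indicator A a)"
    proof (cases "a \<in> A")
      case True
      have "ennreal ((N / n a) powr (q - 1)) * (\<integral>\<^sup>+x. ennpowr (F a x) q \<partial>L)
        \<le> ennreal ((N / n a) powr (q - 1)) * ennreal (n a powr q)"
        using * True by (intro mult_left_mono) auto
      also have "\<dots> = ennreal (N powr (q - 1)) * ennreal (n a)"
        using pos[OF True] N by (simp add: powr_divide powr_diff flip: ennreal_mult)
      finally show ?thesis using True by simp
    qed simp
  qed
  also have "\<dots> \<le> ennreal (N powr (q - 1)) * ennreal N"
    by (subst nn_integral_cmult) (auto intro!: mult_left_mono N)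
  also have "\<dots> = ennreal (N powr q)"
    using N by (simp add: powr_diff flip: ennreal_mult)
  finally show ?thesis .
qed

section \<open>Reflections, translations and convolution\<close>

lemma lborel_distr_reflect: "distr lborel borel (\<lambda>y. x - y) = (lborel :: 'a::euclidean_space measure)"
  using lborel_affine[of "-1" x] by (simp add: density_1 one_ennreal_def[symmetric])

lemma nn_integral_reflect:
  fixes F :: "'a::euclidean_space \<Rightarrow> ennreal"
  assumes "F \<in> borel_measurable borel"
  shows "(\<integral>\<^sup>+y. F (x - y) \<partial>lborel) = (\<integral>\<^sup>+y. F y \<partial>lborel)"
  using assms by (subst (2) lborel_distr_reflect[of x, symmetric]) (simp add: nn_integral_distr)

lemma nn_integral_shift:
  fixes F :: "'a::euclidean_space \<Rightarrow> ennreal"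
  assumes [measurable]: "F \<in> borel_measurable borel"
  shows "(\<integral>\<^sup>+y. F (y - x) \<partial>lborel) = (\<integral>\<^sup>+y. F y \<partial>lborel)"
  using nn_integral_reflect[of "\<lambda>y. F (- y)" x] nn_integral_reflect[of F 0] by simp

lemma AE_reflect:
  fixes x :: "'a::euclidean_space"
  assumes "AE y in lborel. P y"
  shows "AE y in lborel. P (x - y)"
proof -
  have "AE y in distr lborel borel (\<lambda>y. x - y). P y" by (subst lborel_distr_reflect) (rule assms)
  thus ?thesis by (rule AE_distrD[rotated]) simp
qed

text \<open>Jensen with the weight K (x - y) bounds the r-th power of K * h by e = K * (h powr r).
  The bound on K gives e \<le> B H powr r, the mass of K gives that e has integral at most H powr r,
  and the power q / r of e is split into 1 and q / r - 1 to use both.\<close>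

lemma nn_integral_Young:
  fixes K h :: "'a::euclidean_space \<Rightarrow> ennreal"
  assumes [measurable]: "K \<in> borel_measurable borel" "h \<in> borel_measurable borel"
    and K: "(\<integral>\<^sup>+x. K x \<partial>lborel) \<le> 1" "\<And>x. K x \<le> ennreal B" "B > 0"
    and r: "1 \<le> r" "r \<le> q" and H: "H > 0" "(\<integral>\<^sup>+x. ennpowr (h x) r \<partial>lborel) \<le> ennreal (H powr r)"
  shows "(\<integral>\<^sup>+x. ennpowr (\<integral>\<^sup>+y. K (x - y) * h y \<partial>lborel) q \<partial>lborel)
    \<le> ennreal ((B powr (1 / r - 1 / q) * H) powr q)"
proof -
  define e where "e x = (\<integral>\<^sup>+y. K (x - y) * ennpowr (h y) r \<partial>lborel)" for x
  have [measurable]: "e \<in> borel_measurable borel" unfolding e_def by measurable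
  have "e x \<le> (\<integral>\<^sup>+y. ennreal B * ennpowr (h y) r \<partial>lborel)" for x
    unfolding e_def by (intro nn_integral_mono mult_right_mono K) auto
  also have "\<dots> \<le> ennreal B * ennreal (H powr r)"
    using H by (subst nn_integral_cmult) (auto intro: mult_left_mono)
  finally have e_bd: "e x \<le> ennreal (B * H powr r)" for x using K by (simp add: ennreal_mult)
  have "(\<integral>\<^sup>+x. e x \<partial>lborel) = (\<integral>\<^sup>+y. (\<integral>\<^sup>+x. K (x - y) * ennpowr (h y) r \<partial>lborel) \<partial>lborel)"
    unfolding e_def by (rule lborel_pair.Fubini') measurable
  also have "\<dots> = (\<integral>\<^sup>+y. (\<integral>\<^sup>+x. K x \<partial>lborel) * ennpowr (h y) r \<partial>lborel)"
    by (simp add: nn_integral_multc nn_integral_shift)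
  also have "\<dots> \<le> (\<integral>\<^sup>+y. 1 * ennpowr (h y) r \<partial>lborel)"
    by (intro nn_integral_mono mult_right_mono K) auto
  finally have e_int: "(\<integral>\<^sup>+x. e x \<partial>lborel) \<le> ennreal (H powr r)" using H by simp
  have "ennpowr (\<integral>\<^sup>+y. K (x - y) * h y \<partial>lborel) q \<le> e x * ennreal ((B * H powr r) powr (q / r - 1))" for x
  proof -
    have "ennpowr (\<integral>\<^sup>+y. K (x - y) * h y \<partial>lborel) r \<le> e x"
      unfolding e_def using K r by (intro ennpowr_Jensen) (auto simp: nn_integral_reflect)
    hence "ennpowr (ennpowr (\<integral>\<^sup>+y. K (x - y) * h y \<partial>lborel) r) (q / r) \<le> ennpowr (e x) (q / r)"
      using r by (intro ennpowr_mono) auto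
    hence "ennpowr (\<integral>\<^sup>+y. K (x - y) * h y \<partial>lborel) q \<le> ennpowr (e x) (1 + (q / r - 1))"
      using r by (simp add: ennpowr_ennpowr)
    also have "\<dots> = e x * ennpowr (e x) (q / r - 1)"
      unfolding ennpowr_add by simp
    also have "\<dots> \<le> e x * ennpowr (ennreal (B * H powr r)) (q / r - 1)"
      using r e_bd by (intro mult_left_mono ennpowr_mono) auto
    finally show ?thesis using K H by simp
  qed
  hence "(\<integral>\<^sup>+x. ennpowr (\<integral>\<^sup>+y. K (x - y) * h y \<partial>lborel) q \<partial>lborel)
     \<le> (\<integral>\<^sup>+x. e x * ennreal ((B * H powr r) powr (q / r - 1)) \<partial>lborel)"
    by (intro nn_integral_mono)
  also have "\<dots> \<le> ennreal (H powr r) * ennreal ((B * H powr r) powr (q / r - 1))"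
    using e_int by (subst nn_integral_multc) (auto intro: mult_right_mono)
  also have "\<dots> = ennreal ((B powr (1 / r - 1 / q) * H) powr q)"
  proof -
    have "H powr r * (B * H powr r) powr (q / r - 1) = H powr r * (H powr r) powr (q / r - 1) * B powr (q / r - 1)"
      using K H by (simp add: powr_mult)
    also have "H powr r * (H powr r) powr (q / r - 1) = H powr q"
      using H r by (simp add: powr_powr algebra_simps flip: powr_add)
    also have "H powr q * B powr (q / r - 1) = (B powr (1 / r - 1 / q) * H) powr q"
    proof -
      have "q / r - 1 = (1 / r - 1 / q) * q" using r by (simp add: field_simps)
      thus ?thesis using K H by (simp only: powr_mult powr_powr) (simp add: mult.commute)
    qed
    finally show ?thesis by (simp flip: ennreal_mult)
  qed
  finally show ?thesis .
qed

subsection \<open>Laplace transforms and Abel kernels\<close>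

text \<open>On [-1, 1] all absolute moments are at most 1, so the Taylor sums of the characteristic
  function, which see only the moments, converge to it with error at most 2 \<bar>t\<bar> ^ n /
  n!.\<close>

lemma moments_unique:
  assumes "real_distribution M" "real_distribution N"
    and M: "AE x in M. \<bar>x\<bar> \<le> 1" and N: "AE x in N. \<bar>x\<bar> \<le> 1"
    and eq: "\<And>n::nat. (\<integral>x. x ^ n \<partial>M) = (\<integral>x. x ^ n \<partial>N)"
  shows "M = N"
proof (rule Levy_uniqueness[OF assms(1,2)], rule ext)
  fix t :: real
  interpret M: real_distribution M by fact
  interpret N: real_distribution N by fact
  let ?S = "\<lambda>n. \<Sum>k\<le>n. (\<i> * t) ^ k / fact k * complex_of_real (\<integral>x. x ^ k \<partial>M)"
  have pow: "norm (x ^ n) \<le> 1" if "\<bar>x\<bar> \<le> 1" for x :: real and n :: nat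
    using power_le_one[OF abs_ge_zero that] by (simp add: power_abs)
  have approx: "cmod (char L t - ?S n) \<le> 2 * \<bar>t\<bar> ^ n / fact n"
    if "real_distribution L" and L: "AE x in L. \<bar>x\<bar> \<le> 1"
      and "\<And>n::nat. (\<integral>x. x ^ n \<partial>L) = (\<integral>x. x ^ n \<partial>M)" for L n
  proof -
    interpret L: real_distribution L by fact
    have int: "integrable L (\<lambda>x. x ^ k)" for k :: nat
      by (rule L.integrable_const_bound[of _ 1]) (use L pow in \<open>auto elim!: eventually_mono\<close>)
    have "L.expectation (\<lambda>x. \<bar>x\<bar> ^ n) \<le> L.expectation (\<lambda>x. 1)"
      using int[of n] L pow
      by (intro integral_mono_AE) (auto elim!: eventually_mono simp: power_abs[symmetric])
    hence le1: "L.expectation (\<lambda>x. \<bar>x\<bar> ^ n) \<le> 1"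
      using L.prob_space by simp
    have "cmod (char L t - ?S n) \<le> (2 * \<bar>t\<bar> ^ n / fact n) * L.expectation (\<lambda>x. \<bar>x\<bar> ^ n)"
      using L.char_approx1[OF int, where n = n and t = t] that(3) by simp
    also have "\<dots> \<le> (2 * \<bar>t\<bar> ^ n / fact n) * 1"
      by (intro mult_left_mono le1) auto
    finally show ?thesis by simp
  qed
  have lim: "(\<lambda>n. 2 * \<bar>t\<bar> ^ n / fact n) \<longlonglongrightarrow> 0"
    using tendsto_mult_right_zero[OF summable_LIMSEQ_zero[OF summable_exp[of "\<bar>t\<bar>"]], of 2]
    by (simp add: field_simps)
  have conv: "?S \<longlonglongrightarrow> char L t"
    if "real_distribution L" "AE x in L. \<bar>x\<bar> \<le> 1" "\<And>n::nat. (\<integral>x. x ^ n \<partial>L) = (\<integral>x. x ^ n \<partial>M)" for L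
  proof -
    have "(\<lambda>n. ?S n - char L t) \<longlonglongrightarrow> 0"
      by (rule Lim_null_comparison[OF _ lim]) (use approx[OF that] in \<open>simp add: norm_minus_commute\<close>)
    thus ?thesis by (rule LIM_zero_cancel)
  qed
  show "char M t = char N t"
    by (rule LIMSEQ_unique[OF conv conv]) (use assms in auto)
qed

text \<open>The change of variables x = exp (- s) turns Laplace transforms at integers into moments
  of a law on [0, 1], which determine it.\<close>

lemma Laplace_unique:
  fixes a b :: "real \<Rightarrow> ennreal"
  assumes [measurable]: "a \<in> borel_measurable borel" "b \<in> borel_measurable borel"
    and eq: "\<And>n::nat. n \<ge> 1 \<Longrightarrow> (\<integral>\<^sup>+s\<in>{0<..}. ennreal (exp (- real n * s)) * a s \<partial>lborel)
      = (\<integral>\<^sup>+s\<in>{0<..}. ennreal (exp (- real n * s)) * b s \<partial>lborel)"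
    and fin: "(\<integral>\<^sup>+s\<in>{0<..}. ennreal (exp (- s)) * a s \<partial>lborel) = ennreal m" "m > 0"
  shows "AE s in lborel. s > 0 \<longrightarrow> a s = b s"
proof -
  \<comment> \<open>The factor exp (- s) / m makes \<open>M a\<close> a probability and uses up one
    exponential: moment n is the transform at \<open>Suc n\<close>. The transform at 0, which may be
    infinite, is never consulted.\<close>
  define M where "M c = density lborel (\<lambda>s. ennreal (exp (- s) / m) * c s * indicator {0<..} s)" for c :: "real \<Rightarrow> ennreal"
  have [measurable_cong, simp]: "sets (M c) = sets borel" "space (M c) = UNIV" for c by (simp_all add: M_def)
  have M_nn: "(\<integral>\<^sup>+x. h (exp (- x)) \<partial>M c) = (\<integral>\<^sup>+s. ennreal (exp (- s) / m) * c s * indicator {0<..} s * h (exp (- s)) \<partial>lborel)"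
    if [measurable]: "c \<in> borel_measurable borel" "h \<in> borel_measurable borel" for c and h :: "real \<Rightarrow> ennreal"
    unfolding M_def by (subst nn_integral_density) auto
  have mom: "(\<integral>\<^sup>+x. ennreal (exp (- x) ^ n) \<partial>M c)
      = ennreal (1 / m) * (\<integral>\<^sup>+s\<in>{0<..}. ennreal (exp (- real (Suc n) * s)) * c s \<partial>lborel)"
    if [measurable]: "c \<in> borel_measurable borel" for c n
  proof -
    have "(\<integral>\<^sup>+x. ennreal (exp (- x) ^ n) \<partial>M c)
      = (\<integral>\<^sup>+s. ennreal (exp (- s) / m) * c s * indicator {0<..} s * ennreal (exp (- s) ^ n) \<partial>lborel)"
      by (rule M_nn) auto
    also have "\<dots> = (\<integral>\<^sup>+s. ennreal (1 / m) * (ennreal (exp (- real (Suc n) * s)) * c s * indicator {0<..} s) \<partial>lborel)"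
    proof (rule nn_integral_cong)
      fix s
      have "exp (- s) / m * exp (- s) ^ n = 1 / m * exp (- real (Suc n) * s)"
        by (simp add: algebra_simps exp_of_nat_mult[symmetric] flip: exp_add)
      hence "ennreal (exp (- s) / m) * ennreal (exp (- s) ^ n) = ennreal (1 / m) * ennreal (exp (- real (Suc n) * s))"
        using fin by (simp flip: ennreal_mult)
      thus "ennreal (exp (- s) / m) * c s * indicator {0<..} s * ennreal (exp (- s) ^ n)
        = ennreal (1 / m) * (ennreal (exp (- real (Suc n) * s)) * c s * indicator {0<..} s)"
        by (metis (no_types, lifting) mult.assoc mult.commute)
    qed
    also have "\<dots> = ennreal (1 / m) * (\<integral>\<^sup>+s\<in>{0<..}. ennreal (exp (- real (Suc n) * s)) * c s \<partial>lborel)"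
      by (rule nn_integral_cmult) measurable
    finally show ?thesis .
  qed
  have mom_eq: "(\<integral>\<^sup>+x. ennreal (exp (- x) ^ n) \<partial>M a) = (\<integral>\<^sup>+x. ennreal (exp (- x) ^ n) \<partial>M b)" for n
    using eq[of "Suc n"] by (simp only: mom assms(1,2))
  have mass: "emeasure (M a) UNIV = 1"
    using mom[of a 0] fin by (simp add: ennreal_mult[symmetric])
  hence mass': "emeasure (M b) UNIV = 1"
    using mom_eq[of 0] by simp
  define D where "D c = distr (M c) borel (\<lambda>s. exp (- s))" for c
  have "prob_space (M a)" "prob_space (M b)"
    using mass mass' by (auto intro!: prob_spaceI)
  hence D: "real_distribution (D a)" "real_distribution (D b)"
    unfolding D_def by (auto intro!: prob_space.real_distribution_distr)
  have pos: "AE x in D c. \<bar>x\<bar> \<le> 1" if [measurable]: "c \<in> borel_measurable borel" for c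
  proof -
    have "AE s in M c. s > 0"
      unfolding M_def by (subst AE_density) (auto intro!: AE_I2 simp: indicator_def split: if_splits)
    hence "AE s in M c. \<bar>exp (- s)\<bar> \<le> 1" by eventually_elim simp
    thus ?thesis unfolding D_def by (subst AE_distr_iff) measurable
  qed
  have "D a = D b"
  proof (rule moments_unique[OF D])
    fix n :: nat
    have "(\<integral>x. x ^ n \<partial>D c) = enn2real (\<integral>\<^sup>+x. ennreal (exp (- x) ^ n) \<partial>M c)" for c
      unfolding D_def by (subst integral_distr) (auto intro!: integral_eq_nn_integral)
    thus "(\<integral>x. x ^ n \<partial>D a) = (\<integral>x. x ^ n \<partial>D b)" using mom_eq by simp
  qed (auto intro!: pos)
  \<comment> \<open>Pushing forward by the inverse of exp (- s) recovers the weighted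
    densities.\<close>
  hence "distr (D a) borel (\<lambda>x. - ln x) = distr (D b) borel (\<lambda>x. - ln x)" by simp
  moreover have "distr (D c) borel (\<lambda>x. - ln x) = M c" for c
    unfolding D_def by (subst distr_distr) (auto simp: comp_def intro!: distr_id2)
  ultimately have "M a = M b" by simp
  hence "AE s in lborel. ennreal (exp (- s) / m) * a s * indicator {0<..} s = ennreal (exp (- s) / m) * b s * indicator {0<..} s"
    unfolding M_def by (intro sigma_finite_measure.density_unique[OF sigma_finite_lborel]) measurable
  thus ?thesis
    using fin by (auto elim!: eventually_mono simp: indicator_def ennreal_mult_cancel_left split: if_splits)
qed

text \<open>Cut off to the positive half line, so that a fractional integral is a convolution over
  the whole line and no domain depends on t.\<close>

definition abel_kernel :: "real \<Rightarrow> real \<Rightarrow> ennreal" where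
  "abel_kernel \<rho> t = ennreal (g_frac \<rho> t) * indicator {0<..} t"

lemma measurable_abel_kernel [measurable]: "abel_kernel \<rho> \<in> borel_measurable borel"
  unfolding abel_kernel_def g_frac_def by measurable

lemma Laplace_abel_kernel:
  assumes "\<rho> > 0" "l > 0"
  shows "(\<integral>\<^sup>+t. ennreal (exp (- l * t)) * abel_kernel \<rho> t \<partial>lborel) = ennreal (l powr (- \<rho>))"
proof -
  have "(\<integral>\<^sup>+t. ennreal (exp (- l * t)) * abel_kernel \<rho> t \<partial>lborel)
    = (\<integral>\<^sup>+t. ennreal (1 / Gamma \<rho>) * (ennreal (t powr (\<rho> - 1) * exp (- l * t)) * indicator {0<..} t) \<partial>lborel)"
    unfolding abel_kernel_def g_frac_def using Gamma_real_pos[OF assms(1)]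
    by (intro nn_integral_cong) (auto simp: indicator_def field_simps simp flip: ennreal_mult)
  also have "\<dots> = ennreal (1 / Gamma \<rho>) *
      (\<integral>\<^sup>+t\<in>{0<..}. ennreal (t powr (\<rho> - 1) * exp (- l * t)) \<partial>lborel)"
    by (rule nn_integral_cmult) measurable
  also have "(\<integral>\<^sup>+t\<in>{0<..}. ennreal (t powr (\<rho> - 1) * exp (- l * t)) \<partial>lborel) = ennreal (Gamma \<rho> * l powr (- \<rho>))"
    using assms by (rule nn_integral_powr_exp)
  also have "ennreal (1 / Gamma \<rho>) * ennreal (Gamma \<rho> * l powr (- \<rho>))
      = ennreal (1 / Gamma \<rho> * (Gamma \<rho> * l powr (- \<rho>)))"
    using Gamma_real_pos[OF assms(1)] by (intro ennreal_mult[symmetric]) auto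
  also have "\<dots> = ennreal (l powr (- \<rho>))"
    using Gamma_real_pos[OF assms(1)] by (simp flip: ennreal_mult)
  finally show ?thesis .
qed

text \<open>Scaling reduces to the interval (0, 1). The case a + b = 1 inverts Abel's equation; the
  general case is the time integral of the Duhamel term.\<close>

lemma nn_integral_beta:
  assumes "a > 0" "b > 0" "t > 0"
  shows "(\<integral>\<^sup>+s\<in>{0<..<t}. ennreal ((t - s) powr (a - 1) * s powr (b - 1)) \<partial>lborel)
    = ennreal (Beta a b * t powr (a + b - 1))"
proof -
  have "((\<lambda>s. s powr (b - 1) * (1 - s) powr (a - 1)) has_integral Beta b a) {0<..<1}"
    using has_integral_Beta_real[of b a] assms by (simp add: has_integral_Icc_iff_Ioo)
  from nn_integral_has_integral_lebesgue[OF _ this]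
  have 1: "(\<integral>\<^sup>+s. ennreal (indicator {0<..<1} s * (s powr (b - 1) * (1 - s) powr (a - 1))) \<partial>lborel) = ennreal (Beta b a)"
    by auto
  have "(\<integral>\<^sup>+s\<in>{0<..<t}. ennreal ((t - s) powr (a - 1) * s powr (b - 1)) \<partial>lborel)
    = ennreal t * (\<integral>\<^sup>+s. ennreal ((t - (0 + t * s)) powr (a - 1) * (0 + t * s) powr (b - 1)) * indicator {0<..<t} (0 + t * s) \<partial>lborel)"
    using assms by (subst nn_integral_real_affine[of _ t 0]) auto
  also have "(\<integral>\<^sup>+s. ennreal ((t - (0 + t * s)) powr (a - 1) * (0 + t * s) powr (b - 1)) * indicator {0<..<t} (0 + t * s) \<partial>lborel)
    = (\<integral>\<^sup>+s. ennreal (t powr (a + b - 2)) * ennreal (indicator {0<..<1} s * (s powr (b - 1) * (1 - s) powr (a - 1))) \<partial>lborel)"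
  proof (rule nn_integral_cong)
    fix s
    show "ennreal ((t - (0 + t * s)) powr (a - 1) * (0 + t * s) powr (b - 1)) * indicator {0<..<t} (0 + t * s)
      = ennreal (t powr (a + b - 2)) * ennreal (indicator {0<..<1} s * (s powr (b - 1) * (1 - s) powr (a - 1)))"
    proof (cases "0 < s \<and> s < 1")
      case True
      have "(t - t * s) powr (a - 1) = t powr (a - 1) * (1 - s) powr (a - 1)"
        using True assms by (simp flip: powr_mult add: algebra_simps)
      moreover have "t powr (a - 1) * t powr (b - 1) = t powr (a + b - 2)" by (simp flip: powr_add)
      ultimately have "(t - t * s) powr (a - 1) * (t * s) powr (b - 1) = t powr (a + b - 2) * (s powr (b - 1) * (1 - s) powr (a - 1))"
        using True assms by (simp add: powr_mult)
      thus ?thesis using True assms by (simp flip: ennreal_mult)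
    next
      case False
      thus ?thesis using assms by (auto simp: indicator_def zero_less_mult_iff)
    qed
  qed
  also have "\<dots> = ennreal (t powr (a + b - 2)) * ennreal (Beta b a)"
    by (subst nn_integral_cmult) (auto simp: 1)
  also have "ennreal t * \<dots> = ennreal (t * t powr (a + b - 2) * Beta b a)"
  proof -
    have "Beta b a \<ge> 0" using assms by (simp add: Beta_def Gamma_real_pos less_imp_le)
    thus ?thesis using assms by (simp add: mult.assoc flip: ennreal_mult)
  qed
  also have "t * t powr (a + b - 2) = t powr (a + b - 1)"
    using assms by (simp add: powr_diff power2_eq_square)
  finally show ?thesis by (simp add: mult.commute Beta_commute)
qed

text \<open>Gamma 1 = 1 makes the Beta value cancel the two normalisations. Convolution with
  \<open>abel_kernel \<rho>\<close> therefore turns a fractional integral of order 1 - \<rho> into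
  an ordinary primitive.\<close>

lemma abel_kernel_convolution:
  assumes "0 < \<rho>" "\<rho> < 1"
  shows "(\<integral>\<^sup>+s. abel_kernel \<rho> (t - s) * abel_kernel (1 - \<rho>) s \<partial>lborel) = indicator {0<..} t"
proof (cases "t > 0")
  case True
  have "(\<integral>\<^sup>+s. abel_kernel \<rho> (t - s) * abel_kernel (1 - \<rho>) s \<partial>lborel)
    = (\<integral>\<^sup>+s. ennreal (1 / (Gamma \<rho> * Gamma (1 - \<rho>))) *
        (ennreal ((t - s) powr (\<rho> - 1) * s powr (1 - \<rho> - 1)) * indicator {0<..<t} s) \<partial>lborel)"
    using Gamma_real_pos[OF assms(1)] Gamma_real_pos[of "1 - \<rho>"] assms
    by (intro nn_integral_cong) (auto simp: abel_kernel_def g_frac_def indicator_def field_simps simp flip: ennreal_mult)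
  also have "\<dots> = ennreal (1 / (Gamma \<rho> * Gamma (1 - \<rho>))) * ennreal (Beta \<rho> (1 - \<rho>) * t powr (\<rho> + (1 - \<rho>) - 1))"
    using assms True by (subst nn_integral_cmult) (auto simp only: nn_integral_beta, auto)
  also have "\<dots> = 1"
    using Gamma_real_pos[OF assms(1)] Gamma_real_pos[of "1 - \<rho>"] assms True
    by (simp add: Beta_def less_imp_neq[symmetric] flip: ennreal_mult)
  finally show ?thesis using True by simp
next
  case False
  hence "abel_kernel \<rho> (t - s) * abel_kernel (1 - \<rho>) s = 0" for s
    by (auto simp: abel_kernel_def indicator_def)
  thus ?thesis using False by (simp del: mult_eq_0_iff)
qed

subsection \<open>One-sided stable laws\<close>

locale stable_law =
  fixes \<alpha> :: real and p :: "real \<Rightarrow> real"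
  assumes \<alpha>: "0 < \<alpha>" "\<alpha> < 1"
    and measurable_p [measurable]: "p \<in> borel_measurable borel"
    and p_nonneg: "\<And>s. s > 0 \<Longrightarrow> 0 \<le> p s"
    and Laplace_p: "\<And>r. r \<ge> 0 \<Longrightarrow>
      (\<integral>\<^sup>+s\<in>{0<..}. ennreal (exp (- r * s)) * ennreal (p s) \<partial>lborel) = ennreal (exp (- (r powr \<alpha>)))"
begin

lemma p_total: "(\<integral>\<^sup>+s\<in>{0<..}. ennreal (p s) \<partial>lborel) = 1"
  using Laplace_p[of 0] \<alpha> by simp

text \<open>Write Gamma a * s powr (- a) as the integral of l powr (a - 1) exp (- s l) over l. By
  Tonelli the moment becomes the integral of l powr (a - 1) exp (- (l powr \<alpha>)), a Gamma
  integral in l powr \<alpha>.\<close>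

lemma negative_moment_finite:
  assumes "a > 0"
  shows "(\<integral>\<^sup>+s\<in>{0<..}. ennreal (s powr (- a)) * ennreal (p s) \<partial>lborel) < \<infinity>"
proof -
  have "(\<integral>\<^sup>+l\<in>{0<..}. ennreal (l powr (a - 1) * exp (- (l powr \<alpha>))) \<partial>lborel)
     = (\<integral>\<^sup>+\<tau>\<in>{0<..}. ennreal ((\<tau> powr (1/\<alpha>)) powr (a - 1) * exp (- ((\<tau> powr (1/\<alpha>)) powr \<alpha>)))
           * ennreal (\<bar>1/\<alpha>\<bar> * \<tau> powr (1/\<alpha> - 1)) \<partial>lborel)"
    using \<alpha> by (intro nn_integral_power_substitution) auto
  also have "\<dots> = (\<integral>\<^sup>+\<tau>. ennreal (1/\<alpha>) * (ennreal (\<tau> powr (a/\<alpha> - 1) * exp (- 1 * \<tau>)) * indicator {0<..} \<tau>) \<partial>lborel)"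
  proof (rule nn_integral_cong)
    fix \<tau> :: real
    have "\<tau> powr ((a - 1)/\<alpha>) * \<tau> powr (1/\<alpha> - 1) = \<tau> powr (a/\<alpha> - 1)"
      by (simp add: diff_divide_distrib flip: powr_add)
    hence "(\<tau> powr (1/\<alpha>)) powr (a - 1) * \<tau> powr (1/\<alpha> - 1) = \<tau> powr (a/\<alpha> - 1)"
      by (simp add: powr_powr)
    thus "ennreal ((\<tau> powr (1/\<alpha>)) powr (a - 1) * exp (- ((\<tau> powr (1/\<alpha>)) powr \<alpha>)))
           * ennreal (\<bar>1/\<alpha>\<bar> * \<tau> powr (1/\<alpha> - 1)) * indicator {0<..} \<tau>
       = ennreal (1/\<alpha>) * (ennreal (\<tau> powr (a/\<alpha> - 1) * exp (- 1 * \<tau>)) * indicator {0<..} \<tau>)"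
      using \<alpha> by (auto simp: indicator_def powr_powr mult_ac simp flip: ennreal_mult)
  qed
  also have "\<dots> = ennreal (1/\<alpha>) * (\<integral>\<^sup>+\<tau>\<in>{0<..}. ennreal (\<tau> powr (a/\<alpha> - 1) * exp (- 1 * \<tau>)) \<partial>lborel)"
    by (rule nn_integral_cmult) measurable
  also have "\<dots> < \<infinity>"
    using nn_integral_powr_exp[of "a/\<alpha>" 1] assms \<alpha> by (simp add: ennreal_mult_less_top)
  finally have fin: "(\<integral>\<^sup>+l\<in>{0<..}. ennreal (l powr (a - 1) * exp (- (l powr \<alpha>))) \<partial>lborel) < \<infinity>" .
  have "ennreal (Gamma a) * (\<integral>\<^sup>+s\<in>{0<..}. ennreal (s powr (- a)) * ennreal (p s) \<partial>lborel)
    = (\<integral>\<^sup>+s. ennreal (Gamma a * s powr (- a)) * (ennreal (p s) * indicator {0<..} s) \<partial>lborel)"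
    using Gamma_real_pos[OF assms]
    by (subst nn_integral_cmult[symmetric]) (auto simp: ennreal_mult mult.assoc)
  also have "\<dots> = (\<integral>\<^sup>+s. (\<integral>\<^sup>+l. ennreal (l powr (a - 1) * exp (- s * l)) * indicator {0<..} l *
      (ennreal (p s) * indicator {0<..} s) \<partial>lborel) \<partial>lborel)"
    using nn_integral_powr_exp[OF assms]
    by (intro nn_integral_cong) (auto simp: nn_integral_multc indicator_def)
  also have "\<dots> = (\<integral>\<^sup>+l. (\<integral>\<^sup>+s. ennreal (l powr (a - 1) * exp (- s * l)) * indicator {0<..} l *
      (ennreal (p s) * indicator {0<..} s) \<partial>lborel) \<partial>lborel)"
    by (rule lborel_pair.Fubini') measurable
  also have "\<dots> = (\<integral>\<^sup>+l. (\<integral>\<^sup>+s. ennreal (l powr (a - 1)) * indicator {0<..} l *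
      (ennreal (exp (- l * s)) * ennreal (p s) * indicator {0<..} s) \<partial>lborel) \<partial>lborel)"
    by (intro nn_integral_cong) (auto simp: indicator_def mult_ac ennreal_mult)
  also have "\<dots> = (\<integral>\<^sup>+l. ennreal (l powr (a - 1)) * indicator {0<..} l *
      (\<integral>\<^sup>+s\<in>{0<..}. ennreal (exp (- l * s)) * ennreal (p s) \<partial>lborel) \<partial>lborel)"
    by (intro nn_integral_cong nn_integral_cmult) measurable
  also have "\<dots> = (\<integral>\<^sup>+l\<in>{0<..}. ennreal (l powr (a - 1) * exp (- (l powr \<alpha>))) \<partial>lborel)"
    using Laplace_p by (intro nn_integral_cong) (auto simp: indicator_def ennreal_mult)
  also note fin
  finally show ?thesis
    using Gamma_real_pos[OF assms] by (auto simp: ennreal_mult_less_top ennreal_eq_0_iff)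
qed

text \<open>Write K * s powr a as the integral of (1 - exp (- l s)) l powr (- a - 1) over l.
  Averaging over p replaces 1 - exp (- l s) by 1 - exp (- (l powr \<alpha>)), of order l powr
  \<alpha> at 0; this is where a < \<alpha> is needed.\<close>

lemma positive_moment_finite:
  assumes "0 < a" "a < \<alpha>"
  shows "(\<integral>\<^sup>+s\<in>{0<..}. ennreal (s powr a) * ennreal (p s) \<partial>lborel) < \<infinity>"
proof -
  define K where "K = (\<integral>\<^sup>+l\<in>{0<..}. ennreal ((1 - exp (- l)) * l powr (- a - 1)) \<partial>lborel)"
  \<comment> \<open>Enough for the conclusion: if a product with a nonzero factor is finite, the
    other factor is finite, whatever is known about finiteness of \<open>K\<close>.\<close>
  have "K \<noteq> 0"
  proof
    assume "K = 0"
    hence "AE l in lborel. ennreal ((1 - exp (- l)) * l powr (- a - 1)) * indicator {0<..} (l::real) = 0"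
      unfolding K_def by (subst (asm) nn_integral_0_iff_AE) auto
    hence "AE l in lborel. l \<notin> {0<..(1::real)}"
      by eventually_elim (auto simp: indicator_def ennreal_eq_0_iff mult_le_0_iff split: if_splits)
    hence "{0<..(1::real)} \<in> null_sets lborel"
      by (subst AE_iff_null_sets) auto
    thus False by (simp add: null_sets_def)
  qed
  have scale: "ennreal (s powr a) * K = (\<integral>\<^sup>+l\<in>{0<..}. ennreal ((1 - exp (- l * s)) * l powr (- a - 1)) \<partial>lborel)"
    if "s > 0" for s
  proof -
    have "K = ennreal s * (\<integral>\<^sup>+l\<in>{0<..}. ennreal ((1 - exp (- (s * l))) * (s * l) powr (- a - 1)) \<partial>lborel)"
      unfolding K_def by (rule nn_integral_scale_half_line) (use that in auto)
    also have "\<dots> = ennreal s * (\<integral>\<^sup>+l. ennreal (s powr (- a - 1)) *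
        (ennreal ((1 - exp (- l * s)) * l powr (- a - 1)) * indicator {0<..} l) \<partial>lborel)"
      using that by (intro arg_cong[where f = "\<lambda>x. ennreal s * x"] nn_integral_cong)
        (auto simp: indicator_def powr_mult mult_ac simp flip: ennreal_mult)
    also have "\<dots> = ennreal (s * s powr (- a - 1)) * (\<integral>\<^sup>+l\<in>{0<..}. ennreal ((1 - exp (- l * s)) * l powr (- a - 1)) \<partial>lborel)"
      using that by (subst nn_integral_cmult) (auto simp: ennreal_mult mult.assoc)
    finally have "ennreal (s powr a) * K = ennreal (s powr a * (s * s powr (- a - 1))) *
        (\<integral>\<^sup>+l\<in>{0<..}. ennreal ((1 - exp (- l * s)) * l powr (- a - 1)) \<partial>lborel)"
      using that by (simp add: ennreal_mult mult.assoc)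
    also have "s powr a * (s * s powr (- a - 1)) = 1"
      using that by (simp add: powr_diff powr_minus)
    finally show ?thesis by simp
  qed
  have one_minus: "(\<integral>\<^sup>+s\<in>{0<..}. ennreal (1 - exp (- l * s)) * ennreal (p s) \<partial>lborel) = ennreal (1 - exp (- (l powr \<alpha>)))"
    if "l > 0" for l
  proof -
    have "ennreal (exp (- (l powr \<alpha>))) + (\<integral>\<^sup>+s\<in>{0<..}. ennreal (1 - exp (- l * s)) * ennreal (p s) \<partial>lborel)
      = (\<integral>\<^sup>+s. (ennreal (exp (- l * s)) + ennreal (1 - exp (- l * s))) * ennreal (p s) * indicator {0<..} s \<partial>lborel)"
      using that unfolding Laplace_p[OF less_imp_le[OF that], symmetric]
      by (subst nn_integral_add[symmetric]) (auto simp: distrib_right)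
    also have "\<dots> = (\<integral>\<^sup>+s\<in>{0<..}. ennreal (p s) \<partial>lborel)"
      using that by (intro nn_integral_cong) (auto simp: indicator_def simp flip: ennreal_plus)
    also have "\<dots> = 1" by (rule p_total)
    finally have "(\<integral>\<^sup>+s\<in>{0<..}. ennreal (1 - exp (- l * s)) * ennreal (p s) \<partial>lborel) = 1 - ennreal (exp (- (l powr \<alpha>)))"
      by (metis ennreal_add_diff_cancel_left ennreal_neq_top)
    thus ?thesis by (simp flip: ennreal_minus)
  qed
  have "(\<integral>\<^sup>+s\<in>{0<..}. ennreal (s powr a) * ennreal (p s) \<partial>lborel) * K
    = (\<integral>\<^sup>+s. ennreal (s powr a) * K * (ennreal (p s) * indicator {0<..} s) \<partial>lborel)"
    by (subst nn_integral_multc[symmetric]) (auto simp: mult_ac)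
  also have "\<dots> = (\<integral>\<^sup>+s. (\<integral>\<^sup>+l. ennreal ((1 - exp (- l * s)) * l powr (- a - 1)) * indicator {0<..} l *
      (ennreal (p s) * indicator {0<..} s) \<partial>lborel) \<partial>lborel)"
    using scale by (intro nn_integral_cong) (auto simp: nn_integral_multc indicator_def)
  also have "\<dots> = (\<integral>\<^sup>+l. (\<integral>\<^sup>+s. ennreal ((1 - exp (- l * s)) * l powr (- a - 1)) * indicator {0<..} l *
      (ennreal (p s) * indicator {0<..} s) \<partial>lborel) \<partial>lborel)"
    by (rule lborel_pair.Fubini') measurable
  also have "\<dots> = (\<integral>\<^sup>+l. (\<integral>\<^sup>+s. ennreal (l powr (- a - 1)) * indicator {0<..} l *
      (ennreal (1 - exp (- l * s)) * ennreal (p s) * indicator {0<..} s) \<partial>lborel) \<partial>lborel)"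
    by (intro nn_integral_cong) (auto simp: indicator_def mult_ac ennreal_mult)
  also have "\<dots> = (\<integral>\<^sup>+l. ennreal (l powr (- a - 1)) * indicator {0<..} l *
      (\<integral>\<^sup>+s\<in>{0<..}. ennreal (1 - exp (- l * s)) * ennreal (p s) \<partial>lborel) \<partial>lborel)"
    by (intro nn_integral_cong nn_integral_cmult) measurable
  also have "\<dots> = (\<integral>\<^sup>+l\<in>{0<..}. ennreal ((1 - exp (- (l powr \<alpha>))) * l powr (- a - 1)) \<partial>lborel)"
    using one_minus by (intro nn_integral_cong) (auto simp: indicator_def ennreal_mult mult_ac)
  also have "\<dots> < \<infinity>"
  proof (rule nn_integral_powr_tails[where b = \<alpha> and C = 1])
    fix s :: real
    show "1 - exp (- (s powr \<alpha>)) \<le> 1 * s powr \<alpha>"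
      using exp_ge_add_one_self[of "- (s powr \<alpha>)"] by simp
  qed (use assms in auto)
  finally show ?thesis using \<open>K \<noteq> 0\<close> by (auto simp: ennreal_mult_less_top)
qed

lemma moment_finite:
  assumes "a < \<alpha>"
  shows "(\<integral>\<^sup>+s\<in>{0<..}. ennreal (s powr a) * ennreal (p s) \<partial>lborel) < \<infinity>"
proof -
  consider "a < 0" | "a = 0" | "a > 0" by linarith
  thus ?thesis
  proof cases
    case 2
    have "(\<integral>\<^sup>+s\<in>{0<..}. ennreal (s powr a) * ennreal (p s) \<partial>lborel) = (\<integral>\<^sup>+s\<in>{0<..}. ennreal (p s) \<partial>lborel)"
      using 2 by (intro nn_integral_cong) (auto simp: indicator_def)
    thus ?thesis by (simp add: p_total)
  qed (use negative_moment_finite[of "- a"] positive_moment_finite[of a] assms in auto)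
qed

abbreviation P :: "real \<Rightarrow> ennreal" where
  "P s \<equiv> ennreal (p s) * indicator {0<..} s"

text \<open>The left side has transform l powr (\<alpha> - 1) exp (- (l powr \<alpha>)), which is -
  1 / \<alpha> times the derivative of the transform of p. Instead of differentiating a transform,
  both sides are divided by t, which integrates their transforms; then \<open>Laplace_unique\<close>
  applies.\<close>

lemma abel_convolution_p:
  "AE t in lborel. t > 0 \<longrightarrow>
     (\<integral>\<^sup>+r. abel_kernel (1 - \<alpha>) (t - r) * P r \<partial>lborel) = ennreal (t / \<alpha>) * ennreal (p t)"
proof -
  define \<phi> where "\<phi> t = (\<integral>\<^sup>+r. abel_kernel (1 - \<alpha>) (t - r) * P r \<partial>lborel)" for t
  have [measurable]: "\<phi> \<in> borel_measurable borel" unfolding \<phi>_def by measurable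
  have "\<phi> t = 0" if "t \<le> 0" for t
  proof -
    have "abel_kernel (1 - \<alpha>) (t - r) * P r = 0" for r
      using that by (auto simp: abel_kernel_def indicator_def)
    thus ?thesis by (simp add: \<phi>_def del: mult_eq_0_iff)
  qed
  have L\<phi>: "(\<integral>\<^sup>+t. ennreal (exp (- l * t)) * \<phi> t \<partial>lborel) = ennreal (l powr (\<alpha> - 1) * exp (- (l powr \<alpha>)))"
    if "l > 0" for l
  proof -
    have "(\<integral>\<^sup>+t. ennreal (exp (- l * t)) * \<phi> t \<partial>lborel)
      = (\<integral>\<^sup>+t. (\<integral>\<^sup>+r. ennreal (exp (- l * (t - r))) * abel_kernel (1 - \<alpha>) (t - r) * (ennreal (exp (- l * r)) * P r) \<partial>lborel) \<partial>lborel)"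
      unfolding \<phi>_def
    proof (intro nn_integral_cong, subst nn_integral_cmult[symmetric], measurable, intro nn_integral_cong)
      fix t r
      have "ennreal (exp (- l * t)) = ennreal (exp (- l * (t - r))) * ennreal (exp (- l * r))"
        by (simp add: algebra_simps flip: ennreal_mult exp_add)
      thus "ennreal (exp (- l * t)) * (abel_kernel (1 - \<alpha>) (t - r) * P r)
        = ennreal (exp (- l * (t - r))) * abel_kernel (1 - \<alpha>) (t - r) * (ennreal (exp (- l * r)) * P r)"
        by (simp only: mult_ac)
    qed
    also have "\<dots> = (\<integral>\<^sup>+r. (\<integral>\<^sup>+t. ennreal (exp (- l * (t - r))) * abel_kernel (1 - \<alpha>) (t - r) * (ennreal (exp (- l * r)) * P r) \<partial>lborel) \<partial>lborel)"
      by (rule lborel_pair.Fubini') measurable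
    also have "\<dots> = (\<integral>\<^sup>+r. (\<integral>\<^sup>+t. ennreal (exp (- l * t)) * abel_kernel (1 - \<alpha>) t \<partial>lborel) * (ennreal (exp (- l * r)) * P r) \<partial>lborel)"
    proof (rule nn_integral_cong)
      fix r
      have "(\<integral>\<^sup>+t. ennreal (exp (- l * (t - r))) * abel_kernel (1 - \<alpha>) (t - r) \<partial>lborel) = (\<integral>\<^sup>+t. ennreal (exp (- l * t)) * abel_kernel (1 - \<alpha>) t \<partial>lborel)"
        by (rule nn_integral_shift) measurable
      thus "(\<integral>\<^sup>+t. ennreal (exp (- l * (t - r))) * abel_kernel (1 - \<alpha>) (t - r) * (ennreal (exp (- l * r)) * P r) \<partial>lborel)
        = (\<integral>\<^sup>+t. ennreal (exp (- l * t)) * abel_kernel (1 - \<alpha>) t \<partial>lborel) * (ennreal (exp (- l * r)) * P r)"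
        by (subst nn_integral_multc) auto
    qed
    also have "\<dots> = ennreal (l powr (\<alpha> - 1)) * (\<integral>\<^sup>+r. ennreal (exp (- l * r)) * P r \<partial>lborel)"
      using Laplace_abel_kernel[of "1 - \<alpha>" l] \<alpha> that by (subst nn_integral_cmult[symmetric]) auto
    also have "(\<integral>\<^sup>+r. ennreal (exp (- l * r)) * P r \<partial>lborel) = ennreal (exp (- (l powr \<alpha>)))"
      using Laplace_p[of l] that by (simp add: mult.assoc)
    finally show ?thesis by (simp flip: ennreal_mult)
  qed
  \<comment> \<open>Division by t corresponds to integrating the transform from n to
    \<infinity>.\<close>
  have inv: "ennreal (1 / t * exp (- n * t)) = (\<integral>\<^sup>+l. ennreal (exp (- l * t)) * indicator {n..} l \<partial>lborel)" if "t > 0" for t n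
  proof -
    have "(\<integral>\<^sup>+l. ennreal (exp (- l * t)) * indicator {n..} l \<partial>lborel) = ennreal (0 - (- (1 / t) * exp (- n * t)))"
    proof (rule nn_integral_FTC_atLeast)
      show "((\<lambda>x. - (1 / t) * exp (- x * t)) \<longlongrightarrow> 0) at_top"
        using that by real_asymp
    qed (use that in \<open>auto intro!: derivative_eq_intros\<close>)
    thus ?thesis by simp
  qed
  have key: "(\<integral>\<^sup>+t\<in>{0<..}. ennreal (exp (- n * t)) * (ennreal (1 / t) * \<phi> t) \<partial>lborel) = ennreal (exp (- (n powr \<alpha>)) / \<alpha>)" if "n > 0" for n
  proof -
    have "(\<integral>\<^sup>+t\<in>{0<..}. ennreal (exp (- n * t)) * (ennreal (1 / t) * \<phi> t) \<partial>lborel)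
      = (\<integral>\<^sup>+t. (\<integral>\<^sup>+l. ennreal (exp (- l * t)) * indicator {n..} l * \<phi> t \<partial>lborel) \<partial>lborel)"
    proof (rule nn_integral_cong)
      fix t
      show "ennreal (exp (- n * t)) * (ennreal (1 / t) * \<phi> t) * indicator {0<..} t
        = (\<integral>\<^sup>+l. ennreal (exp (- l * t)) * indicator {n..} l * \<phi> t \<partial>lborel)"
      proof (cases "t > 0")
        case True
        have "ennreal (exp (- n * t)) * (ennreal (1 / t) * \<phi> t) = ennreal (1 / t * exp (- n * t)) * \<phi> t"
          using True by (subst mult.assoc[symmetric], subst ennreal_mult[symmetric]) (auto simp: mult.commute)
        also have "\<dots> = (\<integral>\<^sup>+l. ennreal (exp (- l * t)) * indicator {n..} l * \<phi> t \<partial>lborel)"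
          unfolding inv[OF True] by (rule nn_integral_multc[symmetric]) measurable
        finally show ?thesis using True by simp
      qed (simp add: \<open>t \<le> 0 \<Longrightarrow> \<phi> t = 0\<close>)
    qed
    also have "\<dots> = (\<integral>\<^sup>+l. (\<integral>\<^sup>+t. ennreal (exp (- l * t)) * indicator {n..} l * \<phi> t \<partial>lborel) \<partial>lborel)"
      by (rule lborel_pair.Fubini') measurable
    also have "\<dots> = (\<integral>\<^sup>+l. (\<integral>\<^sup>+t. ennreal (exp (- l * t)) * \<phi> t \<partial>lborel) * indicator {n..} l \<partial>lborel)"
      by (subst nn_integral_multc[symmetric]) (auto simp: mult_ac)
    also have "\<dots> = (\<integral>\<^sup>+l. ennreal (l powr (\<alpha> - 1) * exp (- (l powr \<alpha>))) * indicator {n..} l \<partial>lborel)"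
      using L\<phi> that by (intro nn_integral_cong) (auto simp: indicator_def)
    also have "\<dots> = ennreal (0 - (- exp (- (n powr \<alpha>)) / \<alpha>))"
    proof (rule nn_integral_FTC_atLeast)
      show "((\<lambda>x. - exp (- (x powr \<alpha>)) / \<alpha>) \<longlongrightarrow> 0) at_top"
        using \<alpha> by real_asymp
    qed (use that \<alpha> in \<open>auto intro!: derivative_eq_intros simp: powr_diff\<close>)
    finally show ?thesis by simp
  qed
  have "AE s in lborel. s > 0 \<longrightarrow> ennreal (1 / s) * \<phi> s = ennreal (1 / \<alpha>) * ennreal (p s)"
  proof (rule Laplace_unique)
    fix n :: nat assume "n \<ge> 1"
    have "(\<integral>\<^sup>+s\<in>{0<..}. ennreal (exp (- real n * s)) * (ennreal (1 / \<alpha>) * ennreal (p s)) \<partial>lborel)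
      = ennreal (1 / \<alpha>) * (\<integral>\<^sup>+s\<in>{0<..}. ennreal (exp (- real n * s)) * ennreal (p s) \<partial>lborel)"
      by (subst nn_integral_cmult[symmetric]) (auto simp: mult_ac)
    also have "\<dots> = ennreal (exp (- (real n powr \<alpha>)) / \<alpha>)"
      using \<alpha> by (subst Laplace_p) (auto simp flip: ennreal_mult)
    finally show "(\<integral>\<^sup>+s\<in>{0<..}. ennreal (exp (- real n * s)) * (ennreal (1 / s) * \<phi> s) \<partial>lborel)
      = (\<integral>\<^sup>+s\<in>{0<..}. ennreal (exp (- real n * s)) * (ennreal (1 / \<alpha>) * ennreal (p s)) \<partial>lborel)"
      using key[of "real n"] \<open>n \<ge> 1\<close> by simp
  next
    show "(\<integral>\<^sup>+s\<in>{0<..}. ennreal (exp (- s)) * (ennreal (1 / s) * \<phi> s) \<partial>lborel) = ennreal (exp (- 1) / \<alpha>)"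
      using key[of 1] by simp
  qed (use \<alpha> in auto)
  thus ?thesis
  proof eventually_elim
    fix t
    assume *: "t > 0 \<longrightarrow> ennreal (1 / t) * \<phi> t = ennreal (1 / \<alpha>) * ennreal (p t)"
    show "t > 0 \<longrightarrow> (\<integral>\<^sup>+r. abel_kernel (1 - \<alpha>) (t - r) * P r \<partial>lborel) = ennreal (t / \<alpha>) * ennreal (p t)"
    proof
      assume "t > 0"
      have "\<phi> t = ennreal (t * (1 / t)) * \<phi> t" using \<open>t > 0\<close> by simp
      also have "\<dots> = ennreal t * (ennreal (1 / \<alpha>) * ennreal (p t))"
        using * \<open>t > 0\<close> by (simp only: ennreal_mult' less_imp_le mult.assoc)
      also have "\<dots> = ennreal (t / \<alpha>) * ennreal (p t)"
        using \<open>t > 0\<close> \<alpha> by (simp add: ennreal_mult[symmetric] mult.assoc[symmetric])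
      finally show "(\<integral>\<^sup>+r. abel_kernel (1 - \<alpha>) (t - r) * P r \<partial>lborel) = ennreal (t / \<alpha>) * ennreal (p t)"
        by (simp add: \<phi>_def)
    qed
  qed
qed

end

subsection \<open>Positive Fourier transforms\<close>

lemma
  fixes f :: "'a::euclidean_space \<Rightarrow> real \<Rightarrow> complex"
  assumes "\<And>b. b \<in> Basis \<Longrightarrow> integrable lborel (f b)"
  shows integral_lborel_prod: "(\<integral>x. (\<Prod>b\<in>Basis. f b (x \<bullet> b)) \<partial>lborel) = (\<Prod>b\<in>Basis. \<integral>x. f b x \<partial>lborel)"
    and integrable_lborel_prod: "integrable lborel (\<lambda>x. \<Prod>b\<in>Basis. f b (x \<bullet> b))"
proof -
  interpret product_sigma_finite "\<lambda>_::'a. lborel :: real measure" ..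
  have [measurable]: "f b \<in> borel_measurable borel" if "b \<in> Basis" for b
    using assms[OF that] by auto
  have eq: "(\<Sum>c\<in>Basis. g c *\<^sub>R c) \<bullet> b = g b" if "b \<in> Basis" for g :: "'a \<Rightarrow> real" and b
    using that by simp
  show "(\<integral>x. (\<Prod>b\<in>Basis. f b (x \<bullet> b)) \<partial>lborel) = (\<Prod>b\<in>Basis. \<integral>x. f b x \<partial>lborel)"
    unfolding lborel_eq[where 'a = 'a] using assms
    by (subst integral_distr) (auto simp: eq product_integral_prod cong: prod.cong)
  show "integrable lborel (\<lambda>x. \<Prod>b\<in>Basis. f b (x \<bullet> b))"
    unfolding lborel_eq[where 'a = 'a] using assms
    by (subst integrable_distr_eq) (auto simp: eq intro!: product_integrable_prod cong: prod.cong)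
qed

text \<open>Unnormalised, with s the reciprocal of the standard deviation: as s tends to 0 it tends
  to 1 pointwise, and its transform is a multiple of \<open>gaussian (1 / s)\<close>.\<close>

definition gaussian :: "real \<Rightarrow> 'a::euclidean_space \<Rightarrow> real" where
  "gaussian s x = exp (- (s\<^sup>2 * (x \<bullet> x) / 2))"

lemma measurable_gaussian [measurable]: "gaussian s \<in> borel_measurable borel"
  unfolding gaussian_def by measurable

text \<open>Rescaling of the characteristic function of the standard normal law; the factor sqrt (2
  * pi) restores the normalisation left out of \<open>gaussian\<close>.\<close>

lemma
  fixes a s :: real
  assumes "s > 0"
  shows fourier_gaussian_real: "(\<integral>x. exp (\<i> * complex_of_real (a * x)) * complex_of_real (gaussian s x) \<partial>lborel)
      = complex_of_real (sqrt (2 * pi) / s * gaussian (1 / s) a)"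
    and integrable_fourier_gaussian_real:
      "integrable lborel (\<lambda>x. exp (\<i> * complex_of_real (a * x)) * complex_of_real (gaussian s x))"
proof -
  let ?f = "\<lambda>x. exp (\<i> * complex_of_real (a * x)) * complex_of_real (gaussian s x)"
  let ?g = "\<lambda>y. iexp ((a / s) * y) * complex_of_real (std_normal_density y)"
  have "integrable lborel std_normal_density" by simp
  hence "integrable lborel (\<lambda>y. complex_of_real (std_normal_density y))" by (rule integrable_of_real)
  hence int: "integrable lborel ?g"
    by (rule Bochner_Integration.integrable_bound) (auto simp: norm_mult)
  have "char std_normal_distribution (a / s) = (\<integral>y. iexp ((a / s) * y) \<partial>density lborel std_normal_density)"
    by (simp add: char_def)
  also have "\<dots> = (\<integral>y. ?g y \<partial>lborel)"
    by (subst integral_density) (auto simp: scaleR_conv_of_real mult.commute)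
  finally have val: "(\<integral>y. ?g y \<partial>lborel) = complex_of_real (exp (- ((a / s)\<^sup>2) / 2))"
    by (simp add: char_std_normal_distribution)
  have fg: "?f x = complex_of_real (sqrt (2 * pi)) * ?g (0 + s * x)" for x
    using assms by (simp add: gaussian_def std_normal_density_def power_mult_distrib power2_eq_square
      mult_ac exp_minus real_sqrt_mult flip: of_real_mult)
  have "(\<integral>y. ?g y \<partial>lborel) = s *\<^sub>R (\<integral>x. ?g (0 + s * x) \<partial>lborel)"
    using lborel_integral_real_affine[of s ?g 0] assms by simp
  hence "(\<integral>x. ?g (0 + s * x) \<partial>lborel) = complex_of_real (exp (- ((a / s)\<^sup>2) / 2) / s)"
    using val assms by (simp add: scaleR_conv_of_real field_simps)
  moreover have "(\<integral>x. ?f x \<partial>lborel) = complex_of_real (sqrt (2 * pi)) * (\<integral>x. ?g (0 + s * x) \<partial>lborel)"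
    unfolding fg by (rule integral_mult_right_zero)
  ultimately have "(\<integral>x. ?f x \<partial>lborel) = complex_of_real (sqrt (2 * pi) * (exp (- ((a / s)\<^sup>2) / 2) / s))"
    by simp
  thus "(\<integral>x. ?f x \<partial>lborel) = complex_of_real (sqrt (2 * pi) / s * gaussian (1 / s) a)"
    by (simp add: gaussian_def power2_eq_square field_simps)
  have "integrable lborel (\<lambda>x. ?g (0 + s * x))"
    using lborel_integrable_real_affine[OF int, of s 0] assms by simp
  thus "integrable lborel ?f" unfolding fg by (rule integrable_mult_right)
qed

lemma
  fixes a :: "'a::euclidean_space"
  assumes "s > 0"
  shows fourier_gaussian_complex: "(\<integral>x. exp (\<i> * complex_of_real (a \<bullet> x)) * complex_of_real (gaussian s x) \<partial>lborel)
      = complex_of_real ((sqrt (2 * pi) / s) ^ DIM('a) * gaussian (1 / s) a)"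
    and integrable_fourier_gaussian:
      "integrable lborel (\<lambda>x. exp (\<i> * complex_of_real (a \<bullet> x)) * complex_of_real (gaussian s x))"
proof -
  let ?f = "\<lambda>b x. exp (\<i> * complex_of_real ((a \<bullet> b) * x)) * complex_of_real (gaussian s x)"
  have gprod: "gaussian r x = (\<Prod>b\<in>Basis. gaussian r (x \<bullet> b))" for r and x :: 'a
    unfolding gaussian_def by (subst euclidean_inner) (simp add: exp_sum[symmetric] sum_negf sum_distrib_left sum_divide_distrib)
  have eprod: "exp (\<i> * complex_of_real (a \<bullet> x)) = (\<Prod>b\<in>Basis. exp (\<i> * complex_of_real ((a \<bullet> b) * (x \<bullet> b))))" for x
    by (subst euclidean_inner) (simp add: exp_sum[symmetric] sum_distrib_left)
  have eq: "exp (\<i> * complex_of_real (a \<bullet> x)) * complex_of_real (gaussian s x) = (\<Prod>b\<in>Basis. ?f b (x \<bullet> b))" for x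
    by (simp add: eprod gprod[of s x] prod.distrib)
  have "(\<integral>x. (\<Prod>b\<in>Basis. ?f b (x \<bullet> b)) \<partial>lborel)
    = (\<Prod>b\<in>(Basis::'a set). complex_of_real (sqrt (2 * pi) / s * gaussian (1 / s) (a \<bullet> b)))"
    by (subst integral_lborel_prod)
      (rule integrable_fourier_gaussian_real[OF assms] prod.cong refl fourier_gaussian_real[OF assms])+
  also have "\<dots> = complex_of_real (\<Prod>b\<in>(Basis::'a set). sqrt (2 * pi) / s * gaussian (1 / s) (a \<bullet> b))"
    by simp
  also have "(\<Prod>b\<in>(Basis::'a set). sqrt (2 * pi) / s * gaussian (1 / s) (a \<bullet> b)) = (sqrt (2 * pi) / s) ^ DIM('a) * gaussian (1 / s) a"
    unfolding gprod[of _ a] prod.distrib by simp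
  finally show "(\<integral>x. exp (\<i> * complex_of_real (a \<bullet> x)) * complex_of_real (gaussian s x) \<partial>lborel)
      = complex_of_real ((sqrt (2 * pi) / s) ^ DIM('a) * gaussian (1 / s) a)"
    unfolding eq .
  show "integrable lborel (\<lambda>x. exp (\<i> * complex_of_real (a \<bullet> x)) * complex_of_real (gaussian s x))"
    unfolding eq using assms by (intro integrable_lborel_prod integrable_fourier_gaussian_real)
qed

lemma fourier_gaussian:
  fixes a :: "'a::euclidean_space"
  assumes "s > 0"
  shows "(\<integral>x. cos (a \<bullet> x) * gaussian s x \<partial>lborel) = (sqrt (2 * pi) / s) ^ DIM('a) * gaussian (1 / s) a"
proof -
  have "(\<integral>x. cos (a \<bullet> x) * gaussian s x \<partial>lborel)
      = (\<integral>x. Re (exp (\<i> * complex_of_real (a \<bullet> x)) * complex_of_real (gaussian s x)) \<partial>lborel)"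
    by (intro Bochner_Integration.integral_cong) (auto simp: Re_exp)
  also have "\<dots> = Re (\<integral>x. exp (\<i> * complex_of_real (a \<bullet> x)) * complex_of_real (gaussian s x) \<partial>lborel)"
    by (rule integral_Re[OF integrable_fourier_gaussian[OF assms]])
  finally show ?thesis unfolding fourier_gaussian_complex[OF assms] by simp
qed

lemma integrable_gaussian:
  assumes "s > 0"
  shows "integrable lborel (gaussian s :: 'a::euclidean_space \<Rightarrow> real)"
  using integrable_Re[OF integrable_fourier_gaussian[OF assms, of "0::'a"]] by simp

lemma integral_gaussian:
  assumes "s > 0"
  shows "(\<integral>x. gaussian s (x::'a::euclidean_space) \<partial>lborel) = (sqrt (2 * pi) / s) ^ DIM('a)"
  using fourier_gaussian[OF assms, of "0::'a"] by (simp add: gaussian_def)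

text \<open>Testing only against cosines suffices for even \<open>\<phi>\<close>; the closure properties below rest on
  \<open>cos (a \<bullet> \<xi>) cos (b \<bullet> \<xi>)\<close> being the mean of \<open>cos ((a + b) \<bullet> \<xi>)\<close> and \<open>cos ((a - b) \<bullet> \<xi>)\<close>.\<close>

definition positive_transform :: "'a::euclidean_space measure \<Rightarrow> ('a \<Rightarrow> real) \<Rightarrow> bool" where
  "positive_transform W \<phi> \<longleftrightarrow> \<phi> \<in> borel_measurable borel \<and> (\<exists>B. \<forall>\<xi>. \<bar>\<phi> \<xi>\<bar> \<le> B) \<and>
     (\<forall>a. 0 \<le> (\<integral>\<xi>. \<phi> \<xi> * cos (a \<bullet> \<xi>) \<partial>W))"

context
  fixes W :: "'a::euclidean_space measure"
  assumes fin_W: "finite_measure W" and sets_W [measurable_cong, simp]: "sets W = sets borel"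
begin

interpretation W: finite_measure W by (rule fin_W)

lemma positive_transform_integrable:
  assumes "positive_transform W \<phi>"
  shows "integrable W (\<lambda>\<xi>. \<phi> \<xi> * cos (a \<bullet> \<xi>))"
proof -
  obtain B where B: "\<And>\<xi>. \<bar>\<phi> \<xi>\<bar> \<le> B" and [measurable]: "\<phi> \<in> borel_measurable borel"
    using assms unfolding positive_transform_def by blast
  have "\<bar>\<phi> \<xi>\<bar> * \<bar>cos (a \<bullet> \<xi>)\<bar> \<le> B * 1" for \<xi>
    using B[of \<xi>] by (intro mult_mono) auto
  thus ?thesis by (intro W.integrable_const_bound[of _ B]) (auto simp: abs_mult)
qed

lemma positive_transform_add:
  assumes "positive_transform W \<phi>" "positive_transform W \<zeta>"
  shows "positive_transform W (\<lambda>\<xi>. \<phi> \<xi> + \<zeta> \<xi>)"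
proof -
  obtain B C where B: "\<And>\<xi>. \<bar>\<phi> \<xi>\<bar> \<le> B" and C: "\<And>\<xi>. \<bar>\<zeta> \<xi>\<bar> \<le> C"
    using assms unfolding positive_transform_def by blast
  have "\<bar>\<phi> \<xi> + \<zeta> \<xi>\<bar> \<le> B + C" for \<xi>
    by (rule order_trans[OF abs_triangle_ineq add_mono[OF B C]])
  thus ?thesis
    using assms positive_transform_integrable[OF assms(1)] positive_transform_integrable[OF assms(2)]
    unfolding positive_transform_def by (auto simp: distrib_right)
qed

lemma positive_transform_scale:
  assumes "positive_transform W \<phi>" "c \<ge> 0"
  shows "positive_transform W (\<lambda>\<xi>. c * \<phi> \<xi>)"
proof -
  obtain B where "\<And>\<xi>. \<bar>\<phi> \<xi>\<bar> \<le> B" using assms unfolding positive_transform_def by blast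
  hence "\<bar>c * \<phi> \<xi>\<bar> \<le> c * B" for \<xi> using assms(2) by (simp add: abs_mult mult_left_mono)
  thus ?thesis using assms unfolding positive_transform_def by (auto simp: mult.assoc)
qed

lemma positive_transform_sum:
  assumes "finite J" "J \<noteq> {}" "\<And>j. j \<in> J \<Longrightarrow> positive_transform W (\<phi> j)"
  shows "positive_transform W (\<lambda>\<xi>. \<Sum>j\<in>J. \<phi> j \<xi>)"
  using assms by (induction J rule: finite_ne_induct) (auto intro: positive_transform_add)

text \<open>Dominated convergence with the constant B as majorant, integrable because
  \<open>W\<close> is finite. Lebesgue measure would not do, hence the Gaussian weight put into
  \<open>W\<close> later.\<close>

lemma positive_transform_limit:
  assumes pos: "\<And>n::nat. positive_transform W (\<phi> n)" and bd: "\<And>n \<xi>. \<bar>\<phi> n \<xi>\<bar> \<le> B"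
    and lim: "\<And>\<xi>. (\<lambda>n. \<phi> n \<xi>) \<longlonglongrightarrow> \<zeta> \<xi>"
  shows "positive_transform W \<zeta>"
proof -
  have meas [measurable]: "\<phi> n \<in> borel_measurable borel" for n
    using pos unfolding positive_transform_def by blast
  have [measurable]: "\<zeta> \<in> borel_measurable borel"
    by (rule borel_measurable_LIMSEQ_real[OF lim]) measurable
  have B: "\<bar>\<zeta> \<xi>\<bar> \<le> B" for \<xi>
    by (rule LIMSEQ_le_const2[OF tendsto_rabs[OF lim]]) (use bd in auto)
  have "0 \<le> (\<integral>\<xi>. \<zeta> \<xi> * cos (a \<bullet> \<xi>) \<partial>W)" for a
  proof (rule LIMSEQ_le_const)
    show "(\<lambda>n. \<integral>\<xi>. \<phi> n \<xi> * cos (a \<bullet> \<xi>) \<partial>W) \<longlonglongrightarrow> (\<integral>\<xi>. \<zeta> \<xi> * cos (a \<bullet> \<xi>) \<partial>W)"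
    proof (rule integral_dominated_convergence[where w = "\<lambda>_. B"])
      have "\<bar>\<phi> n \<xi>\<bar> * \<bar>cos (a \<bullet> \<xi>)\<bar> \<le> B * 1" for n \<xi>
        using bd[of n \<xi>] by (intro mult_mono) auto
      thus "AE \<xi> in W. norm (\<phi> n \<xi> * cos (a \<bullet> \<xi>)) \<le> B" for n by (simp add: abs_mult)
    qed (auto intro!: tendsto_mult_right lim)
    show "\<exists>N. \<forall>n\<ge>N. 0 \<le> (\<integral>\<xi>. \<phi> n \<xi> * cos (a \<bullet> \<xi>) \<partial>W)"
      using pos unfolding positive_transform_def by blast
  qed
  thus ?thesis using B unfolding positive_transform_def by auto
qed

context
  fixes \<mu> :: "'b measure" and b :: "'b \<Rightarrow> 'a"
  assumes fin_\<mu>: "finite_measure \<mu>" and b [measurable]: "b \<in> borel_measurable \<mu>"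
begin

interpretation \<mu>: finite_measure \<mu> by (rule fin_\<mu>)
interpretation pair_sigma_finite W \<mu> ..

lemma abs_integral_cos_le: "\<bar>\<integral>z. cos (b z \<bullet> \<xi>) \<partial>\<mu>\<bar> \<le> measure \<mu> (space \<mu>)"
proof -
  have "\<bar>\<integral>z. cos (b z \<bullet> \<xi>) \<partial>\<mu>\<bar> \<le> (\<integral>z. \<bar>cos (b z \<bullet> \<xi>)\<bar> \<partial>\<mu>)"
    by (rule integral_abs_bound)
  also have "\<dots> \<le> (\<integral>z. 1 \<partial>\<mu>)"
    by (intro integral_mono) (auto intro: \<mu>.integrable_const_bound[of _ 1])
  finally show ?thesis by simp
qed

text \<open>On the side of the transforms this is convolution with the symmetrised image of \<mu>
  under b, which preserves non-negativity.\<close>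

lemma positive_transform_mult_cos_integral:
  assumes "positive_transform W \<phi>"
  shows "positive_transform W (\<lambda>\<xi>. \<phi> \<xi> * (\<integral>z. cos (b z \<bullet> \<xi>) \<partial>\<mu>))"
proof -
  obtain B where B: "\<And>\<xi>. \<bar>\<phi> \<xi>\<bar> \<le> B" and meas [measurable]: "\<phi> \<in> borel_measurable borel"
    and pos: "\<And>a. 0 \<le> (\<integral>\<xi>. \<phi> \<xi> * cos (a \<bullet> \<xi>) \<partial>W)"
    using assms unfolding positive_transform_def by blast
  have m: "(\<lambda>\<xi>. \<integral>z. cos (b z \<bullet> \<xi>) \<partial>\<mu>) \<in> borel_measurable borel"
    by (rule \<mu>.borel_measurable_lebesgue_integral) measurable
  have bd: "\<bar>\<phi> \<xi> * (\<integral>z. cos (b z \<bullet> \<xi>) \<partial>\<mu>)\<bar> \<le> B * measure \<mu> (space \<mu>)" for \<xi>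
    unfolding abs_mult using B[of \<xi>] abs_integral_cos_le by (intro mult_mono) auto
  have "0 \<le> (\<integral>\<xi>. \<phi> \<xi> * (\<integral>z. cos (b z \<bullet> \<xi>) \<partial>\<mu>) * cos (a \<bullet> \<xi>) \<partial>W)" for a
  proof -
    interpret W\<mu>: finite_measure "W \<Otimes>\<^sub>M \<mu>" by (rule finite_measure_pair_measure) unfold_locales
    have "integrable (W \<Otimes>\<^sub>M \<mu>) (\<lambda>(\<xi>, z). \<phi> \<xi> * cos (a \<bullet> \<xi>) * cos (b z \<bullet> \<xi>))"
    proof (rule W\<mu>.integrable_const_bound[of _ B])
      have "\<bar>\<phi> \<xi>\<bar> * \<bar>cos (a \<bullet> \<xi>)\<bar> * \<bar>cos (b z \<bullet> \<xi>)\<bar> \<le> B * 1 * 1" for \<xi> z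
        using B[of \<xi>] by (intro mult_mono) auto
      thus "AE x in W \<Otimes>\<^sub>M \<mu>. norm (case x of (\<xi>, z) \<Rightarrow> \<phi> \<xi> * cos (a \<bullet> \<xi>) * cos (b z \<bullet> \<xi>)) \<le> B"
        by (auto simp: abs_mult)
    qed measurable
    hence "(\<integral>\<xi>. (\<integral>z. \<phi> \<xi> * cos (a \<bullet> \<xi>) * cos (b z \<bullet> \<xi>) \<partial>\<mu>) \<partial>W)
      = (\<integral>z. (\<integral>\<xi>. \<phi> \<xi> * cos (a \<bullet> \<xi>) * cos (b z \<bullet> \<xi>) \<partial>W) \<partial>\<mu>)"
      by (rule Fubini_integral[symmetric])
    moreover have "0 \<le> (\<integral>\<xi>. \<phi> \<xi> * cos (a \<bullet> \<xi>) * cos (b z \<bullet> \<xi>) \<partial>W)" for z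
    proof -
      have "(\<integral>\<xi>. \<phi> \<xi> * cos (a \<bullet> \<xi>) * cos (b z \<bullet> \<xi>) \<partial>W)
        = (\<integral>\<xi>. (\<phi> \<xi> * cos ((a - b z) \<bullet> \<xi>) + \<phi> \<xi> * cos ((a + b z) \<bullet> \<xi>)) / 2 \<partial>W)"
        by (intro Bochner_Integration.integral_cong)
          (auto simp: inner_add_left inner_diff_left mult.assoc cos_times_cos distrib_left)
      also have "\<dots> = ((\<integral>\<xi>. \<phi> \<xi> * cos ((a - b z) \<bullet> \<xi>) \<partial>W) + (\<integral>\<xi>. \<phi> \<xi> * cos ((a + b z) \<bullet> \<xi>) \<partial>W)) / 2"
        using positive_transform_integrable[OF assms] by simp
      also have "\<dots> \<ge> 0" using pos by simp
      finally show ?thesis .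
    qed
    ultimately show ?thesis by (simp add: mult_ac)
  qed
  thus ?thesis using bd m unfolding positive_transform_def by auto
qed

text \<open>Each term of the exponential series is covered by the preceding lemma. Up to the factor
  exp (- mass of \<mu>) the exponential is the characteristic function of the compound Poisson law
  with jump measure the symmetrised image of \<mu>.\<close>

lemma positive_transform_exp_cos_integral:
  assumes one: "positive_transform W (\<lambda>_. 1)"
  shows "positive_transform W (\<lambda>\<xi>. exp (\<integral>z. cos (b z \<bullet> \<xi>) \<partial>\<mu>))"
proof -
  define \<zeta> where "\<zeta> \<xi> = (\<integral>z. cos (b z \<bullet> \<xi>) \<partial>\<mu>)" for \<xi>
  define m where "m = measure \<mu> (space \<mu>)"
  have \<zeta>: "\<bar>\<zeta> \<xi>\<bar> \<le> m" for \<xi> unfolding \<zeta>_def m_def by (rule abs_integral_cos_le)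
  have pow: "positive_transform W (\<lambda>\<xi>. \<zeta> \<xi> ^ j)" for j
  proof (induction j)
    case (Suc j)
    thus ?case using positive_transform_mult_cos_integral[OF Suc] by (simp add: \<zeta>_def mult.commute)
  qed (simp add: one)
  \<comment> \<open>The upper limit \<open>Suc n\<close> keeps the index set non-empty, as
    \<open>positive_transform_sum\<close> requires.\<close>
  have "positive_transform W (\<lambda>\<xi>. \<Sum>j<Suc n. (1 / fact j) * \<zeta> \<xi> ^ j)" for n
    by (intro positive_transform_sum positive_transform_scale pow) auto
  moreover have "\<bar>\<Sum>j<Suc n. (1 / fact j) * \<zeta> \<xi> ^ j\<bar> \<le> exp m" for n \<xi>
  proof -
    have "\<bar>\<Sum>j<Suc n. (1 / fact j) * \<zeta> \<xi> ^ j\<bar> \<le> (\<Sum>j<Suc n. \<bar>(1 / fact j) * \<zeta> \<xi> ^ j\<bar>)" by (rule sum_abs)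
    also have "\<dots> \<le> (\<Sum>j<Suc n. inverse (fact j) * m ^ j)"
      using \<zeta>[of \<xi>] by (intro sum_mono) (auto simp: abs_mult power_abs divide_simps intro!: power_mono)
    also have "\<dots> \<le> exp m"
    proof -
      have "m \<ge> 0" using \<zeta>[of \<xi>] by linarith
      hence "(\<Sum>j<Suc n. inverse (fact j) * m ^ j) \<le> (\<Sum>j. inverse (fact j) * m ^ j)"
        by (intro sum_le_suminf summable_exp) auto
      thus ?thesis by (simp add: exp_def)
    qed
    finally show ?thesis .
  qed
  moreover have "(\<lambda>n. \<Sum>j<Suc n. (1 / fact j) * \<zeta> \<xi> ^ j) \<longlonglongrightarrow> exp (\<zeta> \<xi>)" for \<xi>
    using exp_converges[of "\<zeta> \<xi>"] unfolding sums_def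
    by (intro LIMSEQ_Suc) (simp add: divide_inverse_commute)
  ultimately show ?thesis unfolding \<zeta>_def[symmetric] by (rule positive_transform_limit)
qed

end

end

subsection \<open>The stable symbol\<close>

text \<open>Scaling in y takes out \<bar>r\<bar> powr \<beta>. The constant is finite exactly
  because 0 < \<beta> < 2: 1 - cos y is quadratic at 0 and bounded at \<infinity>. This is the
  Levy-Khintchine formula of the one-dimensional symmetric stable law.\<close>

lemma nn_integral_one_minus_cos:
  assumes "0 < \<beta>" "\<beta> < 2"
  obtains K where "K > 0"
    "\<And>r. (\<integral>\<^sup>+y\<in>{0<..}. ennreal ((1 - cos (y * r)) * y powr (- \<beta> - 1)) \<partial>lborel) = ennreal (K * \<bar>r\<bar> powr \<beta>)"
proof -
  define K where "K = (\<integral>\<^sup>+y\<in>{0<..}. ennreal ((1 - cos y) * y powr (- \<beta> - 1)) \<partial>lborel)"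
  have "K < \<infinity>"
    unfolding K_def
  proof (rule nn_integral_powr_tails[where b = 2 and C = 2])
    fix s :: real assume "s > 0"
    have "cos s = 1 - 2 * (sin (s / 2))\<^sup>2"
      using cos_double_sin[of "s / 2"] by simp
    moreover have "(sin (s / 2))\<^sup>2 \<le> (s / 2)\<^sup>2"
      by (rule power2_le_iff_abs_le[THEN iffD2]) (use abs_sin_x_le_abs_x[of "s / 2"] \<open>s > 0\<close> in auto)
    ultimately have "1 - cos s \<le> s\<^sup>2 / 2" by (simp add: power2_eq_square)
    also have "\<dots> \<le> 2 * s powr 2" using \<open>s > 0\<close> by simp
    finally show "1 - cos s \<le> 2 * s powr 2" .
    show "1 - cos s \<le> 2" using cos_ge_minus_one[of s] by linarith
  qed (use assms in auto)
  have "K \<noteq> 0"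
  proof
    assume "K = 0"
    hence "AE y in lborel. ennreal ((1 - cos y) * y powr (- \<beta> - 1)) * indicator {0<..} (y::real) = 0"
      unfolding K_def by (subst (asm) nn_integral_0_iff_AE) auto
    hence "AE y in lborel. y \<notin> {0<..(1::real)}"
    proof eventually_elim
      fix y :: real
      assume *: "ennreal ((1 - cos y) * y powr (- \<beta> - 1)) * indicator {0<..} y = 0"
      have "cos y < cos 0" if "0 < y" "y \<le> 1"
        using that pi_gt3 by (intro cos_monotone_0_pi) auto
      thus "y \<notin> {0<..1}"
        using * by (auto simp: ennreal_eq_0_iff mult_le_0_iff)
    qed
    hence "{0<..(1::real)} \<in> null_sets lborel" by (subst AE_iff_null_sets) auto
    thus False by (simp add: null_sets_def)
  qed
  have scale: "(\<integral>\<^sup>+y\<in>{0<..}. ennreal ((1 - cos (y * r)) * y powr (- \<beta> - 1)) \<partial>lborel) = ennreal (r powr \<beta>) * K"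
    if "r > 0" for r
  proof -
    have "K = ennreal r * (\<integral>\<^sup>+y\<in>{0<..}. ennreal ((1 - cos (r * y)) * (r * y) powr (- \<beta> - 1)) \<partial>lborel)"
      unfolding K_def by (rule nn_integral_scale_half_line) (use that in auto)
    also have "\<dots> = ennreal r * (\<integral>\<^sup>+y. ennreal (r powr (- \<beta> - 1)) *
        (ennreal ((1 - cos (y * r)) * y powr (- \<beta> - 1)) * indicator {0<..} y) \<partial>lborel)"
      using that by (intro arg_cong[where f = "\<lambda>x. ennreal r * x"] nn_integral_cong)
        (auto simp: indicator_def powr_mult mult_ac simp flip: ennreal_mult)
    also have "\<dots> = ennreal (r * r powr (- \<beta> - 1)) * (\<integral>\<^sup>+y\<in>{0<..}. ennreal ((1 - cos (y * r)) * y powr (- \<beta> - 1)) \<partial>lborel)"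
      using that by (subst nn_integral_cmult) (auto simp: ennreal_mult mult.assoc)
    finally have "ennreal (r powr \<beta>) * K = ennreal (r powr \<beta> * (r * r powr (- \<beta> - 1))) *
        (\<integral>\<^sup>+y\<in>{0<..}. ennreal ((1 - cos (y * r)) * y powr (- \<beta> - 1)) \<partial>lborel)"
      using that by (simp add: ennreal_mult mult.assoc)
    also have "r powr \<beta> * (r * r powr (- \<beta> - 1)) = 1"
      using that by (simp add: powr_diff powr_minus)
    finally show ?thesis by simp
  qed
  obtain k where k: "K = ennreal k" "k > 0"
    using \<open>K < \<infinity>\<close> \<open>K \<noteq> 0\<close> by (cases K) (auto simp: le_less)
  show thesis
  proof (rule that[of k])
    fix r :: real
    have "(\<integral>\<^sup>+y\<in>{0<..}. ennreal ((1 - cos (y * r)) * y powr (- \<beta> - 1)) \<partial>lborel)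
      = (\<integral>\<^sup>+y\<in>{0<..}. ennreal ((1 - cos (y * \<bar>r\<bar>)) * y powr (- \<beta> - 1)) \<partial>lborel)"
      by (cases "r \<ge> 0") (auto simp: abs_of_neg)
    also have "\<dots> = ennreal (k * \<bar>r\<bar> powr \<beta>)"
      using scale[of "\<bar>r\<bar>"] k by (cases "r = 0") (auto simp: mult.commute simp flip: ennreal_mult)
    finally show "(\<integral>\<^sup>+y\<in>{0<..}. ennreal ((1 - cos (y * r)) * y powr (- \<beta> - 1)) \<partial>lborel) = ennreal (k * \<bar>r\<bar> powr \<beta>)" .
  qed (use k in auto)
qed

locale spectral =
  fixes \<beta> :: real and \<nu> :: "(real^'n) measure" and c0 :: real
  assumes \<beta>: "0 < \<beta>" "\<beta> < 2"
    and fin_\<nu>: "finite_measure \<nu>"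
    and sets_\<nu>: "sets \<nu> = sets (restrict_space borel (sphere 0 1))"
    and c0: "c0 > 0" "\<And>\<theta>. \<theta> \<in> sphere 0 1 \<Longrightarrow> c0 \<le> omega \<beta> \<nu> \<theta>"
begin

sublocale \<nu>: finite_measure \<nu> by (rule fin_\<nu>)

lemma space_\<nu>: "space \<nu> = sphere 0 1"
  using sets_eq_imp_space_eq[OF sets_\<nu>] by (simp add: space_restrict_space)

lemma measurable_ident_\<nu>: "(\<lambda>\<eta>. \<eta>) \<in> borel_measurable \<nu>"
  by (subst measurable_cong_sets[OF sets_\<nu> refl]) (rule measurable_restrict_space1, simp)

abbreviation \<psi> :: "real^'n \<Rightarrow> real" where "\<psi> \<equiv> symbol \<beta> \<nu>"

lemma integrable_inner_powr: "integrable \<nu> (\<lambda>\<eta>. \<bar>\<xi> \<bullet> \<eta>\<bar> powr \<beta>)"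
  supply measurable_ident_\<nu> [measurable]
proof (rule \<nu>.integrable_const_bound[of _ "norm \<xi> powr \<beta>"])
  show "AE \<eta> in \<nu>. norm (\<bar>\<xi> \<bullet> \<eta>\<bar> powr \<beta>) \<le> norm \<xi> powr \<beta>"
    using \<beta> by (intro AE_I2) (auto simp: space_\<nu> intro!: powr_mono2 order_trans[OF Cauchy_Schwarz_ineq2])
qed measurable

lemma symbol_eq: "\<psi> \<xi> = (\<integral>\<eta>. \<bar>\<xi> \<bullet> \<eta>\<bar> powr \<beta> \<partial>\<nu>)"
proof (cases "\<xi> = 0")
  case False
  have "norm \<xi> powr \<beta> * \<bar>(\<xi> /\<^sub>R norm \<xi>) \<bullet> \<eta>\<bar> powr \<beta> = \<bar>\<xi> \<bullet> \<eta>\<bar> powr \<beta>" for \<eta>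
    using False by (simp add: abs_mult powr_mult[symmetric] flip: mult.assoc)
  thus ?thesis unfolding symbol_def omega_def by (subst integral_mult_right_zero[symmetric]) simp
qed (simp add: symbol_def)

lemma symbol_nonneg: "0 \<le> \<psi> \<xi>"
  unfolding symbol_eq by (rule Bochner_Integration.integral_nonneg) simp

lemma symbol_ge: "c0 * norm \<xi> powr \<beta> \<le> \<psi> \<xi>"
proof (cases "\<xi> = 0")
  case False
  hence "c0 \<le> omega \<beta> \<nu> (\<xi> /\<^sub>R norm \<xi>)" by (intro c0) simp
  thus ?thesis unfolding symbol_def by (subst mult.commute) (rule mult_left_mono, auto)
qed (simp add: symbol_def)

lemma measurable_symbol [measurable]:
  assumes [measurable]: "h \<in> borel_measurable M"
  shows "(\<lambda>z. \<psi> (h z)) \<in> borel_measurable M"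
proof -
  note measurable_ident_\<nu> [measurable]
  have "\<psi> \<in> borel_measurable borel"
    unfolding symbol_eq by (rule \<nu>.borel_measurable_lebesgue_integral) measurable
  from measurable_compose[OF assms this] show ?thesis .
qed

text \<open>t \<psi> \<xi> is the integral of 1 - cos (y \<eta> \<bullet> \<xi>) against the Levy
  measure (t / K) y powr (- \<beta> - 1) dy \<nu>(d\<eta>), where K comes from
  \<open>nn_integral_one_minus_cos\<close>. Near y = 0 this measure may be infinite; its truncations
  are finite and give compound Poisson transforms, and monotone convergence of the exponents removes
  the truncation.\<close>

lemma positive_transform_exp_symbol:
  assumes W: "finite_measure W" "sets W = sets borel" "positive_transform W (\<lambda>_. 1)" and t: "t \<ge> 0"
  shows "positive_transform W (\<lambda>\<xi>. exp (- t * \<psi> \<xi>))"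
proof -
  obtain K where K: "K > 0"
    "\<And>r. (\<integral>\<^sup>+y\<in>{0<..}. ennreal ((1 - cos (y * r)) * y powr (- \<beta> - 1)) \<partial>lborel) = ennreal (K * \<bar>r\<bar> powr \<beta>)"
    using nn_integral_one_minus_cos[OF \<beta>] by blast
  \<comment> \<open>Bounded away from 0, where the jump intensity blows up, and bounded above, so
    that a constant majorant suffices; the intervals increase to (0, \<infinity>).\<close>
  define I where "I m = {1 / real (Suc m)<..real (Suc m)}" for m
  have [measurable]: "I m \<in> sets borel" for m unfolding I_def by measurable
  have I_pos: "y > 0" if "y \<in> I m" for y m
    using that by (auto simp: I_def intro: less_trans[rotated])
  define w where "w m y = ennreal (t / K * y powr (- \<beta> - 1)) * indicator (I m) y" for m y
  have [measurable]: "w m \<in> borel_measurable borel" for m unfolding w_def by measurable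
  define \<pi> where "\<pi> m = density (\<nu> \<Otimes>\<^sub>M lborel) (\<lambda>(\<eta>, y). w m y)" for m
  have sets_\<pi> [measurable_cong]: "sets (\<pi> m) = sets (\<nu> \<Otimes>\<^sub>M lborel)" for m by (simp add: \<pi>_def)
  interpret pair_sigma_finite \<nu> lborel ..
  define b where "b z = snd z *\<^sub>R fst z" for z :: "(real^'n) \<times> real"
  have [measurable]: "b \<in> borel_measurable (\<nu> \<Otimes>\<^sub>M lborel)"
    unfolding b_def using measurable_compose[OF measurable_fst measurable_ident_\<nu>] by measurable
  have fin_\<pi>: "finite_measure (\<pi> m)" for m
  proof (rule finite_measureI)
    have "(\<integral>\<^sup>+y. w m y \<partial>lborel) \<le> (\<integral>\<^sup>+y. ennreal (t / K * (1 / real (Suc m)) powr (- \<beta> - 1)) * indicator (I m) y \<partial>lborel)"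
    proof (rule nn_integral_mono)
      fix y
      show "w m y \<le> ennreal (t / K * (1 / real (Suc m)) powr (- \<beta> - 1)) * indicator (I m) y"
      proof (cases "y \<in> I m")
        case True
        have "y powr (- \<beta> - 1) \<le> (1 / real (Suc m)) powr (- \<beta> - 1)"
          using True \<beta> by (intro powr_mono2') (auto simp: I_def)
        hence "t / K * y powr (- \<beta> - 1) \<le> t / K * (1 / real (Suc m)) powr (- \<beta> - 1)"
          using t K(1) by (intro mult_left_mono) auto
        thus ?thesis using True unfolding w_def by (simp only: indicator_simps mult.right_neutral ennreal_leI)
      qed (simp add: w_def)
    qed
    also have "\<dots> < \<infinity>"
      using emeasure_bounded_finite[of "I m"]
      by (subst nn_integral_cmult_indicator) (auto simp: I_def ennreal_mult_less_top)
    finally have fin: "(\<integral>\<^sup>+y. w m y \<partial>lborel) < \<infinity>" .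
    have "emeasure (\<pi> m) (space (\<pi> m)) = (\<integral>\<^sup>+z. (case z of (\<eta>, y) \<Rightarrow> w m y) \<partial>(\<nu> \<Otimes>\<^sub>M lborel))"
    proof -
      have "emeasure (\<pi> m) (space (\<nu> \<Otimes>\<^sub>M lborel))
        = (\<integral>\<^sup>+z. (case z of (\<eta>, y) \<Rightarrow> w m y) * indicator (space (\<nu> \<Otimes>\<^sub>M lborel)) z \<partial>(\<nu> \<Otimes>\<^sub>M lborel))"
        unfolding \<pi>_def by (rule emeasure_density[OF _ sets.top]) measurable
      also have "\<dots> = (\<integral>\<^sup>+z. (case z of (\<eta>, y) \<Rightarrow> w m y) \<partial>(\<nu> \<Otimes>\<^sub>M lborel))"
        by (intro nn_integral_cong) simp
      finally show ?thesis by (simp add: \<pi>_def)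
    qed
    also have "\<dots> = (\<integral>\<^sup>+\<eta>. (\<integral>\<^sup>+y. w m y \<partial>lborel) \<partial>\<nu>)"
      by (subst lborel.nn_integral_fst[symmetric]) auto
    also have "\<dots> = (\<integral>\<^sup>+y. w m y \<partial>lborel) * emeasure \<nu> (space \<nu>)"
      by (rule nn_integral_const)
    also have "emeasure \<nu> (space \<nu>) < \<infinity>" by (simp add: less_top[symmetric])
    with fin have "(\<integral>\<^sup>+y. w m y \<partial>lborel) * emeasure \<nu> (space \<nu>) < \<infinity>"
      by (simp add: ennreal_mult_less_top)
    finally show "emeasure (\<pi> m) (space (\<pi> m)) \<noteq> \<infinity>" by simp
  qed
  \<comment> \<open>The 1 in the integrand contributes the total mass of \<open>\<pi> m\<close>, and
    thus the normalising factor of the compound Poisson law.\<close>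
  define \<Psi> where "\<Psi> m \<xi> = (\<integral>z. 1 - cos (b z \<bullet> \<xi>) \<partial>\<pi> m)" for m \<xi>
  have pos: "positive_transform W (\<lambda>\<xi>. exp (- \<Psi> m \<xi>))" for m
  proof -
    interpret \<pi>: finite_measure "\<pi> m" by (rule fin_\<pi>)
    have "integrable (\<pi> m) (\<lambda>z. cos (b z \<bullet> \<xi>))" for \<xi>
      by (rule \<pi>.integrable_const_bound[of _ 1]) auto
    hence "\<Psi> m \<xi> = measure (\<pi> m) (space (\<pi> m)) - (\<integral>z. cos (b z \<bullet> \<xi>) \<partial>\<pi> m)" for \<xi>
      unfolding \<Psi>_def by simp
    hence "exp (- \<Psi> m \<xi>) = exp (- measure (\<pi> m) (space (\<pi> m))) * exp (\<integral>z. cos (b z \<bullet> \<xi>) \<partial>\<pi> m)" for \<xi>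
      by (simp flip: exp_add)
    moreover have "positive_transform W (\<lambda>\<xi>. exp (- measure (\<pi> m) (space (\<pi> m))) * exp (\<integral>z. cos (b z \<bullet> \<xi>) \<partial>\<pi> m))"
      by (intro positive_transform_scale positive_transform_exp_cos_integral W fin_\<pi>) auto
    ultimately show ?thesis by simp
  qed
  have \<Psi>_nonneg: "0 \<le> \<Psi> m \<xi>" for m \<xi>
    unfolding \<Psi>_def by (rule Bochner_Integration.integral_nonneg) simp
  have \<Psi>_nn: "ennreal (\<Psi> m \<xi>) = (\<integral>\<^sup>+z. w m (snd z) * ennreal (1 - cos (b z \<bullet> \<xi>)) \<partial>(\<nu> \<Otimes>\<^sub>M lborel))" for m \<xi>
  proof -
    interpret \<pi>: finite_measure "\<pi> m" by (rule fin_\<pi>)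
    have "integrable (\<pi> m) (\<lambda>z. 1 - cos (b z \<bullet> \<xi>))"
      by (intro Bochner_Integration.integrable_diff \<pi>.integrable_const_bound[of _ 1]) auto
    hence "ennreal (\<Psi> m \<xi>) = (\<integral>\<^sup>+z. ennreal (1 - cos (b z \<bullet> \<xi>)) \<partial>\<pi> m)"
      unfolding \<Psi>_def by (intro nn_integral_eq_integral[symmetric]) auto
    also have "\<dots> = (\<integral>\<^sup>+z. w m (snd z) * ennreal (1 - cos (b z \<bullet> \<xi>)) \<partial>(\<nu> \<Otimes>\<^sub>M lborel))"
      unfolding \<pi>_def by (subst nn_integral_density) (auto simp: case_prod_beta)
    finally show ?thesis .
  qed
  have w_mono: "w m y \<le> w n y" if "m \<le> n" for m n y
  proof -
    have "1 / real (Suc n) \<le> 1 / real (Suc m)" using that by (intro frac_le) auto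
    hence "I m \<subseteq> I n"
      using that unfolding I_def by (auto simp del: of_nat_Suc)
    thus ?thesis unfolding w_def by (intro mult_left_mono) (auto simp: indicator_def)
  qed
  have w_SUP: "(SUP m. w m y) = ennreal (t / K * y powr (- \<beta> - 1)) * indicator {0<..} y" for y
  proof (cases "y > 0")
    case True
    obtain m :: nat where "max y (1 / y) < real m" using reals_Archimedean2 by blast
    hence m: "y < real (Suc m)" "1 / y < real (Suc m)" by auto
    hence "1 / real (Suc m) < y" using True by (simp add: field_simps)
    hence "y \<in> I m" using m by (simp add: I_def)
    hence "ennreal (t / K * y powr (- \<beta> - 1)) \<le> w m y" by (simp add: w_def)
    hence "ennreal (t / K * y powr (- \<beta> - 1)) \<le> (SUP m. w m y)" by (meson SUP_upper2 UNIV_I)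
    moreover have "(SUP m. w m y) \<le> ennreal (t / K * y powr (- \<beta> - 1))"
      by (intro SUP_least) (auto simp: w_def indicator_def)
    ultimately show ?thesis using True by (simp add: antisym)
  next
    case False
    hence "w m y = 0" for m using I_pos by (auto simp: w_def indicator_def)
    thus ?thesis using False by simp
  qed
  have lim: "(\<lambda>m. \<Psi> m \<xi>) \<longlonglongrightarrow> t * \<psi> \<xi>" for \<xi>
  proof -
    have "(SUP m. ennreal (\<Psi> m \<xi>)) = (\<integral>\<^sup>+z. (SUP m. w m (snd z) * ennreal (1 - cos (b z \<bullet> \<xi>))) \<partial>(\<nu> \<Otimes>\<^sub>M lborel))"
      unfolding \<Psi>_nn using w_mono
      by (intro nn_integral_monotone_convergence_SUP[symmetric])
        (auto simp: incseq_def le_fun_def intro!: mult_right_mono)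
    also have "\<dots> = (\<integral>\<^sup>+z. ennreal (t / K * snd z powr (- \<beta> - 1)) * indicator {0<..} (snd z) *
        ennreal (1 - cos (b z \<bullet> \<xi>)) \<partial>(\<nu> \<Otimes>\<^sub>M lborel))"
      by (simp add: w_SUP flip: SUP_mult_right_ennreal)
    also have "\<dots> = (\<integral>\<^sup>+\<eta>. (\<integral>\<^sup>+y. ennreal (t / K * y powr (- \<beta> - 1)) * indicator {0<..} y *
        ennreal (1 - cos (b (\<eta>, y) \<bullet> \<xi>)) \<partial>lborel) \<partial>\<nu>)"
      by (subst lborel.nn_integral_fst[symmetric]) auto
    also have "\<dots> = (\<integral>\<^sup>+\<eta>. ennreal t * ennreal (\<bar>\<xi> \<bullet> \<eta>\<bar> powr \<beta>) \<partial>\<nu>)"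
    proof (rule nn_integral_cong)
      fix \<eta>
      have "(\<integral>\<^sup>+y. ennreal (t / K * y powr (- \<beta> - 1)) * indicator {0<..} y * ennreal (1 - cos (b (\<eta>, y) \<bullet> \<xi>)) \<partial>lborel)
        = (\<integral>\<^sup>+y. ennreal (t / K) * (ennreal ((1 - cos (y * (\<xi> \<bullet> \<eta>))) * y powr (- \<beta> - 1)) * indicator {0<..} y) \<partial>lborel)"
        using t K(1) by (intro nn_integral_cong)
          (auto simp: indicator_def b_def inner_commute mult_ac simp flip: ennreal_mult)
      also have "\<dots> = ennreal (t / K) * ennreal (K * \<bar>\<xi> \<bullet> \<eta>\<bar> powr \<beta>)"
        by (subst nn_integral_cmult) (auto simp: K(2))
      also have "\<dots> = ennreal t * ennreal (\<bar>\<xi> \<bullet> \<eta>\<bar> powr \<beta>)"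
        using t K(1) by (simp flip: ennreal_mult)
      finally show "(\<integral>\<^sup>+y. ennreal (t / K * y powr (- \<beta> - 1)) * indicator {0<..} y * ennreal (1 - cos (b (\<eta>, y) \<bullet> \<xi>)) \<partial>lborel)
        = ennreal t * ennreal (\<bar>\<xi> \<bullet> \<eta>\<bar> powr \<beta>)" .
    qed
    also have "\<dots> = ennreal t * (\<integral>\<^sup>+\<eta>. ennreal (\<bar>\<xi> \<bullet> \<eta>\<bar> powr \<beta>) \<partial>\<nu>)"
      by (rule nn_integral_cmult[OF measurable_compose[OF borel_measurable_integrable[OF integrable_inner_powr] measurable_ennreal]])
    also have "\<dots> = ennreal t * ennreal (\<psi> \<xi>)"
      unfolding symbol_eq by (subst nn_integral_eq_integral[OF integrable_inner_powr]) auto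
    finally have SUP: "(SUP m. ennreal (\<Psi> m \<xi>)) = ennreal (t * \<psi> \<xi>)"
      using t symbol_nonneg by (simp flip: ennreal_mult)
    have "incseq (\<lambda>m. ennreal (\<Psi> m \<xi>))"
      unfolding \<Psi>_nn incseq_def using w_mono by (auto intro!: nn_integral_mono mult_right_mono)
    hence "(\<lambda>m. ennreal (\<Psi> m \<xi>)) \<longlonglongrightarrow> ennreal (t * \<psi> \<xi>)"
      using LIMSEQ_SUP SUP by metis
    thus ?thesis using \<Psi>_nonneg t symbol_nonneg by (subst (asm) tendsto_ennreal_iff) auto
  qed
  have "positive_transform W (\<lambda>\<xi>. exp (- (t * \<psi> \<xi>)))"
    by (rule positive_transform_limit[OF W(1,2) pos, where B = 1])
      (auto intro!: tendsto_intros lim simp: \<Psi>_nonneg)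
  thus ?thesis by simp
qed

end

subsection \<open>The Green function\<close>

lemma nn_integral_exp_abs_powr:
  assumes "\<beta> > 0" "a > 0"
  shows "(\<integral>\<^sup>+x. ennreal (exp (- a * \<bar>x\<bar> powr \<beta>)) \<partial>lborel) = ennreal (2 / \<beta> * Gamma (1 / \<beta>) * a powr (- (1 / \<beta>)))"
proof -
  have half: "(\<integral>\<^sup>+x\<in>{0<..}. ennreal (exp (- a * x powr \<beta>)) \<partial>lborel) = ennreal (1 / \<beta> * Gamma (1 / \<beta>) * a powr (- (1 / \<beta>)))"
  proof -
    have "(\<integral>\<^sup>+x\<in>{0<..}. ennreal (exp (- a * x powr \<beta>)) \<partial>lborel)
      = (\<integral>\<^sup>+s\<in>{0<..}. ennreal (exp (- a * (s powr (1 / \<beta>)) powr \<beta>)) * ennreal (\<bar>1 / \<beta>\<bar> * s powr (1 / \<beta> - 1)) \<partial>lborel)"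
      using assms by (intro nn_integral_power_substitution) auto
    also have "\<dots> = (\<integral>\<^sup>+s. ennreal (1 / \<beta>) * (ennreal (s powr (1 / \<beta> - 1) * exp (- a * s)) * indicator {0<..} s) \<partial>lborel)"
      using assms by (intro nn_integral_cong) (auto simp: indicator_def powr_powr mult_ac simp flip: ennreal_mult)
    also have "\<dots> = ennreal (1 / \<beta>) * (\<integral>\<^sup>+s\<in>{0<..}. ennreal (s powr (1 / \<beta> - 1) * exp (- a * s)) \<partial>lborel)"
      by (rule nn_integral_cmult) measurable
    also have "\<dots> = ennreal (1 / \<beta>) * ennreal (Gamma (1 / \<beta>) * a powr (- (1 / \<beta>)))"
      by (subst nn_integral_powr_exp) (use assms in auto)
    also have "\<dots> = ennreal (1 / \<beta> * (Gamma (1 / \<beta>) * a powr (- (1 / \<beta>))))"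
      using assms Gamma_real_pos[of "1 / \<beta>"] by (intro ennreal_mult[symmetric]) auto
    finally show ?thesis by (simp add: mult.assoc)
  qed
  have "(\<integral>\<^sup>+x. ennreal (exp (- a * \<bar>x\<bar> powr \<beta>)) \<partial>lborel)
    = (\<integral>\<^sup>+x. ennreal (exp (- a * \<bar>x\<bar> powr \<beta>)) * indicator {0<..} x + ennreal (exp (- a * \<bar>x\<bar> powr \<beta>)) * indicator {0<..} (- x) \<partial>lborel)"
    using AE_lborel_singleton[of "0::real"] by (intro nn_integral_cong_AE) (auto elim!: eventually_mono simp: indicator_def)
  also have "\<dots> = (\<integral>\<^sup>+x\<in>{0<..}. ennreal (exp (- a * \<bar>x\<bar> powr \<beta>)) \<partial>lborel)
     + (\<integral>\<^sup>+x. ennreal (exp (- a * \<bar>x\<bar> powr \<beta>)) * indicator {0<..} (- x) \<partial>lborel)"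
    by (rule nn_integral_add) measurable
  also have "(\<integral>\<^sup>+x. ennreal (exp (- a * \<bar>x\<bar> powr \<beta>)) * indicator {0<..} (- x) \<partial>lborel)
     = (\<integral>\<^sup>+x\<in>{0<..}. ennreal (exp (- a * \<bar>x\<bar> powr \<beta>)) \<partial>lborel)"
    using nn_integral_reflect[of "\<lambda>x. ennreal (exp (- a * \<bar>x\<bar> powr \<beta>)) * indicator {0<..} x" "0::real"] by simp
  also have "(\<integral>\<^sup>+x\<in>{0<..}. ennreal (exp (- a * \<bar>x\<bar> powr \<beta>)) \<partial>lborel) = (\<integral>\<^sup>+x\<in>{0<..}. ennreal (exp (- a * x powr \<beta>)) \<partial>lborel)"
    by (intro nn_integral_cong) (auto simp: indicator_def)
  also note half
  also have "ennreal (1 / \<beta> * Gamma (1 / \<beta>) * a powr (- (1 / \<beta>))) + ennreal (1 / \<beta> * Gamma (1 / \<beta>) * a powr (- (1 / \<beta>)))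
    = ennreal (2 / \<beta> * Gamma (1 / \<beta>) * a powr (- (1 / \<beta>)))"
    using assms Gamma_real_pos[of "1 / \<beta>"] by (subst ennreal_plus[symmetric]) auto
  finally show ?thesis .
qed

context spectral
begin

lemma exp_symbol_bound:
  "\<exists>C>0. \<forall>t>0. (\<integral>\<^sup>+\<xi>. ennreal (exp (- t * \<psi> \<xi>)) \<partial>lborel) \<le> ennreal (C * t powr (- real CARD('n) / \<beta>))"
proof -
  define d where "d = real CARD('n)"
  have d: "d > 0" "d = real DIM(real^'n)" by (simp_all add: d_def)
  define C where "C = (2 / \<beta> * Gamma (1 / \<beta>) * (c0 / d) powr (- (1 / \<beta>))) ^ CARD('n)"
  have C: "C > 0" unfolding C_def using \<beta> c0(1) d Gamma_real_pos[of "1 / \<beta>"] by (intro zero_less_power mult_pos_pos) auto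
  have bound: "(\<integral>\<^sup>+\<xi>. ennreal (exp (- t * \<psi> \<xi>)) \<partial>lborel) \<le> ennreal (C * t powr (- real CARD('n) / \<beta>))" if t: "t > 0" for t
  proof -
    have le: "exp (- t * \<psi> \<xi>) \<le> (\<Prod>b\<in>Basis. exp (- (t * c0 / d) * \<bar>\<xi> \<bullet> b\<bar> powr \<beta>))" for \<xi> :: "real^'n"
    proof -
      have "(\<Sum>b\<in>(Basis :: (real^'n) set). \<bar>\<xi> \<bullet> b\<bar> powr \<beta>) \<le> (\<Sum>b\<in>(Basis :: (real^'n) set). norm \<xi> powr \<beta>)"
        using \<beta> by (intro sum_mono powr_mono2) (auto simp: Basis_le_norm)
      hence "(\<Sum>b\<in>(Basis :: (real^'n) set). \<bar>\<xi> \<bullet> b\<bar> powr \<beta>) \<le> d * norm \<xi> powr \<beta>" using d by simp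
      hence "(t * c0 / d) * (\<Sum>b\<in>(Basis :: (real^'n) set). \<bar>\<xi> \<bullet> b\<bar> powr \<beta>) \<le> (t * c0 / d) * (d * norm \<xi> powr \<beta>)"
        using t c0(1) d by (intro mult_left_mono) auto
      also have "\<dots> = t * (c0 * norm \<xi> powr \<beta>)" using d by simp
      also have "\<dots> \<le> t * \<psi> \<xi>" using t symbol_ge[of \<xi>] by (intro mult_left_mono) auto
      finally show ?thesis by (simp add: exp_sum[symmetric] sum_distrib_left sum_negf)
    qed
    have "(\<integral>\<^sup>+\<xi>. ennreal (exp (- t * \<psi> \<xi>)) \<partial>lborel)
      \<le> (\<integral>\<^sup>+\<xi>. (\<Prod>b\<in>Basis. ennreal (exp (- (t * c0 / d) * \<bar>\<xi> \<bullet> b\<bar> powr \<beta>))) \<partial>(lborel :: (real^'n) measure))"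
      by (intro nn_integral_mono) (subst prod_ennreal, simp, intro ennreal_leI le)
    also have "\<dots> = (\<Prod>b\<in>(Basis :: (real^'n) set). \<integral>\<^sup>+x. ennreal (exp (- (t * c0 / d) * \<bar>x\<bar> powr \<beta>)) \<partial>lborel)"
      by (rule nn_integral_lborel_prod) auto
    also have "\<dots> = (\<Prod>b\<in>(Basis :: (real^'n) set). ennreal (2 / \<beta> * Gamma (1 / \<beta>) * (t * c0 / d) powr (- (1 / \<beta>))))"
      using \<beta> t c0(1) d by (subst nn_integral_exp_abs_powr) auto
    also have "\<dots> = ennreal ((2 / \<beta> * Gamma (1 / \<beta>) * (t * c0 / d) powr (- (1 / \<beta>))) ^ CARD('n))"
      using \<beta> Gamma_real_pos[of "1 / \<beta>"] by (simp add: ennreal_power)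
    also have "(t * c0 / d) powr (- (1 / \<beta>)) = (c0 / d) powr (- (1 / \<beta>)) * t powr (- (1 / \<beta>))"
      using t c0(1) d by (simp add: powr_mult[symmetric] mult.commute)
    also have "(2 / \<beta> * Gamma (1 / \<beta>) * ((c0 / d) powr (- (1 / \<beta>)) * t powr (- (1 / \<beta>)))) ^ CARD('n) = C * (t powr (- (1 / \<beta>))) ^ CARD('n)"
      unfolding C_def by (simp only: power_mult_distrib mult.assoc)
    also have "(t powr (- (1 / \<beta>))) ^ CARD('n) = t powr (- real CARD('n) / \<beta>)"
      using t by (simp add: powr_powr mult.commute flip: powr_realpow)
    finally show ?thesis .
  qed
  show ?thesis by (intro exI[of _ C] conjI allI impI C bound)
qed

lemma integrable_exp_symbol:
  assumes "t > 0"
  shows "integrable lborel (\<lambda>\<xi>. exp (- t * \<psi> \<xi>))"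
proof (rule integrableI_bounded)
  obtain C where "C > 0"
    and C: "\<forall>t>0. (\<integral>\<^sup>+\<xi>. ennreal (exp (- t * \<psi> \<xi>)) \<partial>lborel) \<le> ennreal (C * t powr (- real CARD('n) / \<beta>))"
    using exp_symbol_bound by (elim exE conjE)
  from C[rule_format, OF assms] show "(\<integral>\<^sup>+\<xi>. ennreal (norm (exp (- t * \<psi> \<xi>))) \<partial>lborel) < \<infinity>"
    by (simp add: le_less_trans)
qed measurable

abbreviation G :: "real \<Rightarrow> real^'n \<Rightarrow> real" where "G \<equiv> kernel_G \<beta> \<nu>"

lemma measurable_G [measurable]:
  assumes [measurable]: "f \<in> borel_measurable M" "g \<in> borel_measurable M"
  shows "(\<lambda>z. G (f z) (g z)) \<in> borel_measurable M"
proof -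
  have [measurable]: "(\<lambda>z. \<integral>\<xi>. exp (\<i> * complex_of_real (snd z \<bullet> \<xi>)) * complex_of_real (exp (- fst z * \<psi> \<xi>)) \<partial>lborel)
      \<in> borel_measurable (borel \<Otimes>\<^sub>M borel)"
    by (rule lborel.borel_measurable_lebesgue_integral) measurable
  have "(\<lambda>z. (f z, g z)) \<in> M \<rightarrow>\<^sub>M borel \<Otimes>\<^sub>M borel" by measurable
  from measurable_compose[OF this, of "\<lambda>z. G (fst z) (snd z)"] show ?thesis
    unfolding kernel_G_def by simp
qed

lemma G_eq:
  assumes "t > 0"
  shows "G t x = (\<integral>\<xi>. exp (- t * \<psi> \<xi>) * cos (x \<bullet> \<xi>) \<partial>lborel) / (2 * pi) ^ CARD('n)"
proof -
  let ?f = "\<lambda>\<xi>. exp (\<i> * complex_of_real (x \<bullet> \<xi>)) * complex_of_real (exp (- t * \<psi> \<xi>))"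
  have "integrable lborel ?f"
    by (rule Bochner_Integration.integrable_bound[OF integrable_exp_symbol[OF assms]]) (auto simp: norm_mult)
  hence "(\<integral>\<xi>. Re (?f \<xi>) \<partial>lborel) = Re (\<integral>\<xi>. ?f \<xi> \<partial>lborel)" by (rule integral_Re)
  moreover have "Re (?f \<xi>) = exp (- t * \<psi> \<xi>) * cos (x \<bullet> \<xi>)" for \<xi> by (simp add: Re_exp mult.commute)
  moreover have "(2 * complex_of_real pi) ^ CARD('n) = complex_of_real ((2 * pi) ^ CARD('n))" by simp
  ultimately show ?thesis unfolding kernel_G_def by (simp only: Re_divide_of_real)
qed

lemma integrable_exp_symbol_cos:
  assumes "t > 0"
  shows "integrable lborel (\<lambda>\<xi>. exp (- t * \<psi> \<xi>) * cos (x \<bullet> \<xi>))"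
proof (rule Bochner_Integration.integrable_bound[OF integrable_exp_symbol[OF assms]])
  have "exp (- t * \<psi> \<xi>) * \<bar>cos (x \<bullet> \<xi>)\<bar> \<le> exp (- t * \<psi> \<xi>) * 1" for \<xi>
    by (intro mult_left_mono) auto
  thus "AE \<xi> in lborel. norm (exp (- t * \<psi> \<xi>) * cos (x \<bullet> \<xi>)) \<le> norm (exp (- t * \<psi> \<xi>))"
    by (simp add: abs_mult)
qed measurable

lemma gaussian_tendsto_1: "(\<lambda>m. gaussian (1 / real (Suc m)) x) \<longlonglongrightarrow> 1"
proof -
  have "(\<lambda>m. exp (- ((1 / real (Suc m))\<^sup>2 * (x \<bullet> x) / 2))) \<longlonglongrightarrow> exp (- (0\<^sup>2 * (x \<bullet> x) / 2))"
    by (intro tendsto_intros LIMSEQ_Suc[OF lim_1_over_n]) auto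
  thus ?thesis by (simp add: gaussian_def)
qed

lemma gaussian_le_1: "gaussian s x \<le> 1"
  by (simp add: gaussian_def)

lemma gaussian_nonneg: "0 \<le> gaussian s x"
  by (simp add: gaussian_def)

text \<open>The constant 1 is not integrable for Lebesgue measure, so the closure properties are
  applied to a Gaussian weight; its width then tends to \<infinity>, with exp (- t \<psi>) as
  majorant.\<close>

lemma G_nonneg:
  assumes "t > 0"
  shows "0 \<le> G t x"
proof -
  let ?I = "\<lambda>m. \<integral>\<xi>. exp (- t * \<psi> \<xi>) * cos (x \<bullet> \<xi>) * gaussian (1 / real (Suc m)) \<xi> \<partial>lborel"
  have "0 \<le> ?I m" for m
  proof -
    define s where "s = 1 / real (Suc m)"
    have s: "s > 0" by (simp add: s_def)
    define W where "W = density lborel (\<lambda>\<xi>::real^'n. ennreal (gaussian s \<xi>))"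
    have W_int: "(\<integral>\<xi>. h \<xi> \<partial>W) = (\<integral>\<xi>. h \<xi> * gaussian s \<xi> \<partial>lborel)"
      if [measurable]: "h \<in> borel_measurable borel" for h :: "real^'n \<Rightarrow> real"
      unfolding W_def by (subst integral_density) (auto simp: gaussian_nonneg mult.commute)
    have fin: "finite_measure W"
    proof (rule finite_measureI)
      have "emeasure W (space W) = (\<integral>\<^sup>+\<xi>. ennreal (gaussian s (\<xi>::real^'n)) \<partial>lborel)"
        unfolding W_def by (subst emeasure_density) auto
      also have "\<dots> < \<infinity>"
        using integrable_gaussian[OF s, where 'a = "real^'n"] by (subst nn_integral_eq_integral) (auto simp: gaussian_nonneg)
      finally show "emeasure W (space W) \<noteq> \<infinity>" by simp
    qed
    have sets: "sets W = sets borel" by (simp add: W_def)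
    \<comment> \<open>Base case of the closure properties: the transform of a Gaussian is a positive
      multiple of a Gaussian.\<close>
    have "0 \<le> (\<integral>\<xi>. cos (a \<bullet> \<xi>) \<partial>W)" for a
      using s by (subst W_int) (auto simp: fourier_gaussian gaussian_nonneg)
    hence "positive_transform W (\<lambda>_. 1)" unfolding positive_transform_def by auto
    hence "positive_transform W (\<lambda>\<xi>. exp (- t * \<psi> \<xi>))"
      using assms by (intro positive_transform_exp_symbol fin sets) auto
    hence "0 \<le> (\<integral>\<xi>. exp (- t * \<psi> \<xi>) * cos (x \<bullet> \<xi>) \<partial>W)" unfolding positive_transform_def by blast
    thus ?thesis by (subst (asm) W_int) (auto simp: s_def)
  qed
  moreover have "?I \<longlonglongrightarrow> (\<integral>\<xi>. exp (- t * \<psi> \<xi>) * cos (x \<bullet> \<xi>) \<partial>lborel)"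
  proof (rule integral_dominated_convergence[OF _ _ integrable_exp_symbol[OF assms]])
    have "(\<lambda>m. exp (- t * \<psi> \<xi>) * cos (x \<bullet> \<xi>) * gaussian (1 / real (Suc m)) \<xi>) \<longlonglongrightarrow> exp (- t * \<psi> \<xi>) * cos (x \<bullet> \<xi>) * 1" for \<xi>
      by (intro tendsto_mult_left gaussian_tendsto_1)
    thus "AE \<xi> in lborel. (\<lambda>m. exp (- t * \<psi> \<xi>) * cos (x \<bullet> \<xi>) * gaussian (1 / real (Suc m)) \<xi>) \<longlonglongrightarrow> exp (- t * \<psi> \<xi>) * cos (x \<bullet> \<xi>)"
      by simp
    have "exp (- t * \<psi> \<xi>) * \<bar>cos (x \<bullet> \<xi>)\<bar> * \<bar>gaussian (1 / real (Suc m)) \<xi>\<bar> \<le> exp (- t * \<psi> \<xi>) * 1 * 1" for m \<xi>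
      by (intro mult_mono) (auto simp: gaussian_le_1 gaussian_nonneg)
    thus "AE \<xi> in lborel. norm (exp (- t * \<psi> \<xi>) * cos (x \<bullet> \<xi>) * gaussian (1 / real (Suc m)) \<xi>) \<le> exp (- t * \<psi> \<xi>)" for m
      by (simp add: abs_mult)
  qed auto
  ultimately have "0 \<le> (\<integral>\<xi>. exp (- t * \<psi> \<xi>) * cos (x \<bullet> \<xi>) \<partial>lborel)"
    by (intro LIMSEQ_le_const) auto
  thus ?thesis unfolding G_eq[OF assms] by simp
qed

lemma G_le: "\<exists>C>0. \<forall>t>0. \<forall>x. G t x \<le> C * t powr (- real CARD('n) / \<beta>)"
proof -
  obtain C where C: "C > 0"
    "\<forall>t>0. (\<integral>\<^sup>+\<xi>. ennreal (exp (- t * \<psi> \<xi>)) \<partial>lborel) \<le> ennreal (C * t powr (- real CARD('n) / \<beta>))"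
    using exp_symbol_bound by (elim exE conjE)
  have bound: "G t x \<le> C * t powr (- real CARD('n) / \<beta>)" if t: "t > 0" for t x
  proof -
    have "ennreal (\<integral>\<xi>. exp (- t * \<psi> \<xi>) \<partial>lborel) \<le> ennreal (C * t powr (- real CARD('n) / \<beta>))"
      using C(2)[rule_format, OF t] integrable_exp_symbol[OF t] by (subst nn_integral_eq_integral[symmetric]) auto
    hence le: "(\<integral>\<xi>. exp (- t * \<psi> \<xi>) \<partial>lborel) \<le> C * t powr (- real CARD('n) / \<beta>)"
      using C(1) by (subst (asm) ennreal_le_iff) auto
    have "(\<integral>\<xi>. exp (- t * \<psi> \<xi>) * cos (x \<bullet> \<xi>) \<partial>lborel) \<le> (\<integral>\<xi>. exp (- t * \<psi> \<xi>) \<partial>lborel)"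
      using t by (intro integral_mono integrable_exp_symbol_cos integrable_exp_symbol) (simp_all add: mult_left_le)
    also note le
    finally have "(\<integral>\<xi>. exp (- t * \<psi> \<xi>) * cos (x \<bullet> \<xi>) \<partial>lborel) \<le> C * t powr (- real CARD('n) / \<beta>)" .
    \<comment> \<open>Dropping the factor 1 / (2 * pi) ^ CARD('n) increases the value only because
      the integral is non-negative, which is \<open>G_nonneg\<close> read backwards.\<close>
    moreover have "G t x \<le> (\<integral>\<xi>. exp (- t * \<psi> \<xi>) * cos (x \<bullet> \<xi>) \<partial>lborel) / 1"
    proof -
      have "0 \<le> (\<integral>\<xi>. exp (- t * \<psi> \<xi>) * cos (x \<bullet> \<xi>) \<partial>lborel)"
        using mult_nonneg_nonneg[OF G_nonneg[OF t, of x], of "(2 * pi) ^ CARD('n)"] by (simp add: G_eq[OF t])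
      moreover have "1 \<le> (2 * pi) ^ CARD('n)" using pi_gt3 by (intro one_le_power) auto
      ultimately show ?thesis unfolding G_eq[OF t] by (intro divide_left_mono) auto
    qed
    ultimately show ?thesis by simp
  qed
  show ?thesis by (intro exI[of _ C] conjI allI impI C(1) bound)
qed

text \<open>Integrating \<open>G\<close> against a Gaussian moves the integral to the Fourier side, where the total mass
  of the transformed Gaussian does not depend on its width.\<close>

lemma nn_integral_G_le_1:
  assumes t: "t > 0"
  shows "(\<integral>\<^sup>+x. ennreal (G t x) \<partial>lborel) \<le> 1"
proof -
  have bd: "(\<integral>\<^sup>+x. ennreal (G t x * gaussian s x) \<partial>lborel) \<le> 1" if s: "s > 0" for s
  proof -
    let ?F = "\<lambda>(x::real^'n) \<xi>. exp (- t * \<psi> \<xi>) * cos (x \<bullet> \<xi>) * gaussian s x"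
    \<comment> \<open>The absolute integrability behind Fubini: the cosine is bounded, and what
      remains is a product of integrable functions of x and \<xi>.\<close>
    have int: "integrable (lborel \<Otimes>\<^sub>M lborel) (\<lambda>(x, \<xi>). ?F x \<xi>)"
    proof (rule Bochner_Integration.integrable_bound)
      show "integrable (lborel \<Otimes>\<^sub>M lborel) (\<lambda>(x::real^'n, \<xi>). gaussian s x * exp (- t * \<psi> \<xi>))"
      proof (rule lborel_pair.Fubini_integrable)
        have "integrable lborel (\<lambda>x::real^'n. gaussian s x * (\<integral>\<xi>. exp (- t * \<psi> \<xi>) \<partial>lborel))"
          by (intro integrable_mult_left integrable_gaussian s)
        thus "integrable lborel (\<lambda>x::real^'n. \<integral>\<xi>. norm (case (x, \<xi>) of (x, \<xi>) \<Rightarrow> gaussian s x * exp (- t * \<psi> \<xi>)) \<partial>lborel)"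
          by (simp add: abs_mult gaussian_nonneg)
        show "AE x::real^'n in lborel. integrable lborel (\<lambda>\<xi>. case (x, \<xi>) of (x, \<xi>) \<Rightarrow> gaussian s x * exp (- t * \<psi> \<xi>))"
          using integrable_exp_symbol[OF t] by simp
      qed measurable
      have "norm (?F x \<xi>) \<le> norm (gaussian s x * exp (- t * \<psi> \<xi>))" for x \<xi>
      proof -
        have "exp (- t * \<psi> \<xi>) * \<bar>cos (x \<bullet> \<xi>)\<bar> * gaussian s x \<le> exp (- t * \<psi> \<xi>) * 1 * gaussian s x"
          by (intro mult_right_mono mult_left_mono gaussian_nonneg) auto
        thus ?thesis by (simp add: abs_mult gaussian_nonneg mult.commute)
      qed
      thus "AE z in lborel \<Otimes>\<^sub>M lborel. norm (case z of (x, \<xi>) \<Rightarrow> ?F x \<xi>) \<le> norm (case z of (x, \<xi>) \<Rightarrow> gaussian s x * exp (- t * \<psi> \<xi>))"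
        by auto
    qed measurable
    have "(\<integral>x. G t x * gaussian s x \<partial>lborel) = (\<integral>x. (\<integral>\<xi>. ?F x \<xi> \<partial>lborel) / (2 * pi) ^ CARD('n) \<partial>lborel)"
      by (intro Bochner_Integration.integral_cong refl) (simp add: G_eq[OF t])
    also have "\<dots> = (\<integral>x. (\<integral>\<xi>. ?F x \<xi> \<partial>lborel) \<partial>lborel) / (2 * pi) ^ CARD('n)"
      by (rule integral_divide_zero)
    also have "(\<integral>x. (\<integral>\<xi>. ?F x \<xi> \<partial>lborel) \<partial>lborel) = (\<integral>\<xi>. (\<integral>x. ?F x \<xi> \<partial>lborel) \<partial>lborel)"
      by (rule lborel_pair.Fubini_integral[symmetric, OF int])
    also have "\<dots> = (\<integral>\<xi>. exp (- t * \<psi> \<xi>) * ((sqrt (2 * pi) / s) ^ CARD('n) * gaussian (1 / s) \<xi>) \<partial>lborel)"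
    proof (intro Bochner_Integration.integral_cong refl)
      fix \<xi> :: "real^'n"
      have "(\<integral>x. ?F x \<xi> \<partial>lborel) = (\<integral>x. exp (- t * \<psi> \<xi>) * (cos (\<xi> \<bullet> x) * gaussian s x) \<partial>lborel)"
        by (simp add: inner_commute mult.assoc)
      thus "(\<integral>x. ?F x \<xi> \<partial>lborel) = exp (- t * \<psi> \<xi>) * ((sqrt (2 * pi) / s) ^ CARD('n) * gaussian (1 / s) \<xi>)"
        by (simp add: fourier_gaussian[OF s])
    qed
    also have "\<dots> \<le> (\<integral>\<xi>. (sqrt (2 * pi) / s) ^ CARD('n) * gaussian (1 / s) (\<xi>::real^'n) \<partial>lborel)"
    proof (rule integral_mono)
      show "integrable lborel (\<lambda>\<xi>. exp (- t * \<psi> \<xi>) * ((sqrt (2 * pi) / s) ^ CARD('n) * gaussian (1 / s) \<xi>))"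
      proof (rule Bochner_Integration.integrable_bound)
        show "integrable lborel (\<lambda>\<xi>. exp (- t * \<psi> \<xi>) * (sqrt (2 * pi) / s) ^ CARD('n))"
          by (intro integrable_mult_left integrable_exp_symbol t)
        have "exp (- t * \<psi> \<xi>) * ((sqrt (2 * pi) / s) ^ CARD('n) * gaussian (1 / s) \<xi>)
          \<le> exp (- t * \<psi> \<xi>) * ((sqrt (2 * pi) / s) ^ CARD('n) * 1)" for \<xi> :: "real^'n"
          using s by (intro mult_left_mono gaussian_le_1) auto
        thus "AE \<xi> in lborel. norm (exp (- t * \<psi> \<xi>) * ((sqrt (2 * pi) / s) ^ CARD('n) * gaussian (1 / s) \<xi>))
          \<le> norm (exp (- t * \<psi> \<xi>) * (sqrt (2 * pi) / s) ^ CARD('n))"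
          using s by (simp add: abs_mult gaussian_nonneg)
      qed measurable
      fix \<xi> :: "real^'n"
      have "exp (- t * \<psi> \<xi>) * ((sqrt (2 * pi) / s) ^ CARD('n) * gaussian (1 / s) \<xi>)
        \<le> 1 * ((sqrt (2 * pi) / s) ^ CARD('n) * gaussian (1 / s) \<xi>)"
        using s t symbol_nonneg by (intro mult_right_mono mult_nonneg_nonneg) (auto simp: gaussian_nonneg)
      thus "exp (- t * \<psi> \<xi>) * ((sqrt (2 * pi) / s) ^ CARD('n) * gaussian (1 / s) \<xi>)
        \<le> (sqrt (2 * pi) / s) ^ CARD('n) * gaussian (1 / s) \<xi>" by simp
    qed (use s in \<open>intro integrable_mult_right integrable_gaussian, auto\<close>)
    also have "\<dots> = (sqrt (2 * pi) / s) ^ CARD('n) * (sqrt (2 * pi) / (1 / s)) ^ CARD('n)"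
      using s by (simp add: integral_gaussian)
    also have "\<dots> = (2 * pi) ^ CARD('n)"
      using s by (subst power_mult_distrib[symmetric]) simp
    finally have "(\<integral>x. G t x * gaussian s x \<partial>lborel) \<le> 1" by (simp add: divide_right_mono)
    moreover have "integrable lborel (\<lambda>x. G t x * gaussian s x)"
    proof -
      have "integrable lborel (\<lambda>x. \<integral>\<xi>. ?F x \<xi> \<partial>lborel)"
        using lborel_pair.integrable_fst[OF int] by simp
      hence "integrable lborel (\<lambda>x. (\<integral>\<xi>. ?F x \<xi> \<partial>lborel) / (2 * pi) ^ CARD('n))" by (rule integrable_divide)
      thus ?thesis by (simp add: G_eq[OF t])
    qed
    ultimately show ?thesis
      using G_nonneg[OF t] by (subst nn_integral_eq_integral) (auto simp: gaussian_nonneg)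
  qed
  let ?g = "\<lambda>m x. ennreal (G t x * gaussian (1 / real (Suc m)) x)"
  \<comment> \<open>The parameter 1 / (m + 1) decreases, so the Gaussians widen and increase to
    1.\<close>
  have "incseq ?g"
  proof (rule incseq_SucI, rule le_funI, rule ennreal_leI, rule mult_left_mono)
    fix m and x :: "real^'n"
    have "(1 / real (Suc (Suc m)))\<^sup>2 \<le> (1 / real (Suc m))\<^sup>2"
      by (intro power_mono frac_le) auto
    thus "gaussian (1 / real (Suc m)) x \<le> gaussian (1 / real (Suc (Suc m))) x"
      unfolding gaussian_def by (simp add: mult_right_mono divide_right_mono del: of_nat_Suc)
  qed (rule G_nonneg[OF t])
  moreover have "(\<lambda>m. ?g m x) \<longlonglongrightarrow> ennreal (G t x)" for x
  proof -
    have "(\<lambda>m. G t x * gaussian (1 / real (Suc m)) x) \<longlonglongrightarrow> G t x * 1"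
      by (intro tendsto_mult_left gaussian_tendsto_1)
    thus ?thesis by (intro tendsto_ennrealI) simp
  qed
  ultimately have "(SUP m. ?g m x) = ennreal (G t x)" for x
    by (intro LIMSEQ_unique[OF LIMSEQ_SUP]) (auto simp: incseq_def le_fun_def)
  hence "(\<integral>\<^sup>+x. ennreal (G t x) \<partial>lborel) = (\<integral>\<^sup>+x. (SUP m. ?g m x) \<partial>lborel)" by simp
  also have "\<dots> = (SUP m. \<integral>\<^sup>+x. ?g m x \<partial>lborel)"
    by (rule nn_integral_monotone_convergence_SUP[OF \<open>incseq ?g\<close>]) measurable
  also have "\<dots> \<le> 1" by (intro SUP_least bd) simp
  finally show ?thesis .
qed

end

subsection \<open>Subordination\<close>

lemma nn_integral_less_unique:
  fixes h k :: "real \<Rightarrow> ennreal"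
  assumes [measurable]: "h \<in> borel_measurable borel" "k \<in> borel_measurable borel"
    and eq: "\<And>T. (\<integral>\<^sup>+r\<in>{..<T}. h r \<partial>lborel) = (\<integral>\<^sup>+r\<in>{..<T}. k r \<partial>lborel)"
    and fin: "\<And>T. (\<integral>\<^sup>+r\<in>{..<T}. k r \<partial>lborel) < \<infinity>"
  shows "AE r in lborel. h r = k r"
proof -
  have em: "emeasure (density lborel g) {..<T} = (\<integral>\<^sup>+r\<in>{..<T}. g r \<partial>lborel)"
    if "g \<in> borel_measurable borel" for g and T :: real
    using that by (subst emeasure_density) (auto simp: borel_open)
  \<comment> \<open>The half lines generate the Borel sets and are stable under intersection;
    \<open>fin\<close> makes the measure finite on the exhausting sequence.\<close>
  have "density lborel h = density lborel k"
  proof (rule measure_eqI_generator_eq[where E = "range lessThan" and \<Omega> = UNIV and A = "\<lambda>n. {..<real n}"])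
    show "Int_stable (range lessThan :: real set set)"
    proof (rule Int_stableI)
      fix A B :: "real set" assume "A \<in> range lessThan" "B \<in> range lessThan"
      then obtain a b where "A = {..<a}" "B = {..<b}" by auto
      hence "A \<inter> B = {..<min a b}" by auto
      thus "A \<inter> B \<in> range lessThan" by auto
    qed
    show "(\<Union>n. {..<real n}) = UNIV"
      using reals_Archimedean2 by auto
    show "sets (density lborel h) = sigma_sets UNIV (range lessThan)"
      "sets (density lborel k) = sigma_sets UNIV (range lessThan)"
      by (simp_all add: borel_Iio)
    show "emeasure (density lborel h) {..<real n} \<noteq> \<infinity>" for n
      using fin[of "real n"] eq[of "real n"] by (simp add: em)
  qed (auto simp: em eq)
  thus ?thesis by (intro sigma_finite_measure.density_unique[OF sigma_finite_lborel]) auto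
qed

text \<open>Convolving the equation with \<open>abel_kernel \<alpha>\<close> gives the primitives of
  h and k, since the two kernels convolve to the indicator of the half line. Local integrability is
  assumed of k alone; the equality of primitives passes it on to h.\<close>

lemma abel_inversion:
  fixes h k :: "real \<Rightarrow> ennreal"
  assumes \<alpha>: "0 < \<alpha>" "\<alpha> < 1"
    and [measurable]: "h \<in> borel_measurable borel" "k \<in> borel_measurable borel"
    and eq: "AE t in lborel. (\<integral>\<^sup>+r. abel_kernel (1 - \<alpha>) (t - r) * h r \<partial>lborel) = (\<integral>\<^sup>+r. abel_kernel (1 - \<alpha>) (t - r) * k r \<partial>lborel)"
    and fin: "\<And>T. (\<integral>\<^sup>+r\<in>{..<T}. k r \<partial>lborel) < \<infinity>"
  shows "AE r in lborel. h r = k r"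
proof (rule nn_integral_less_unique)
  have inv: "(\<integral>\<^sup>+t. abel_kernel \<alpha> (T - t) * (\<integral>\<^sup>+r. abel_kernel (1 - \<alpha>) (t - r) * g r \<partial>lborel) \<partial>lborel)
    = (\<integral>\<^sup>+r\<in>{..<T}. g r \<partial>lborel)" if [measurable]: "g \<in> borel_measurable borel" for g T
  proof -
    have "(\<integral>\<^sup>+t. abel_kernel \<alpha> (T - t) * (\<integral>\<^sup>+r. abel_kernel (1 - \<alpha>) (t - r) * g r \<partial>lborel) \<partial>lborel)
      = (\<integral>\<^sup>+t. (\<integral>\<^sup>+r. abel_kernel \<alpha> (T - t) * (abel_kernel (1 - \<alpha>) (t - r) * g r) \<partial>lborel) \<partial>lborel)"
      by (intro nn_integral_cong nn_integral_cmult[symmetric]) measurable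
    also have "\<dots> = (\<integral>\<^sup>+r. (\<integral>\<^sup>+t. abel_kernel \<alpha> (T - t) * (abel_kernel (1 - \<alpha>) (t - r) * g r) \<partial>lborel) \<partial>lborel)"
      by (rule lborel_pair.Fubini') measurable
    also have "\<dots> = (\<integral>\<^sup>+r. g r * indicator {..<T} r \<partial>lborel)"
    proof (rule nn_integral_cong)
      fix r
      have "(\<integral>\<^sup>+t. abel_kernel \<alpha> (T - t) * (abel_kernel (1 - \<alpha>) (t - r) * g r) \<partial>lborel)
        = (\<integral>\<^sup>+t. abel_kernel \<alpha> (T - r - (t - r)) * abel_kernel (1 - \<alpha>) (t - r) \<partial>lborel) * g r"
        by (subst nn_integral_multc[symmetric]) (auto simp: mult.assoc)
      also have "(\<integral>\<^sup>+t. abel_kernel \<alpha> (T - r - (t - r)) * abel_kernel (1 - \<alpha>) (t - r) \<partial>lborel)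
        = (\<integral>\<^sup>+t. abel_kernel \<alpha> (T - r - t) * abel_kernel (1 - \<alpha>) t \<partial>lborel)"
        by (rule nn_integral_shift[of "\<lambda>t. abel_kernel \<alpha> (T - r - t) * abel_kernel (1 - \<alpha>) t"]) measurable
      also have "\<dots> = indicator {0<..} (T - r)"
        by (rule abel_kernel_convolution[OF \<alpha>])
      finally show "(\<integral>\<^sup>+t. abel_kernel \<alpha> (T - t) * (abel_kernel (1 - \<alpha>) (t - r) * g r) \<partial>lborel) = g r * indicator {..<T} r"
        by (simp add: indicator_def)
    qed
    finally show ?thesis .
  qed
  fix T
  have "(\<integral>\<^sup>+t. abel_kernel \<alpha> (T - t) * (\<integral>\<^sup>+r. abel_kernel (1 - \<alpha>) (t - r) * h r \<partial>lborel) \<partial>lborel)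
    = (\<integral>\<^sup>+t. abel_kernel \<alpha> (T - t) * (\<integral>\<^sup>+r. abel_kernel (1 - \<alpha>) (t - r) * k r \<partial>lborel) \<partial>lborel)"
    using eq by (intro nn_integral_cong_AE) (auto elim!: eventually_mono)
  thus "(\<integral>\<^sup>+r\<in>{..<T}. h r \<partial>lborel) = (\<integral>\<^sup>+r\<in>{..<T}. k r \<partial>lborel)"
    by (simp add: inv)
qed (use fin in auto)

section \<open>The subordinated kernels and their Abel equation\<close>

locale kernels = spectral \<beta> \<nu> c0 + stable_law \<alpha> p
  for \<beta> :: real and \<nu> :: "(real^'n) measure" and c0 \<alpha> :: real and p :: "real \<Rightarrow> real"
begin

text \<open>One form for both kernels: a = 0 yields Z, and a = \<alpha> yields Y up to a power of t,
  so a single convolution estimate covers them.\<close>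

definition subordinated :: "real \<Rightarrow> real \<Rightarrow> real^'n \<Rightarrow> ennreal" where
  "subordinated a t x = (\<integral>\<^sup>+\<tau>. ennreal (G ((t / \<tau>) powr \<alpha>) x) * (ennreal (\<tau> powr (- a)) * P \<tau>) \<partial>lborel)"

definition Z' :: "real \<Rightarrow> real^'n \<Rightarrow> ennreal" where
  "Z' = subordinated 0"

text \<open>The candidate for Y, extended by 0 so that \<open>abel_kernel\<close> can be convolved
  with it over the whole line.\<close>

definition Y' :: "real \<Rightarrow> real^'n \<Rightarrow> ennreal" where
  "Y' t x = ennreal (\<alpha> * t powr (\<alpha> - 1)) * subordinated \<alpha> t x * indicator {0<..} t"

lemma measurable_subordinated [measurable]:
  assumes [measurable]: "f \<in> borel_measurable M" "g \<in> borel_measurable M"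
  shows "(\<lambda>z. subordinated a (f z) (g z)) \<in> borel_measurable M"
  unfolding subordinated_def by measurable

lemma measurable_Z' [measurable]:
  assumes [measurable]: "f \<in> borel_measurable M" "g \<in> borel_measurable M"
  shows "(\<lambda>z. Z' (f z) (g z)) \<in> borel_measurable M"
  unfolding Z'_def by measurable

lemma measurable_Y' [measurable]:
  assumes [measurable]: "f \<in> borel_measurable M" "g \<in> borel_measurable M"
  shows "(\<lambda>z. Y' (f z) (g z)) \<in> borel_measurable M"
  unfolding Y'_def by measurable

lemma Z'_eq: "Z' t x = (\<integral>\<^sup>+\<tau>. ennreal (G ((t / \<tau>) powr \<alpha>) x) * P \<tau> \<partial>lborel)"
  unfolding Z'_def subordinated_def by (intro nn_integral_cong) (auto simp: indicator_def)

text \<open>Substitute s = \<tau> powr (- \<alpha>): the Jacobian cancels s powr (- 1 - 1 /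
  \<alpha>) and the prefactor 1 / \<alpha>. Where the integral diverges both sides are 0, the
  default value of the Bochner integral and of \<open>enn2real\<close>.\<close>

lemma kernel_Z_eq:
  assumes "G\<alpha> 1 = p" and t: "t > 0"
  shows "kernel_Z \<alpha> \<beta> \<nu> G\<alpha> t x = enn2real (Z' t x)"
proof -
  let ?h = "\<lambda>s. G (t powr \<alpha> * s) x * s powr (- 1 - 1 / \<alpha>) * p (s powr (- 1 / \<alpha>))"
  have nonneg: "0 \<le> ?h s" if "s > 0" for s
    using that t by (intro mult_nonneg_nonneg G_nonneg p_nonneg) auto
  have "(LINT s:{0<..}|lborel. ?h s) = enn2real (\<integral>\<^sup>+s. ennreal (indicator {0<..} s *\<^sub>R ?h s) \<partial>lborel)"
    unfolding set_lebesgue_integral_def using nonneg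
    by (intro integral_eq_nn_integral) (auto simp: indicator_def)
  also have "(\<integral>\<^sup>+s. ennreal (indicator {0<..} s *\<^sub>R ?h s) \<partial>lborel) = (\<integral>\<^sup>+s\<in>{0<..}. ennreal (?h s) \<partial>lborel)"
    by (intro nn_integral_cong) (auto simp: indicator_def)
  also have "\<dots> = (\<integral>\<^sup>+\<tau>\<in>{0<..}. ennreal (?h (\<tau> powr (- \<alpha>))) * ennreal (\<bar>- \<alpha>\<bar> * \<tau> powr (- \<alpha> - 1)) \<partial>lborel)"
    using \<alpha> by (intro nn_integral_power_substitution) auto
  also have "\<dots> = (\<integral>\<^sup>+\<tau>. ennreal \<alpha> * (ennreal (G ((t / \<tau>) powr \<alpha>) x) * P \<tau>) \<partial>lborel)"
  proof (rule nn_integral_cong)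
    fix \<tau> :: real
    show "ennreal (?h (\<tau> powr (- \<alpha>))) * ennreal (\<bar>- \<alpha>\<bar> * \<tau> powr (- \<alpha> - 1)) * indicator {0<..} \<tau>
      = ennreal \<alpha> * (ennreal (G ((t / \<tau>) powr \<alpha>) x) * P \<tau>)"
    proof (cases "\<tau> > 0")
      case True
      have e1: "t powr \<alpha> * \<tau> powr (- \<alpha>) = (t / \<tau>) powr \<alpha>"
        using True t by (simp add: powr_divide powr_minus_divide)
      have e2: "(\<tau> powr (- \<alpha>)) powr (- 1 / \<alpha>) = \<tau>"
        using True \<alpha> by (simp add: powr_powr)
      have "(- \<alpha>) * (- 1 - 1 / \<alpha>) = \<alpha> + 1" using \<alpha> by (simp add: field_simps)
      hence e3: "(\<tau> powr (- \<alpha>)) powr (- 1 - 1 / \<alpha>) * \<tau> powr (- \<alpha> - 1) = 1"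
        using True by (simp add: powr_powr flip: powr_add)
      have "?h (\<tau> powr (- \<alpha>)) * (\<alpha> * \<tau> powr (- \<alpha> - 1))
        = \<alpha> * (G ((t / \<tau>) powr \<alpha>) x * p \<tau>) * ((\<tau> powr (- \<alpha>)) powr (- 1 - 1 / \<alpha>) * \<tau> powr (- \<alpha> - 1))"
        unfolding e1 e2 by (simp only: mult_ac)
      also have "\<dots> = \<alpha> * (G ((t / \<tau>) powr \<alpha>) x * p \<tau>)" unfolding e3 by simp
      finally have "ennreal (?h (\<tau> powr (- \<alpha>)) * (\<alpha> * \<tau> powr (- \<alpha> - 1))) = ennreal (\<alpha> * (G ((t / \<tau>) powr \<alpha>) x * p \<tau>))"
        by (rule arg_cong)
      moreover have "0 \<le> ?h (\<tau> powr (- \<alpha>))" using True by (intro nonneg) simp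
      moreover have "0 \<le> G ((t / \<tau>) powr \<alpha>) x" "0 \<le> p \<tau>" using True t by (auto intro: G_nonneg p_nonneg)
      ultimately show ?thesis using True \<alpha> by (simp add: ennreal_mult)
    qed simp
  qed
  also have "\<dots> = ennreal \<alpha> * Z' t x"
    unfolding Z'_eq by (rule nn_integral_cmult) measurable
  finally have "(LINT s:{0<..}|lborel. ?h s) = \<alpha> * enn2real (Z' t x)"
    using \<alpha> by (simp add: enn2real_mult)
  thus ?thesis using \<alpha> assms(1) by (simp add: kernel_Z_def)
qed

lemma nn_integral_Z'_le_1:
  assumes t: "t > 0"
  shows "(\<integral>\<^sup>+x. Z' t x \<partial>lborel) \<le> 1"
proof -
  have "(\<integral>\<^sup>+x. Z' t x \<partial>lborel) = (\<integral>\<^sup>+\<tau>. (\<integral>\<^sup>+x. ennreal (G ((t / \<tau>) powr \<alpha>) x) * P \<tau> \<partial>lborel) \<partial>lborel)"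
    unfolding Z'_eq by (rule lborel_pair.Fubini') measurable
  also have "\<dots> = (\<integral>\<^sup>+\<tau>. (\<integral>\<^sup>+x. ennreal (G ((t / \<tau>) powr \<alpha>) x) \<partial>lborel) * P \<tau> \<partial>lborel)"
    by (intro nn_integral_cong nn_integral_multc) measurable
  also have "\<dots> \<le> (\<integral>\<^sup>+\<tau>. 1 * P \<tau> \<partial>lborel)"
  proof (rule nn_integral_mono)
    fix \<tau> :: real
    show "(\<integral>\<^sup>+x. ennreal (G ((t / \<tau>) powr \<alpha>) x) \<partial>lborel) * P \<tau> \<le> 1 * P \<tau>"
    proof (cases "\<tau> > 0")
      case True
      thus ?thesis using t by (intro mult_right_mono nn_integral_G_le_1) auto
    qed simp
  qed
  also have "\<dots> = 1" using p_total by simp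
  finally show ?thesis .
qed

lemma abel_kernel_scale:
  assumes "\<sigma> > 0"
  shows "abel_kernel (1 - \<alpha>) (u / \<sigma>) = ennreal (\<sigma> powr \<alpha>) * abel_kernel (1 - \<alpha>) u"
proof (cases "u > 0")
  case True
  have "(u / \<sigma>) powr (- \<alpha>) = \<sigma> powr \<alpha> * u powr (- \<alpha>)"
    using True assms by (simp add: powr_divide powr_minus field_simps)
  moreover have "Gamma (1 - \<alpha>) > 0" using \<alpha> by (intro Gamma_real_pos) simp
  ultimately show ?thesis
    using True assms by (simp add: abel_kernel_def g_frac_def flip: ennreal_mult)
qed (use assms in \<open>simp add: abel_kernel_def zero_less_divide_iff\<close>)

text \<open>The substitution \<tau> = r \<sigma> leaves r in the argument of p only, so that a
  convolution in r acts on nothing else.\<close>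

lemma Y'_eq:
  "Y' r x = (\<integral>\<^sup>+\<sigma>\<in>{0<..}. ennreal (G (\<sigma> powr (- \<alpha>)) x) * ennreal (\<alpha> * \<sigma> powr (- \<alpha>)) * P (r * \<sigma>) \<partial>lborel)"
proof (cases "r > 0")
  case True
  have "Y' r x = ennreal (\<alpha> * r powr (\<alpha> - 1)) *
      (\<integral>\<^sup>+\<tau>\<in>{0<..}. ennreal (G ((r / \<tau>) powr \<alpha>) x) * (ennreal (\<tau> powr (- \<alpha>)) * P \<tau>) \<partial>lborel)"
    using True unfolding Y'_def subordinated_def
    by (simp, intro arg_cong[where f = "\<lambda>z. _ * z"] nn_integral_cong) (auto simp: indicator_def)
  also have "(\<integral>\<^sup>+\<tau>\<in>{0<..}. ennreal (G ((r / \<tau>) powr \<alpha>) x) * (ennreal (\<tau> powr (- \<alpha>)) * P \<tau>) \<partial>lborel)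
    = ennreal r * (\<integral>\<^sup>+\<sigma>\<in>{0<..}. ennreal (G ((r / (r * \<sigma>)) powr \<alpha>) x) * (ennreal ((r * \<sigma>) powr (- \<alpha>)) * P (r * \<sigma>)) \<partial>lborel)"
    by (rule nn_integral_scale_half_line) (use True in auto)
  also have "ennreal (\<alpha> * r powr (\<alpha> - 1)) * \<dots>
    = (\<integral>\<^sup>+\<sigma>. ennreal (\<alpha> * r powr (\<alpha> - 1)) * ennreal r *
        (ennreal (G ((r / (r * \<sigma>)) powr \<alpha>) x) * (ennreal ((r * \<sigma>) powr (- \<alpha>)) * P (r * \<sigma>)) * indicator {0<..} \<sigma>) \<partial>lborel)"
    by (subst nn_integral_cmult) (auto simp: mult.assoc)
  also have "\<dots> = (\<integral>\<^sup>+\<sigma>\<in>{0<..}. ennreal (G (\<sigma> powr (- \<alpha>)) x) * ennreal (\<alpha> * \<sigma> powr (- \<alpha>)) * P (r * \<sigma>) \<partial>lborel)"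
  proof (rule nn_integral_cong)
    fix \<sigma> :: real
    show "ennreal (\<alpha> * r powr (\<alpha> - 1)) * ennreal r *
        (ennreal (G ((r / (r * \<sigma>)) powr \<alpha>) x) * (ennreal ((r * \<sigma>) powr (- \<alpha>)) * P (r * \<sigma>)) * indicator {0<..} \<sigma>)
      = ennreal (G (\<sigma> powr (- \<alpha>)) x) * ennreal (\<alpha> * \<sigma> powr (- \<alpha>)) * P (r * \<sigma>) * indicator {0<..} \<sigma>"
    proof (cases "\<sigma> > 0")
      case True': True
      have e1: "(r / (r * \<sigma>)) powr \<alpha> = \<sigma> powr (- \<alpha>)"
        using True True' by (simp add: powr_divide powr_minus_divide)
      have "\<alpha> * r powr (\<alpha> - 1) * r * (r * \<sigma>) powr (- \<alpha>) = \<alpha> * \<sigma> powr (- \<alpha>)"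
        using True True' by (simp add: powr_mult powr_diff powr_minus field_simps)
      hence e2: "ennreal (\<alpha> * r powr (\<alpha> - 1)) * ennreal r * ennreal ((r * \<sigma>) powr (- \<alpha>)) = ennreal (\<alpha> * \<sigma> powr (- \<alpha>))"
        using True \<alpha> by (simp flip: ennreal_mult)
      have "ennreal (\<alpha> * r powr (\<alpha> - 1)) * ennreal r * (ennreal (G ((r / (r * \<sigma>)) powr \<alpha>) x) * (ennreal ((r * \<sigma>) powr (- \<alpha>)) * P (r * \<sigma>)))
        = ennreal (G (\<sigma> powr (- \<alpha>)) x) * (ennreal (\<alpha> * r powr (\<alpha> - 1)) * ennreal r * ennreal ((r * \<sigma>) powr (- \<alpha>))) * P (r * \<sigma>)"
        unfolding e1 by (simp only: mult_ac)
      thus ?thesis unfolding e2 using True' by simp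
    qed simp
  qed
  finally show ?thesis .
next
  case False
  have "P (r * \<sigma>) * indicator {0<..} \<sigma> = 0" for \<sigma> :: real
    using False by (auto simp: indicator_def zero_less_mult_iff)
  hence "ennreal (G (\<sigma> powr (- \<alpha>)) x) * ennreal (\<alpha> * \<sigma> powr (- \<alpha>)) * P (r * \<sigma>) * indicator {0<..} \<sigma> = 0" for \<sigma>
    by (metis mult.assoc mult_zero_right)
  thus ?thesis using False by (simp add: Y'_def del: mult_eq_0_iff)
qed

text \<open>By \<open>Y'_eq\<close> and Tonelli the convolution is taken at fixed \<sigma>, where it
  is the rescaled identity \<open>abel_convolution_p\<close>. The powers of \<sigma> cancel, and
  \<tau> = t \<sigma> leads back to the formula for \<open>Z'\<close>.\<close>

lemma abel_convolution_Y':
  assumes t: "t > 0"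
  shows "(\<integral>\<^sup>+r. abel_kernel (1 - \<alpha>) (t - r) * Y' r x \<partial>lborel) = Z' t x"
proof -
  define \<phi> where "\<phi> u = (\<integral>\<^sup>+r. abel_kernel (1 - \<alpha>) (u - r) * P r \<partial>lborel)" for u
  have [measurable]: "\<phi> \<in> borel_measurable borel" unfolding \<phi>_def by measurable
  let ?c = "\<lambda>\<sigma>. ennreal (G (\<sigma> powr (- \<alpha>)) x) * ennreal (\<alpha> * \<sigma> powr (- \<alpha>)) * indicator {0<..} \<sigma>"
  have inner: "(\<integral>\<^sup>+r. abel_kernel (1 - \<alpha>) (t - r) * P (r * \<sigma>) \<partial>lborel) = ennreal (\<sigma> powr (\<alpha> - 1)) * \<phi> (t * \<sigma>)"
    if "\<sigma> > 0" for \<sigma>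
  proof -
    have "(\<integral>\<^sup>+r. abel_kernel (1 - \<alpha>) (t - r) * P (r * \<sigma>) \<partial>lborel)
      = ennreal \<bar>1 / \<sigma>\<bar> * (\<integral>\<^sup>+r. abel_kernel (1 - \<alpha>) (t - (0 + 1 / \<sigma> * r)) * P ((0 + 1 / \<sigma> * r) * \<sigma>) \<partial>lborel)"
      by (rule nn_integral_real_affine) (use that in auto)
    also have "(\<integral>\<^sup>+r. abel_kernel (1 - \<alpha>) (t - (0 + 1 / \<sigma> * r)) * P ((0 + 1 / \<sigma> * r) * \<sigma>) \<partial>lborel)
      = (\<integral>\<^sup>+r. ennreal (\<sigma> powr \<alpha>) * (abel_kernel (1 - \<alpha>) (t * \<sigma> - r) * P r) \<partial>lborel)"
    proof (rule nn_integral_cong)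
      fix r
      have "t - (0 + 1 / \<sigma> * r) = (t * \<sigma> - r) / \<sigma>" "(0 + 1 / \<sigma> * r) * \<sigma> = r"
        using that by (simp_all add: field_simps)
      thus "abel_kernel (1 - \<alpha>) (t - (0 + 1 / \<sigma> * r)) * P ((0 + 1 / \<sigma> * r) * \<sigma>)
        = ennreal (\<sigma> powr \<alpha>) * (abel_kernel (1 - \<alpha>) (t * \<sigma> - r) * P r)"
        by (simp only: abel_kernel_scale[OF that] mult.assoc)
    qed
    also have "\<dots> = ennreal (\<sigma> powr \<alpha>) * \<phi> (t * \<sigma>)"
      unfolding \<phi>_def by (rule nn_integral_cmult) measurable
    also have "ennreal \<bar>1 / \<sigma>\<bar> * (ennreal (\<sigma> powr \<alpha>) * \<phi> (t * \<sigma>)) = ennreal (\<bar>1 / \<sigma>\<bar> * \<sigma> powr \<alpha>) * \<phi> (t * \<sigma>)"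
      by (subst ennreal_mult) (auto simp: mult.assoc)
    also have "\<bar>1 / \<sigma>\<bar> * \<sigma> powr \<alpha> = \<sigma> powr (\<alpha> - 1)"
      using that by (simp add: powr_diff)
    finally show ?thesis .
  qed
  \<comment> \<open>The identity holds for almost every u; the dilation u = t \<sigma> carries the
    null set over to \<sigma>.\<close>
  have AE\<phi>: "AE \<sigma> in lborel. \<sigma> > 0 \<longrightarrow> \<phi> (t * \<sigma>) = ennreal (t * \<sigma> / \<alpha>) * ennreal (p (t * \<sigma>))"
  proof -
    have "AE u in lborel. u > 0 \<longrightarrow> \<phi> u = ennreal (u / \<alpha>) * ennreal (p u)"
      using abel_convolution_p unfolding \<phi>_def .
    from AE_borel_affine[OF _ _ this, of t 0] t
    have "AE \<sigma> in lborel. 0 + t * \<sigma> > 0 \<longrightarrow> \<phi> (0 + t * \<sigma>) = ennreal ((0 + t * \<sigma>) / \<alpha>) * ennreal (p (0 + t * \<sigma>))"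
      by simp
    thus ?thesis by (rule eventually_mono) (use t in \<open>simp add: zero_less_mult_iff\<close>)
  qed
  have "(\<integral>\<^sup>+r. abel_kernel (1 - \<alpha>) (t - r) * Y' r x \<partial>lborel)
    = (\<integral>\<^sup>+r. (\<integral>\<^sup>+\<sigma>. ?c \<sigma> * (abel_kernel (1 - \<alpha>) (t - r) * P (r * \<sigma>)) \<partial>lborel) \<partial>lborel)"
    unfolding Y'_eq by (subst nn_integral_cmult[symmetric]) (auto simp: mult_ac)
  also have "\<dots> = (\<integral>\<^sup>+\<sigma>. (\<integral>\<^sup>+r. ?c \<sigma> * (abel_kernel (1 - \<alpha>) (t - r) * P (r * \<sigma>)) \<partial>lborel) \<partial>lborel)"
    by (rule lborel_pair.Fubini') measurable
  also have "\<dots> = (\<integral>\<^sup>+\<sigma>. ?c \<sigma> * (\<integral>\<^sup>+r. abel_kernel (1 - \<alpha>) (t - r) * P (r * \<sigma>) \<partial>lborel) \<partial>lborel)"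
    by (intro nn_integral_cong nn_integral_cmult) measurable
  also have "\<dots> = (\<integral>\<^sup>+\<sigma>. ennreal t * (ennreal (G (\<sigma> powr (- \<alpha>)) x) * P (t * \<sigma>) * indicator {0<..} \<sigma>) \<partial>lborel)"
  proof (rule nn_integral_cong_AE, use AE\<phi> in eventually_elim)
    fix \<sigma> :: real
    assume *: "\<sigma> > 0 \<longrightarrow> \<phi> (t * \<sigma>) = ennreal (t * \<sigma> / \<alpha>) * ennreal (p (t * \<sigma>))"
    show "?c \<sigma> * (\<integral>\<^sup>+r. abel_kernel (1 - \<alpha>) (t - r) * P (r * \<sigma>) \<partial>lborel)
      = ennreal t * (ennreal (G (\<sigma> powr (- \<alpha>)) x) * P (t * \<sigma>) * indicator {0<..} \<sigma>)"
    proof (cases "\<sigma> > 0")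
      case True
      have "\<alpha> * \<sigma> powr (- \<alpha>) * \<sigma> powr (\<alpha> - 1) * (t * \<sigma> / \<alpha>) = t"
        using True \<alpha> by (simp add: powr_diff powr_minus field_simps)
      hence e: "ennreal (\<alpha> * \<sigma> powr (- \<alpha>)) * ennreal (\<sigma> powr (\<alpha> - 1)) * ennreal (t * \<sigma> / \<alpha>) = ennreal t"
        using True \<alpha> t by (simp flip: ennreal_mult)
      have "?c \<sigma> * (\<integral>\<^sup>+r. abel_kernel (1 - \<alpha>) (t - r) * P (r * \<sigma>) \<partial>lborel)
        = (ennreal (\<alpha> * \<sigma> powr (- \<alpha>)) * ennreal (\<sigma> powr (\<alpha> - 1)) * ennreal (t * \<sigma> / \<alpha>)) *
          (ennreal (G (\<sigma> powr (- \<alpha>)) x) * ennreal (p (t * \<sigma>)) * indicator {0<..} \<sigma>)"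
        unfolding inner[OF True] using * True by (simp only: mult_ac simp_thms)
      thus ?thesis unfolding e using True t by simp
    qed simp
  qed
  also have "\<dots> = ennreal t * (\<integral>\<^sup>+\<sigma>\<in>{0<..}. ennreal (G (\<sigma> powr (- \<alpha>)) x) * P (t * \<sigma>) \<partial>lborel)"
    by (rule nn_integral_cmult) measurable
  also have "(\<integral>\<^sup>+\<sigma>\<in>{0<..}. ennreal (G (\<sigma> powr (- \<alpha>)) x) * P (t * \<sigma>) \<partial>lborel)
    = (\<integral>\<^sup>+\<sigma>\<in>{0<..}. ennreal (G ((t / (t * \<sigma>)) powr \<alpha>) x) * P (t * \<sigma>) \<partial>lborel)"
    using t by (intro nn_integral_cong) (auto simp: indicator_def powr_divide powr_minus_divide)
  also have "ennreal t * \<dots> = (\<integral>\<^sup>+\<tau>\<in>{0<..}. ennreal (G ((t / \<tau>) powr \<alpha>) x) * P \<tau> \<partial>lborel)"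
    by (rule nn_integral_scale_half_line[symmetric]) (use t in auto)
  also have "\<dots> = Z' t x"
    unfolding Z'_eq by (intro nn_integral_cong) (auto simp: indicator_def)
  finally show ?thesis .
qed

text \<open>At fixed x both Y and \<open>Y'\<close> solve the same Abel equation, so they should
  agree almost everywhere. The sign of Y being unknown, its parts are compared instead, in a form
  free of subtraction. The inequality is all that the estimates use.\<close>

lemma kernel_Y_le_Y':
  assumes p: "G\<alpha> 1 = p" and Y: "is_kernel_Y \<alpha> (kernel_Z \<alpha> \<beta> \<nu> G\<alpha>) Y"
  shows "AE t in lborel. AE x in lborel. t > 0 \<longrightarrow> ennreal (Y t x) \<le> Y' t x"
proof -
  have Y_pair: "(\<lambda>(t, x). Y t x) \<in> borel_measurable (borel \<Otimes>\<^sub>M borel)"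
    using Y unfolding is_kernel_Y_def borel_prod by simp
  have meas [measurable]: "(\<lambda>z. Y (f z) (g z)) \<in> borel_measurable M"
    if [measurable]: "f \<in> borel_measurable M" "g \<in> borel_measurable M" for f g and M :: "'c measure"
    using measurable_compose[OF _ Y_pair, of "\<lambda>z. (f z, g z)" M] by simp
  have Yint: "set_integrable lborel {0<..<t} (\<lambda>s. g_frac (1 - \<alpha>) (t - s) * Y s x)"
    and YZ: "kernel_Z \<alpha> \<beta> \<nu> G\<alpha> t x = (LINT s:{0<..<t}|lborel. g_frac (1 - \<alpha>) (t - s) * Y s x)"
    if "t > 0" "x \<noteq> 0" for t x
    using Y that unfolding is_kernel_Y_def by auto
  have \<Gamma>: "Gamma (1 - \<alpha>) > 0" using \<alpha> by (intro Gamma_real_pos) simp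
  \<comment> \<open>Where \<open>Z'\<close> is infinite, \<open>kernel_Z\<close> is 0 and its
    equation carries no information about \<open>Z'\<close>. The mass bound excludes this for almost
    every x at each t; the quantifiers are then exchanged, because the Abel equation lives at fixed
    x.\<close>
  have "AE t in lborel. AE x in lborel. t > 0 \<longrightarrow> Z' t x < \<infinity>"
  proof (rule AE_I2)
    fix t :: real
    show "AE x in lborel. t > 0 \<longrightarrow> Z' t x < \<infinity>"
    proof (cases "t > 0")
      case True
      have "(\<integral>\<^sup>+x. Z' t x \<partial>lborel) \<noteq> \<infinity>"
        using nn_integral_Z'_le_1[OF True] by (auto simp: top_unique)
      from nn_integral_noteq_infinite[OF _ this] show ?thesis by (auto simp: less_top elim!: eventually_mono)
    qed simp
  qed
  hence "AE x in lborel. AE t in lborel. t > 0 \<longrightarrow> Z' t x < \<infinity>"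
    by (subst (asm) lborel_pair.AE_commute) measurable
  moreover have "AE x in lborel. (x::real^'n) \<noteq> 0" by (rule AE_lborel_singleton)
  ultimately have "AE x in lborel. AE t in lborel. t > 0 \<longrightarrow> ennreal (Y t x) \<le> Y' t x"
  proof eventually_elim
    fix x :: "real^'n"
    assume fin: "AE t in lborel. t > 0 \<longrightarrow> Z' t x < \<infinity>" and x: "x \<noteq> 0"
    define Yp where "Yp r = ennreal (Y r x) * indicator {0<..} r" for r
    define Yn where "Yn r = ennreal (- Y r x) * indicator {0<..} r" for r
    have [measurable]: "Yp \<in> borel_measurable borel" "Yn \<in> borel_measurable borel"
      unfolding Yp_def Yn_def by measurable
    let ?A = "\<lambda>t. \<integral>\<^sup>+r. abel_kernel (1 - \<alpha>) (t - r) * Yp r \<partial>lborel"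
    let ?B = "\<lambda>t. \<integral>\<^sup>+r. abel_kernel (1 - \<alpha>) (t - r) * Yn r \<partial>lborel"
    let ?f = "\<lambda>t s. indicator {0<..<t} s *\<^sub>R (g_frac (1 - \<alpha>) (t - s) * Y s x)"
    have f_pos: "ennreal (?f t s) = abel_kernel (1 - \<alpha>) (t - s) * Yp s"
      and f_neg: "ennreal (- ?f t s) = abel_kernel (1 - \<alpha>) (t - s) * Yn s" for t s
      using \<Gamma> by (auto simp: Yp_def Yn_def abel_kernel_def g_frac_def indicator_def ennreal_mult'[symmetric])
    have AB: "?A t < \<infinity>" "?B t < \<infinity>" "kernel_Z \<alpha> \<beta> \<nu> G\<alpha> t x = enn2real (?A t) - enn2real (?B t)" if "t > 0" for t
    proof -
      have int: "integrable lborel (?f t)" using Yint[OF that x] by (simp add: set_integrable_def)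
      show "?A t < \<infinity>" "?B t < \<infinity>"
        using int unfolding real_integrable_def f_pos f_neg by (auto simp: less_top)
      show "kernel_Z \<alpha> \<beta> \<nu> G\<alpha> t x = enn2real (?A t) - enn2real (?B t)"
        unfolding YZ[OF that x] set_lebesgue_integral_def real_lebesgue_integral_def[OF int] f_pos f_neg ..
    qed
    \<comment> \<open>The identity Y = Y' with the negative part moved to the other side; both sides
      are now non-negative and \<open>abel_inversion\<close> applies.\<close>
    have "AE r in lborel. Y' r x + Yn r = Yp r"
    proof (rule abel_inversion[OF \<alpha>])
      show "AE t in lborel. (\<integral>\<^sup>+r. abel_kernel (1 - \<alpha>) (t - r) * (Y' r x + Yn r) \<partial>lborel) = ?A t"
        using fin
      proof eventually_elim
        fix t :: real
        assume *: "t > 0 \<longrightarrow> Z' t x < \<infinity>"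
        show "(\<integral>\<^sup>+r. abel_kernel (1 - \<alpha>) (t - r) * (Y' r x + Yn r) \<partial>lborel) = ?A t"
        proof (cases "t > 0")
          case True
          have "(\<integral>\<^sup>+r. abel_kernel (1 - \<alpha>) (t - r) * (Y' r x + Yn r) \<partial>lborel)
            = (\<integral>\<^sup>+r. abel_kernel (1 - \<alpha>) (t - r) * Y' r x \<partial>lborel) + ?B t"
            by (simp add: distrib_left nn_integral_add)
          also have "\<dots> = Z' t x + ?B t" by (simp only: abel_convolution_Y'[OF True])
          also have "\<dots> = ?A t"
          proof -
            obtain z where z: "Z' t x = ennreal z" "z \<ge> 0" using * True by (cases "Z' t x") auto
            obtain a where a: "?A t = ennreal a" "a \<ge> 0" using AB(1)[OF True] by (cases "?A t") auto
            obtain b where b: "?B t = ennreal b" "b \<ge> 0" using AB(2)[OF True] by (cases "?B t") auto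
            have "z = a - b" using AB(3)[OF True] kernel_Z_eq[of G\<alpha>, OF p True] z a b by simp
            thus ?thesis unfolding z a b using z b by (simp flip: ennreal_plus)
          qed
          finally show ?thesis .
        next
          case False
          hence "abel_kernel (1 - \<alpha>) (t - r) * Y' r x = 0" "abel_kernel (1 - \<alpha>) (t - r) * Yn r = 0"
            "abel_kernel (1 - \<alpha>) (t - r) * Yp r = 0" for r
            by (auto simp: abel_kernel_def indicator_def Y'_def Yn_def Yp_def)
          thus ?thesis by (simp add: distrib_left del: mult_eq_0_iff)
        qed
      qed
      show "(\<integral>\<^sup>+r\<in>{..<T}. Yp r \<partial>lborel) < \<infinity>" for T
      proof (cases "T > 0")
        case True
        \<comment> \<open>On (0, T) the kernel at T - r is at least 1 / c, so finiteness of the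
          fractional integral at T bounds the integral of \<open>Yp\<close> up to T.\<close>
        define c where "c = Gamma (1 - \<alpha>) * T powr \<alpha>"
        have c: "c > 0" using \<Gamma> True by (simp add: c_def)
        have "(\<integral>\<^sup>+r\<in>{..<T}. Yp r \<partial>lborel) \<le> (\<integral>\<^sup>+r. ennreal c * (abel_kernel (1 - \<alpha>) (T - r) * Yp r) \<partial>lborel)"
        proof (rule nn_integral_mono)
          fix r
          show "Yp r * indicator {..<T} r \<le> ennreal c * (abel_kernel (1 - \<alpha>) (T - r) * Yp r)"
          proof (cases "0 < r \<and> r < T")
            case r: True
            have "T powr (- \<alpha>) \<le> (T - r) powr (- \<alpha>)"
              using r \<alpha> by (intro powr_mono2') auto
            hence "1 \<le> T powr \<alpha> * (T - r) powr (- \<alpha>)"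
              using True by (simp add: powr_minus field_simps)
            hence "1 \<le> c * g_frac (1 - \<alpha>) (T - r)"
              using \<Gamma> by (simp add: c_def g_frac_def)
            hence "1 \<le> ennreal c * abel_kernel (1 - \<alpha>) (T - r)"
              using r c \<Gamma> by (simp add: abel_kernel_def g_frac_def flip: ennreal_mult)
            from mult_right_mono[OF this, of "Yp r"] show ?thesis using r by (simp add: mult.assoc)
          qed (auto simp: Yp_def indicator_def)
        qed
        also have "\<dots> = ennreal c * ?A T" by (rule nn_integral_cmult) measurable
        also have "\<dots> < \<infinity>" using AB(1)[OF True] by (simp add: ennreal_mult_less_top)
        finally show ?thesis .
      next
        case False
        hence "Yp r * indicator {..<T} r = 0" for r by (auto simp: Yp_def indicator_def)
        thus ?thesis by (simp del: mult_eq_0_iff)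
      qed
    qed measurable
    thus "AE t in lborel. t > 0 \<longrightarrow> ennreal (Y t x) \<le> Y' t x"
    proof eventually_elim
      fix t assume eq: "Y' t x + Yn t = Yp t"
      show "t > 0 \<longrightarrow> ennreal (Y t x) \<le> Y' t x"
      proof
        assume "t > 0"
        show "ennreal (Y t x) \<le> Y' t x"
        \<comment> \<open>Where Y > 0 the negative part vanishes and even equality holds; elsewhere
          \<open>ennreal (Y t x)\<close> is 0.\<close>
        proof (cases "Y t x \<le> 0")
          case False
          thus ?thesis using eq \<open>t > 0\<close> by (simp add: Yp_def Yn_def ennreal_neg)
        qed (simp add: ennreal_neg)
      qed
    qed
  qed
  thus ?thesis by (subst lborel_pair.AE_commute) measurable
qed

end

subsection \<open>Monotone iteration\<close>

text \<open>Factor out one power: x powr (q - 1) and y powr (q - 1) are both at most (x + y) powr (q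
  - 1).\<close>

lemma powr_add_le_add_powr:
  fixes x y q :: real
  assumes "0 \<le> x" "0 \<le> y" "1 \<le> q"
  shows "x powr q + y powr q \<le> (x + y) powr q"
proof (cases "x + y = 0")
  case False
  have split: "z powr q = z * z powr (q - 1)" if "z \<ge> 0" for z :: real
    using that by (cases "z = 0") (simp_all add: powr_diff)
  have "x powr q + y powr q = x * x powr (q - 1) + y * y powr (q - 1)"
    using assms by (simp only: split)
  also have "\<dots> \<le> x * (x + y) powr (q - 1) + y * (x + y) powr (q - 1)"
    using assms by (intro add_mono mult_left_mono powr_mono2) auto
  also have "\<dots> = (x + y) powr q"
    using assms split[of "x + y"] by (simp add: distrib_right)
  finally show ?thesis .
qed (use assms in \<open>simp add: add_nonneg_eq_0_iff\<close>)

text \<open>Here a is the free term, k the kernel and m the growth exponent of the nonlinearity.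
  \<open>k_bound\<close> states that convolution with k s maps
  \<open>L\<^sub>q\<^sub>/\<^sub>m\<close> to \<open>L\<^sub>q\<close> with norm at most B s powr
  (\<rho> - 1). \<open>scaling\<close> makes the Duhamel term reproduce the weight t powr (-
  \<theta>), and \<open>small\<close> keeps the constant below M. \<open>\<Phi>_SUP\<close> is asked
  for only at finite suprema, where it follows from continuity.\<close>

locale integral_equation =
  fixes a k :: "real \<Rightarrow> 'a::euclidean_space \<Rightarrow> ennreal" and \<Phi> :: "ennreal \<Rightarrow> ennreal"
    and A B C M \<rho> \<theta> m q :: real
  assumes measurable_a: "(\<lambda>z. a (fst z) (snd z)) \<in> borel_measurable (borel \<Otimes>\<^sub>M borel)"
    and measurable_k: "(\<lambda>z. k (fst z) (snd z)) \<in> borel_measurable (borel \<Otimes>\<^sub>M borel)"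
    and measurable_\<Phi> [measurable]: "\<Phi> \<in> borel_measurable borel"
    and \<Phi>_mono: "\<And>v w. v \<le> w \<Longrightarrow> \<Phi> v \<le> \<Phi> w"
    and \<Phi>_SUP: "\<And>v. incseq v \<Longrightarrow> (SUP n. v n) < \<top> \<Longrightarrow> (SUP n. \<Phi> (v n)) = \<Phi> (SUP n. v n)"
    and \<Phi>_le: "\<And>v. \<Phi> v \<le> ennreal C * ennpowr v m"
    and pos: "A > 0" "B > 0" "C > 0" "M > 0" "\<rho> > 0" "m > 0" "m * \<theta> < 1" "1 \<le> q"
    and a_bound: "\<And>t. t > 0 \<Longrightarrow> (\<integral>\<^sup>+x. ennpowr (a t x) q \<partial>lborel) \<le> ennreal ((A * t powr (- \<theta>)) powr q)"
    and k_bound: "AE s in lborel. s > 0 \<longrightarrow> (\<forall>h\<in>borel_measurable borel. \<forall>H>0.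
      (\<integral>\<^sup>+y. ennpowr (h y) (q / m) \<partial>lborel) \<le> ennreal (H powr (q / m)) \<longrightarrow>
      (\<integral>\<^sup>+x. ennpowr (\<integral>\<^sup>+y. k s (x - y) * h y \<partial>lborel) q \<partial>lborel) \<le> ennreal ((B * s powr (\<rho> - 1) * H) powr q))"
    and scaling: "\<rho> - m * \<theta> = - \<theta>"
    and small: "2 * (A + B * C * M powr m * Beta \<rho> (1 - m * \<theta>)) \<le> M"
begin

lemma measurable_a' [measurable]:
  assumes [measurable]: "f \<in> borel_measurable N" "g \<in> borel_measurable N"
  shows "(\<lambda>z. a (f z) (g z)) \<in> borel_measurable N"
  using measurable_compose[OF _ measurable_a, of "\<lambda>z. (f z, g z)" N] by simp

lemma measurable_k' [measurable]:
  assumes [measurable]: "f \<in> borel_measurable N" "g \<in> borel_measurable N"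
  shows "(\<lambda>z. k (f z) (g z)) \<in> borel_measurable N"
  using measurable_compose[OF _ measurable_k, of "\<lambda>z. (f z, g z)" N] by simp

definition Duhamel :: "(real \<Rightarrow> 'a \<Rightarrow> ennreal) \<Rightarrow> real \<Rightarrow> 'a \<Rightarrow> ennreal" where
  "Duhamel u t x = (\<integral>\<^sup>+s\<in>{0<..<t}. (\<integral>\<^sup>+y. k (t - s) (x - y) * \<Phi> (u s y) \<partial>lborel) \<partial>lborel)"

primrec U :: "nat \<Rightarrow> real \<Rightarrow> 'a \<Rightarrow> ennreal" where
  "U 0 t x = 0"
| "U (Suc n) t x = a t x + Duhamel (U n) t x"

lemma measurable_U_pair: "(\<lambda>z. U n (fst z) (snd z)) \<in> borel_measurable (borel \<Otimes>\<^sub>M borel)"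
proof (induction n)
  case (Suc n)
  have U: "(\<lambda>z. U n (f z) (g z)) \<in> borel_measurable N"
    if [measurable]: "f \<in> borel_measurable N" "g \<in> borel_measurable N" for f g and N :: "'c measure"
    using measurable_compose[OF _ Suc, of "\<lambda>z. (f z, g z)" N] by simp
  \<comment> \<open>The domain of integration depends on t, so its indicator is split into a product
    of two half-line indicators, each jointly measurable.\<close>
  have "(\<lambda>z. Duhamel (U n) (fst z) (snd z)) \<in> borel_measurable (borel \<Otimes>\<^sub>M borel)"
    unfolding Duhamel_def greaterThanLessThan_def greaterThan_def lessThan_def indicator_inter_arith
    supply U [measurable] by measurable
  thus ?case by simp
qed simp

lemma measurable_U [measurable]:
  assumes [measurable]: "f \<in> borel_measurable N" "g \<in> borel_measurable N"
  shows "(\<lambda>z. U n (f z) (g z)) \<in> borel_measurable N"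
  using measurable_compose[OF _ measurable_U_pair, of "\<lambda>z. (f z, g z)" N] by simp

lemma Duhamel_mono:
  assumes "\<And>s y. u s y \<le> v s y"
  shows "Duhamel u t x \<le> Duhamel v t x"
  unfolding Duhamel_def
  by (intro nn_integral_mono mult_right_mono mult_left_mono \<Phi>_mono assms) auto

lemma U_le_Suc: "U n t x \<le> U (Suc n) t x"
proof (induction n arbitrary: t x)
  case (Suc n)
  show ?case using Duhamel_mono[of "U n" "U (Suc n)"] Suc by (simp add: add_left_mono del: U.simps(2) add: U.simps(2)[of n] U.simps(2)[of "Suc n"])
qed simp

lemma incseq_U: "incseq (\<lambda>n. U n t x)"
  by (rule incseq_SucI) (rule U_le_Suc)

text \<open>Minkowski in time, \<open>k_bound\<close> in space, and \<open>\<Phi>_le\<close>, which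
  makes the norm of \<Phi> (u s) in \<open>L\<^sub>q\<^sub>/\<^sub>m\<close> at most C times the
  m-th power of the norm of u s in \<open>L\<^sub>q\<close>. What remains is a Beta integral; it
  converges because \<rho> > 0 and m \<theta> < 1.\<close>

lemma Duhamel_bound:
  assumes u [measurable]: "(\<lambda>z. u (fst z) (snd z)) \<in> borel_measurable (borel \<Otimes>\<^sub>M borel)"
    and bd: "\<And>s. s > 0 \<Longrightarrow> (\<integral>\<^sup>+y. ennpowr (u s y) q \<partial>lborel) \<le> ennreal ((M * s powr (- \<theta>)) powr q)"
    and t: "t > 0"
  shows "(\<integral>\<^sup>+x. ennpowr (Duhamel u t x) q \<partial>lborel)
    \<le> ennreal ((B * C * M powr m * Beta \<rho> (1 - m * \<theta>) * t powr (- \<theta>)) powr q)"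
  unfolding Duhamel_def
proof (rule nn_integral_Minkowski)
  \<comment> \<open>The majorant for Minkowski: the operator norm of the kernel at time t - s times
    the bound for \<Phi> (u s).\<close>
  define n where "n s = B * (t - s) powr (\<rho> - 1) * (C * (M * s powr (- \<theta>)) powr m)" for s
  have u' [measurable]: "(\<lambda>z. u (f z) (g z)) \<in> borel_measurable N"
    if [measurable]: "f \<in> borel_measurable N" "g \<in> borel_measurable N" for f g and N :: "'c measure"
    using measurable_compose[OF _ u, of "\<lambda>z. (f z, g z)" N] by simp
  have Beta: "Beta \<rho> (1 - m * \<theta>) > 0"
    using pos by (simp add: Beta_def Gamma_real_pos)
  show "sigma_finite_measure lborel" "sigma_finite_measure (lborel :: 'a measure)" by unfold_locales
  show "(\<lambda>(s, x). \<integral>\<^sup>+y. k (t - s) (x - y) * \<Phi> (u s y) \<partial>lborel) \<in> borel_measurable (lborel \<Otimes>\<^sub>M lborel)"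
    by measurable
  show "{0<..<t} \<in> sets lborel" by simp
  show "n \<in> borel_measurable lborel" unfolding n_def by measurable
  show "n s > 0" if "s \<in> {0<..<t}" for s using that pos by (simp add: n_def)
  show "B * C * M powr m * Beta \<rho> (1 - m * \<theta>) * t powr (- \<theta>) > 0" using pos Beta t by simp
  show "1 \<le> q" using pos by simp
  have "(\<integral>\<^sup>+s\<in>{0<..<t}. ennreal (n s) \<partial>lborel)
    = (\<integral>\<^sup>+s. ennreal (B * C * M powr m) * (ennreal ((t - s) powr (\<rho> - 1) * s powr (1 - m * \<theta> - 1)) * indicator {0<..<t} s) \<partial>lborel)"
  proof (rule nn_integral_cong)
    fix s
    show "ennreal (n s) * indicator {0<..<t} s
      = ennreal (B * C * M powr m) * (ennreal ((t - s) powr (\<rho> - 1) * s powr (1 - m * \<theta> - 1)) * indicator {0<..<t} s)"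
    proof (cases "s \<in> {0<..<t}")
      case True
      have "n s = B * C * M powr m * ((t - s) powr (\<rho> - 1) * s powr (1 - m * \<theta> - 1))"
        using True pos by (simp add: n_def powr_mult powr_powr mult_ac)
      thus ?thesis using True pos by (simp flip: ennreal_mult)
    qed simp
  qed
  also have "\<dots> = ennreal (B * C * M powr m) * (\<integral>\<^sup>+s\<in>{0<..<t}. ennreal ((t - s) powr (\<rho> - 1) * s powr (1 - m * \<theta> - 1)) \<partial>lborel)"
    by (rule nn_integral_cmult) measurable
  also have "\<dots> = ennreal (B * C * M powr m) * ennreal (Beta \<rho> (1 - m * \<theta>) * t powr (\<rho> + (1 - m * \<theta>) - 1))"
    using pos t by (subst nn_integral_beta) auto
  also have "\<rho> + (1 - m * \<theta>) - 1 = - \<theta>" using scaling by simp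
  also have "ennreal (B * C * M powr m) * ennreal (Beta \<rho> (1 - m * \<theta>) * t powr (- \<theta>))
    = ennreal (B * C * M powr m * Beta \<rho> (1 - m * \<theta>) * t powr (- \<theta>))"
    using pos Beta by (simp add: mult.assoc flip: ennreal_mult)
  finally show "(\<integral>\<^sup>+s\<in>{0<..<t}. ennreal (n s) \<partial>lborel) \<le> ennreal (B * C * M powr m * Beta \<rho> (1 - m * \<theta>) * t powr (- \<theta>))"
    by simp
  \<comment> \<open>\<open>k_bound\<close> holds for almost every time and is used at t - s;
    reflection preserves null sets.\<close>
  show "AE s in lborel. s \<in> {0<..<t} \<longrightarrow>
    (\<integral>\<^sup>+x. ennpowr (\<integral>\<^sup>+y. k (t - s) (x - y) * \<Phi> (u s y) \<partial>lborel) q \<partial>lborel) \<le> ennreal (n s powr q)"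
    using AE_reflect[OF k_bound, of t]
  proof eventually_elim
    fix s
    assume *: "t - s > 0 \<longrightarrow> (\<forall>h\<in>borel_measurable borel. \<forall>H>0.
      (\<integral>\<^sup>+y. ennpowr (h y) (q / m) \<partial>lborel) \<le> ennreal (H powr (q / m)) \<longrightarrow>
      (\<integral>\<^sup>+x. ennpowr (\<integral>\<^sup>+y. k (t - s) (x - y) * h y \<partial>lborel) q \<partial>lborel) \<le> ennreal ((B * (t - s) powr (\<rho> - 1) * H) powr q))"
    show "s \<in> {0<..<t} \<longrightarrow>
      (\<integral>\<^sup>+x. ennpowr (\<integral>\<^sup>+y. k (t - s) (x - y) * \<Phi> (u s y) \<partial>lborel) q \<partial>lborel) \<le> ennreal (n s powr q)"
    proof
      assume s: "s \<in> {0<..<t}"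
      have "(\<integral>\<^sup>+y. ennpowr (\<Phi> (u s y)) (q / m) \<partial>lborel) \<le> (\<integral>\<^sup>+y. ennreal (C powr (q / m)) * ennpowr (u s y) q \<partial>lborel)"
      proof (rule nn_integral_mono)
        fix y
        have "ennpowr (\<Phi> (u s y)) (q / m) \<le> ennpowr (ennreal C * ennpowr (u s y) m) (q / m)"
          using pos by (intro ennpowr_mono \<Phi>_le) auto
        thus "ennpowr (\<Phi> (u s y)) (q / m) \<le> ennreal (C powr (q / m)) * ennpowr (u s y) q"
          using pos by (simp add: ennpowr_mult ennpowr_ennpowr)
      qed
      also have "\<dots> = ennreal (C powr (q / m)) * (\<integral>\<^sup>+y. ennpowr (u s y) q \<partial>lborel)"
        by (rule nn_integral_cmult) measurable
      also have "\<dots> \<le> ennreal (C powr (q / m)) * ennreal ((M * s powr (- \<theta>)) powr q)"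
        using s by (intro mult_left_mono bd) auto
      also have "\<dots> = ennreal ((C * (M * s powr (- \<theta>)) powr m) powr (q / m))"
        using pos s by (simp add: powr_mult powr_powr flip: ennreal_mult)
      finally have "(\<integral>\<^sup>+y. ennpowr (\<Phi> (u s y)) (q / m) \<partial>lborel) \<le> ennreal ((C * (M * s powr (- \<theta>)) powr m) powr (q / m))" .
      moreover have "C * (M * s powr (- \<theta>)) powr m > 0" using pos s by simp
      moreover have "(\<lambda>y. \<Phi> (u s y)) \<in> borel_measurable borel" by measurable
      ultimately show "(\<integral>\<^sup>+x. ennpowr (\<integral>\<^sup>+y. k (t - s) (x - y) * \<Phi> (u s y) \<partial>lborel) q \<partial>lborel) \<le> ennreal (n s powr q)"
        using * s unfolding n_def by auto
    qed
  qed
qed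

lemma U_bound:
  assumes "t > 0"
  shows "(\<integral>\<^sup>+x. ennpowr (U n t x) q \<partial>lborel) \<le> ennreal ((M * t powr (- \<theta>)) powr q)"
  using assms
proof (induction n arbitrary: t)
  case (Suc n)
  define D where "D = B * C * M powr m * Beta \<rho> (1 - m * \<theta>)"
  have D: "D > 0" using pos by (simp add: D_def Beta_def Gamma_real_pos)
  have m1 [measurable]: "(\<lambda>x. Duhamel (U n) t x) \<in> borel_measurable borel"
    unfolding Duhamel_def by measurable
  have "(\<integral>\<^sup>+x. ennpowr (U (Suc n) t x) q \<partial>lborel)
    \<le> (\<integral>\<^sup>+x. ennreal (2 powr q) * (ennpowr (a t x) q + ennpowr (Duhamel (U n) t x) q) \<partial>lborel)"
    unfolding U.simps using pos by (intro nn_integral_mono ennpowr_add_le) auto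
  also have "\<dots> = ennreal (2 powr q) * ((\<integral>\<^sup>+x. ennpowr (a t x) q \<partial>lborel) + (\<integral>\<^sup>+x. ennpowr (Duhamel (U n) t x) q \<partial>lborel))"
    by (subst nn_integral_cmult, measurable) (subst nn_integral_add, auto)
  also have "\<dots> \<le> ennreal (2 powr q) * (ennreal ((A * t powr (- \<theta>)) powr q) + ennreal ((D * t powr (- \<theta>)) powr q))"
    unfolding D_def using Suc.prems
    by (intro mult_left_mono add_mono a_bound Duhamel_bound measurable_U_pair Suc.IH) auto
  also have "\<dots> = ennreal (2 powr q * ((A * t powr (- \<theta>)) powr q + (D * t powr (- \<theta>)) powr q))"
    by (simp flip: ennreal_plus ennreal_mult)
  also have "\<dots> \<le> ennreal ((M * t powr (- \<theta>)) powr q)"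
  proof (rule ennreal_leI)
    \<comment> \<open>Superadditivity joins both bounds under one power, where \<open>small\<close>
      applies; the 2 in \<open>small\<close> absorbs the factor 2 powr q of
      \<open>ennpowr_add_le\<close>.\<close>
    have "2 powr q * ((A * t powr (- \<theta>)) powr q + (D * t powr (- \<theta>)) powr q)
      \<le> 2 powr q * (A * t powr (- \<theta>) + D * t powr (- \<theta>)) powr q"
      using pos D by (intro mult_left_mono powr_add_le_add_powr) auto
    also have "\<dots> = (2 * (A + D) * t powr (- \<theta>)) powr q"
      using pos D by (simp add: powr_mult[symmetric] distrib_right distrib_left mult.assoc)
    also have "\<dots> \<le> (M * t powr (- \<theta>)) powr q"
      using pos D small by (intro powr_mono2 mult_right_mono) (auto simp: D_def)
    finally show "2 powr q * ((A * t powr (- \<theta>)) powr q + (D * t powr (- \<theta>)) powr q) \<le> (M * t powr (- \<theta>)) powr q" .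
  qed
  finally show ?case .
qed simp

definition solution :: "real \<Rightarrow> 'a \<Rightarrow> ennreal" where
  "solution t x = (SUP n. U n t x)"

lemma measurable_solution [measurable]:
  assumes [measurable]: "f \<in> borel_measurable N" "g \<in> borel_measurable N"
  shows "(\<lambda>z. solution (f z) (g z)) \<in> borel_measurable N"
  unfolding solution_def by measurable

lemma solution_bound:
  assumes "t > 0"
  shows "(\<integral>\<^sup>+x. ennpowr (solution t x) q \<partial>lborel) \<le> ennreal ((M * t powr (- \<theta>)) powr q)"
proof -
  have "(\<integral>\<^sup>+x. ennpowr (solution t x) q \<partial>lborel) = (\<integral>\<^sup>+x. (SUP n. ennpowr (U n t x) q) \<partial>lborel)"
    using pos by (simp add: solution_def ennpowr_SUP)
  also have "\<dots> = (SUP n. \<integral>\<^sup>+x. ennpowr (U n t x) q \<partial>lborel)"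
    using pos incseq_U unfolding incseq_def
    by (intro nn_integral_monotone_convergence_SUP) (auto simp: incseq_def le_fun_def intro!: ennpowr_mono)
  also have "\<dots> \<le> ennreal ((M * t powr (- \<theta>)) powr q)"
    using assms by (intro SUP_least U_bound)
  finally show ?thesis .
qed

lemma solution_finite:
  assumes "t > 0"
  shows "AE x in lborel. solution t x < \<top>"
proof -
  have "(\<integral>\<^sup>+x. ennpowr (solution t x) q \<partial>lborel) \<noteq> \<infinity>"
    using solution_bound[OF assms] by (auto simp: top_unique)
  from nn_integral_noteq_infinite[OF _ this] show ?thesis
    by (auto simp: less_top elim!: eventually_mono)
qed

text \<open>An identity in [0, \<infinity>] at every point. Monotone convergence is applied in y and
  in s; \<open>\<Phi>_SUP\<close> needs finite suprema, which \<open>solution_finite\<close>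
  provides for almost every y at each s > 0.\<close>

lemma solution_eq: "solution t x = a t x + Duhamel solution t x"
proof -
  have "solution t x = (SUP n. U (Suc n) t x)"
    unfolding solution_def
  proof (rule antisym)
    show "(SUP n. U n t x) \<le> (SUP n. U (Suc n) t x)"
      by (intro SUP_mono) (use U_le_Suc in blast)
    show "(SUP n. U (Suc n) t x) \<le> (SUP n. U n t x)"
      by (intro SUP_mono) blast
  qed
  also have "\<dots> = a t x + (SUP n. Duhamel (U n) t x)"
    by (simp add: ennreal_SUP_add_right)
  also have "(SUP n. Duhamel (U n) t x) = Duhamel solution t x"
  proof -
    let ?I = "\<lambda>n s y. k (t - s) (x - y) * \<Phi> (U n s y)"
    have inc: "incseq (\<lambda>n. ?I n s y)" for s y
      using incseq_U[of s y] by (auto simp: incseq_def intro!: mult_left_mono \<Phi>_mono)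
    have "(SUP n. Duhamel (U n) t x) = (\<integral>\<^sup>+s. (SUP n. (\<integral>\<^sup>+y. ?I n s y \<partial>lborel) * indicator {0<..<t} s) \<partial>lborel)"
      unfolding Duhamel_def using inc
      by (intro nn_integral_monotone_convergence_SUP[symmetric])
        (auto simp: incseq_def le_fun_def intro!: mult_right_mono nn_integral_mono)
    also have "\<dots> = (\<integral>\<^sup>+s. (\<integral>\<^sup>+y. (SUP n. ?I n s y) \<partial>lborel) * indicator {0<..<t} s \<partial>lborel)"
    proof (rule nn_integral_cong)
      fix s
      have "(\<integral>\<^sup>+y. (SUP n. ?I n s y) \<partial>lborel) = (SUP n. \<integral>\<^sup>+y. ?I n s y \<partial>lborel)"
        using inc by (intro nn_integral_monotone_convergence_SUP) (auto simp: incseq_def le_fun_def)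
      thus "(SUP n. (\<integral>\<^sup>+y. ?I n s y \<partial>lborel) * indicator {0<..<t} s) = (\<integral>\<^sup>+y. (SUP n. ?I n s y) \<partial>lborel) * indicator {0<..<t} s"
        by (simp add: SUP_mult_right_ennreal)
    qed
    also have "\<dots> = Duhamel solution t x"
      unfolding Duhamel_def
    proof (rule nn_integral_cong)
      fix s
      show "(\<integral>\<^sup>+y. (SUP n. ?I n s y) \<partial>lborel) * indicator {0<..<t} s
        = (\<integral>\<^sup>+y. k (t - s) (x - y) * \<Phi> (solution s y) \<partial>lborel) * indicator {0<..<t} s"
      proof (cases "s \<in> {0<..<t}")
        case True
        have "(\<integral>\<^sup>+y. (SUP n. ?I n s y) \<partial>lborel) = (\<integral>\<^sup>+y. k (t - s) (x - y) * \<Phi> (solution s y) \<partial>lborel)"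
        proof (rule nn_integral_cong_AE)
          have "AE y in lborel. solution s y < \<top>" using True by (intro solution_finite) simp
          thus "AE y in lborel. (SUP n. ?I n s y) = k (t - s) (x - y) * \<Phi> (solution s y)"
          proof eventually_elim
            fix y assume "solution s y < \<top>"
            thus "(SUP n. ?I n s y) = k (t - s) (x - y) * \<Phi> (solution s y)"
              using \<Phi>_SUP[OF incseq_U, of s y] by (simp add: solution_def SUP_mult_left_ennreal[symmetric])
          qed
        qed
        thus ?thesis by simp
      qed simp
    qed
    finally show ?thesis .
  qed
  finally show ?thesis .
qed

end

subsection \<open>Kernel estimates\<close>

context kernels
begin

text \<open>Minkowski in \<tau>, and Young in x with the bound of \<open>G_le\<close> at time (t /
  \<tau>) powr \<alpha>. Raised to the power 1 / r - 1 / q, that bound is a multiple of t powr (-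
  \<alpha> \<kappa>) \<tau> powr (\<alpha> \<kappa>), so only the moment of p of order \<alpha>
  \<kappa> - a has to be finite.\<close>

lemma subordinated_convolution_bound:
  assumes r: "1 \<le> r" "r \<le> q" and \<kappa>: "\<kappa> = real CARD('n) / \<beta> * (1 / r - 1 / q)" "\<alpha> * \<kappa> - a < \<alpha>"
  shows "\<exists>C>0. \<forall>t>0. \<forall>h\<in>borel_measurable borel. \<forall>H>0.
    (\<integral>\<^sup>+y. ennpowr (h y) r \<partial>lborel) \<le> ennreal (H powr r) \<longrightarrow>
    (\<integral>\<^sup>+x. ennpowr (\<integral>\<^sup>+y. subordinated a t (x - y) * h y \<partial>lborel) q \<partial>lborel)
      \<le> ennreal ((C * t powr (- \<alpha> * \<kappa>) * H) powr q)"
proof -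
  obtain C1 where C1: "C1 > 0" "\<forall>t>0. \<forall>x. G t x \<le> C1 * t powr (- real CARD('n) / \<beta>)"
    using G_le by (elim exE conjE)
  obtain m where m: "(\<integral>\<^sup>+\<tau>\<in>{0<..}. ennreal (\<tau> powr (\<alpha> * \<kappa> - a)) * ennreal (p \<tau>) \<partial>lborel) = ennreal m" "m \<ge> 0"
    using moment_finite[OF \<kappa>(2)]
    by (cases "\<integral>\<^sup>+\<tau>\<in>{0<..}. ennreal (\<tau> powr (\<alpha> * \<kappa> - a)) * ennreal (p \<tau>) \<partial>lborel") auto
  define e where "e = 1 / r - 1 / q"
  \<comment> \<open>With m + 1 in place of m the constant is positive without further
    argument.\<close>
  define C where "C = C1 powr e * (m + 1)"
  have C: "C > 0" using C1(1) m by (simp add: C_def)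
  have bound: "(\<integral>\<^sup>+x. ennpowr (\<integral>\<^sup>+y. subordinated a t (x - y) * h y \<partial>lborel) q \<partial>lborel)
      \<le> ennreal ((C * t powr (- \<alpha> * \<kappa>) * H) powr q)"
    if t: "t > 0" and h [measurable]: "h \<in> borel_measurable borel" and H: "H > 0"
      and hH: "(\<integral>\<^sup>+y. ennpowr (h y) r \<partial>lborel) \<le> ennreal (H powr r)" for t h H
  proof -
    \<comment> \<open>Minkowski requires a strictly positive majorant, hence the restriction to
      where p is positive; elsewhere the integrand vanishes.\<close>
    define A where "A = {\<tau>. 0 < \<tau> \<and> 0 < p \<tau>}"
    have A [measurable]: "A \<in> sets borel" unfolding A_def by measurable
    define B where "B \<tau> = C1 * ((t / \<tau>) powr \<alpha>) powr (- real CARD('n) / \<beta>)" for \<tau>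
    define n where "n \<tau> = \<tau> powr (- a) * p \<tau> * (B \<tau> powr e * H)" for \<tau>
    define F where "F \<tau> x = ennreal (\<tau> powr (- a)) * P \<tau> * (\<integral>\<^sup>+y. ennreal (G ((t / \<tau>) powr \<alpha>) (x - y)) * h y \<partial>lborel)" for \<tau> x
    have PA: "P \<tau> = ennreal (p \<tau>) * indicator A \<tau>" for \<tau>
      using p_nonneg[of \<tau>] by (auto simp: A_def indicator_def ennreal_eq_0_iff)
    have B: "B \<tau> > 0" "B \<tau> powr e = C1 powr e * t powr (- \<alpha> * \<kappa>) * \<tau> powr (\<alpha> * \<kappa>)" if "\<tau> > 0" for \<tau>
    proof -
      show "B \<tau> > 0" using that t C1(1) by (simp add: B_def)
      have "(((t / \<tau>) powr \<alpha>) powr (- real CARD('n) / \<beta>)) powr e = (t / \<tau>) powr (- \<alpha> * \<kappa>)"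
        by (simp add: powr_powr \<kappa>(1) e_def[symmetric] mult.assoc)
      also have "\<dots> = t powr (- \<alpha> * \<kappa>) * \<tau> powr (\<alpha> * \<kappa>)"
        using that t by (simp add: powr_divide powr_minus_divide)
      finally show "B \<tau> powr e = C1 powr e * t powr (- \<alpha> * \<kappa>) * \<tau> powr (\<alpha> * \<kappa>)"
        using C1(1) unfolding B_def by (subst powr_mult) (simp_all add: mult.assoc)
    qed
    have "(\<integral>\<^sup>+y. subordinated a t (x - y) * h y \<partial>lborel) = (\<integral>\<^sup>+\<tau>\<in>A. F \<tau> x \<partial>lborel)" for x
    proof -
      have "(\<integral>\<^sup>+y. subordinated a t (x - y) * h y \<partial>lborel)
        = (\<integral>\<^sup>+y. (\<integral>\<^sup>+\<tau>. ennreal (G ((t / \<tau>) powr \<alpha>) (x - y)) * (ennreal (\<tau> powr (- a)) * P \<tau>) * h y \<partial>lborel) \<partial>lborel)"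
        unfolding subordinated_def by (intro nn_integral_cong nn_integral_multc[symmetric]) measurable
      also have "\<dots> = (\<integral>\<^sup>+\<tau>. (\<integral>\<^sup>+y. ennreal (G ((t / \<tau>) powr \<alpha>) (x - y)) * (ennreal (\<tau> powr (- a)) * P \<tau>) * h y \<partial>lborel) \<partial>lborel)"
        by (rule lborel_pair.Fubini') measurable
      also have "\<dots> = (\<integral>\<^sup>+\<tau>\<in>A. F \<tau> x \<partial>lborel)"
      proof (rule nn_integral_cong)
        fix \<tau>
        have "(\<integral>\<^sup>+y. ennreal (G ((t / \<tau>) powr \<alpha>) (x - y)) * (ennreal (\<tau> powr (- a)) * P \<tau>) * h y \<partial>lborel)
          = (\<integral>\<^sup>+y. ennreal (\<tau> powr (- a)) * P \<tau> * (ennreal (G ((t / \<tau>) powr \<alpha>) (x - y)) * h y) \<partial>lborel)"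
          by (intro nn_integral_cong) (simp only: mult_ac)
        also have "\<dots> = F \<tau> x" unfolding F_def by (rule nn_integral_cmult) measurable
        also have "\<dots> = F \<tau> x * indicator A \<tau>"
          unfolding F_def PA by (simp add: indicator_def)
        finally show "(\<integral>\<^sup>+y. ennreal (G ((t / \<tau>) powr \<alpha>) (x - y)) * (ennreal (\<tau> powr (- a)) * P \<tau>) * h y \<partial>lborel)
          = F \<tau> x * indicator A \<tau>" .
      qed
      finally show ?thesis .
    qed
    moreover have "(\<integral>\<^sup>+x. ennpowr (\<integral>\<^sup>+\<tau>\<in>A. F \<tau> x \<partial>lborel) q \<partial>lborel) \<le> ennreal ((C * t powr (- \<alpha> * \<kappa>) * H) powr q)"
    proof (rule nn_integral_Minkowski)
      show "sigma_finite_measure lborel" "sigma_finite_measure (lborel :: (real^'n) measure)" by unfold_locales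
      show "(\<lambda>(\<tau>, x). F \<tau> x) \<in> borel_measurable (lborel \<Otimes>\<^sub>M lborel)" unfolding F_def by measurable
      show "A \<in> sets lborel" by simp
      show "n \<in> borel_measurable lborel" unfolding n_def B_def by measurable
      show "n \<tau> > 0" if "\<tau> \<in> A" for \<tau>
        unfolding n_def using that B(1)[of \<tau>] H by (intro mult_pos_pos) (auto simp: A_def)
      show "C * t powr (- \<alpha> * \<kappa>) * H > 0" using C t H by simp
      show "1 \<le> q" using r by simp
      let ?c = "C1 powr e * t powr (- \<alpha> * \<kappa>) * H"
      have "(\<integral>\<^sup>+\<tau>\<in>A. ennreal (n \<tau>) \<partial>lborel)
        \<le> (\<integral>\<^sup>+\<tau>. ennreal ?c * (ennreal (\<tau> powr (\<alpha> * \<kappa> - a)) * ennreal (p \<tau>) * indicator {0<..} \<tau>) \<partial>lborel)"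
      proof (rule nn_integral_mono)
        fix \<tau>
        show "ennreal (n \<tau>) * indicator A \<tau> \<le> ennreal ?c * (ennreal (\<tau> powr (\<alpha> * \<kappa> - a)) * ennreal (p \<tau>) * indicator {0<..} \<tau>)"
        proof (cases "\<tau> \<in> A")
          case True
          hence \<tau>: "\<tau> > 0" "p \<tau> > 0" by (auto simp: A_def)
          have e: "\<tau> powr (- a) * \<tau> powr (\<alpha> * \<kappa>) = \<tau> powr (\<alpha> * \<kappa> - a)" by (simp add: algebra_simps flip: powr_add)
          have "n \<tau> = ?c * ((\<tau> powr (- a) * \<tau> powr (\<alpha> * \<kappa>)) * p \<tau>)"
            unfolding n_def B(2)[OF \<tau>(1)] by (simp only: mult_ac)
          hence "n \<tau> = ?c * (\<tau> powr (\<alpha> * \<kappa> - a) * p \<tau>)"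
            unfolding e .
          thus ?thesis using True \<tau> H by (simp add: ennreal_mult)
        qed simp
      qed
      also have "\<dots> = ennreal ?c * ennreal m"
        unfolding m(1)[symmetric] by (rule nn_integral_cmult) measurable
      also have "\<dots> \<le> ennreal (C * t powr (- \<alpha> * \<kappa>) * H)"
      proof -
        have "?c * m \<le> ?c * (m + 1)" using H by (intro mult_left_mono) auto
        also have "\<dots> = C * t powr (- \<alpha> * \<kappa>) * H" by (simp only: C_def mult_ac)
        finally show ?thesis using H m(2) by (simp add: ennreal_leI flip: ennreal_mult)
      qed
      finally show "(\<integral>\<^sup>+\<tau>\<in>A. ennreal (n \<tau>) \<partial>lborel) \<le> ennreal (C * t powr (- \<alpha> * \<kappa>) * H)" .
      show "AE \<tau> in lborel. \<tau> \<in> A \<longrightarrow> (\<integral>\<^sup>+x. ennpowr (F \<tau> x) q \<partial>lborel) \<le> ennreal (n \<tau> powr q)"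
      proof (rule AE_I2, rule impI)
        fix \<tau> assume "\<tau> \<in> A"
        hence \<tau>: "\<tau> > 0" "p \<tau> > 0" by (auto simp: A_def)
        have s: "(t / \<tau>) powr \<alpha> > 0" using t \<tau> by simp
        have "(\<integral>\<^sup>+x. ennpowr (F \<tau> x) q \<partial>lborel)
          = (\<integral>\<^sup>+x. ennreal ((\<tau> powr (- a) * p \<tau>) powr q) * ennpowr (\<integral>\<^sup>+y. ennreal (G ((t / \<tau>) powr \<alpha>) (x - y)) * h y \<partial>lborel) q \<partial>lborel)"
        proof -
          have "ennreal (\<tau> powr (- a)) * P \<tau> = ennreal (\<tau> powr (- a) * p \<tau>)"
            using \<tau> by (simp add: ennreal_mult)
          thus ?thesis using \<tau> by (simp add: F_def ennpowr_mult)
        qed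
        also have "\<dots> = ennreal ((\<tau> powr (- a) * p \<tau>) powr q) * (\<integral>\<^sup>+x. ennpowr (\<integral>\<^sup>+y. ennreal (G ((t / \<tau>) powr \<alpha>) (x - y)) * h y \<partial>lborel) q \<partial>lborel)"
          by (rule nn_integral_cmult) measurable
        also have "\<dots> \<le> ennreal ((\<tau> powr (- a) * p \<tau>) powr q) * ennreal ((B \<tau> powr (1 / r - 1 / q) * H) powr q)"
          using r B(1)[OF \<tau>(1)] H hH C1(2) s nn_integral_G_le_1[OF s]
          by (intro mult_left_mono nn_integral_Young) (auto simp: B_def intro!: ennreal_leI)
        also have "\<dots> = ennreal (n \<tau> powr q)"
          using \<tau> H unfolding n_def e_def by (simp add: powr_mult flip: ennreal_mult)
        finally show "(\<integral>\<^sup>+x. ennpowr (F \<tau> x) q \<partial>lborel) \<le> ennreal (n \<tau> powr q)" .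
      qed
    qed
    ultimately show ?thesis by simp
  qed
  show ?thesis by (intro exI[of _ C] conjI allI ballI impI C bound)
qed

lemma kernel_Z_bound:
  assumes p: "G\<alpha> 1 = p" and r: "1 \<le> r" "r \<le> q" and \<kappa>: "\<kappa> = real CARD('n) / \<beta> * (1 / r - 1 / q)" "\<kappa> < 1"
  shows "\<exists>C>0. \<forall>u0\<in>borel_measurable borel. \<forall>H>0. \<forall>t>0. (\<forall>x. 0 \<le> u0 x) \<longrightarrow>
    (\<integral>\<^sup>+y. ennpowr (ennreal (u0 y)) r \<partial>lborel) \<le> ennreal (H powr r) \<longrightarrow>
    (\<integral>\<^sup>+x. ennpowr (\<integral>\<^sup>+y. ennreal (kernel_Z \<alpha> \<beta> \<nu> G\<alpha> t (x - y) * u0 y) \<partial>lborel) q \<partial>lborel)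
      \<le> ennreal ((C * H * t powr (- (\<alpha> * \<kappa>))) powr q)"
proof -
  have "\<alpha> * \<kappa> - 0 < \<alpha>" using \<kappa>(2) \<alpha> by simp
  from subordinated_convolution_bound[OF r \<kappa>(1) this]
  obtain C where C: "C > 0" "\<forall>t>0. \<forall>h\<in>borel_measurable borel. \<forall>H>0.
    (\<integral>\<^sup>+y. ennpowr (h y) r \<partial>lborel) \<le> ennreal (H powr r) \<longrightarrow>
    (\<integral>\<^sup>+x. ennpowr (\<integral>\<^sup>+y. subordinated 0 t (x - y) * h y \<partial>lborel) q \<partial>lborel)
      \<le> ennreal ((C * t powr (- \<alpha> * \<kappa>) * H) powr q)"
    by (elim exE conjE)
  have bound: "(\<integral>\<^sup>+x. ennpowr (\<integral>\<^sup>+y. ennreal (kernel_Z \<alpha> \<beta> \<nu> G\<alpha> t (x - y) * u0 y) \<partial>lborel) q \<partial>lborel)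
      \<le> ennreal ((C * H * t powr (- (\<alpha> * \<kappa>))) powr q)"
    if [measurable]: "u0 \<in> borel_measurable borel" and H: "H > 0" and t: "t > 0" and u0: "\<forall>x. 0 \<le> u0 x"
      and hH: "(\<integral>\<^sup>+y. ennpowr (ennreal (u0 y)) r \<partial>lborel) \<le> ennreal (H powr r)" for u0 H t
  proof -
    \<comment> \<open>Only an inequality: where \<open>Z'\<close> is infinite,
      \<open>kernel_Z\<close> is 0.\<close>
    have "ennreal (kernel_Z \<alpha> \<beta> \<nu> G\<alpha> t x * w) \<le> Z' t x * ennreal w" if "0 \<le> w" for x w
    proof -
      have "ennreal (kernel_Z \<alpha> \<beta> \<nu> G\<alpha> t x * w) = ennreal (enn2real (Z' t x)) * ennreal w"
        using that by (simp add: kernel_Z_eq[of G\<alpha>, OF p t] ennreal_mult)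
      also have "\<dots> \<le> Z' t x * ennreal w"
        by (intro mult_right_mono) (auto simp: ennreal_enn2real_if)
      finally show ?thesis .
    qed
    hence "(\<integral>\<^sup>+x. ennpowr (\<integral>\<^sup>+y. ennreal (kernel_Z \<alpha> \<beta> \<nu> G\<alpha> t (x - y) * u0 y) \<partial>lborel) q \<partial>lborel)
      \<le> (\<integral>\<^sup>+x. ennpowr (\<integral>\<^sup>+y. subordinated 0 t (x - y) * ennreal (u0 y) \<partial>lborel) q \<partial>lborel)"
      using r u0 unfolding Z'_def by (intro nn_integral_mono ennpowr_mono) auto
    also have "\<dots> \<le> ennreal ((C * t powr (- \<alpha> * \<kappa>) * H) powr q)"
      using C(2) t H hH by auto
    also have "C * t powr (- \<alpha> * \<kappa>) * H = C * H * t powr (- (\<alpha> * \<kappa>))" by simp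
    finally show ?thesis .
  qed
  show ?thesis by (intro exI[of _ C] conjI C(1) ballI allI impI, rule bound)
qed

text \<open>The factor s powr (\<alpha> - 1) of \<open>Y'\<close> combines with the loss s powr (-
  \<alpha> \<kappa>). The exceptional null set of times precedes the quantifiers over h and H, so
  that a function depending on the time may later be inserted for h.\<close>

lemma kernel_Y_bound:
  assumes p: "G\<alpha> 1 = p" and Y: "is_kernel_Y \<alpha> (kernel_Z \<alpha> \<beta> \<nu> G\<alpha>) Y"
    and r: "1 \<le> r" "r \<le> q" and \<kappa>: "\<kappa> = real CARD('n) / \<beta> * (1 / r - 1 / q)" "\<kappa> < 1"
  shows "\<exists>C>0. AE s in lborel. s > 0 \<longrightarrow> (\<forall>h\<in>borel_measurable borel. \<forall>H>0.
    (\<integral>\<^sup>+y. ennpowr (h y) r \<partial>lborel) \<le> ennreal (H powr r) \<longrightarrow>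
    (\<integral>\<^sup>+x. ennpowr (\<integral>\<^sup>+y. ennreal (Y s (x - y)) * h y \<partial>lborel) q \<partial>lborel)
      \<le> ennreal ((C * s powr (\<alpha> * (1 - \<kappa>) - 1) * H) powr q))"
proof -
  have "\<alpha> * \<kappa> - \<alpha> < \<alpha>" using \<kappa>(2) \<alpha> by (simp add: mult_less_cancel_left_pos algebra_simps)
  from subordinated_convolution_bound[OF r \<kappa>(1) this]
  obtain C where C: "C > 0" "\<forall>t>0. \<forall>h\<in>borel_measurable borel. \<forall>H>0.
    (\<integral>\<^sup>+y. ennpowr (h y) r \<partial>lborel) \<le> ennreal (H powr r) \<longrightarrow>
    (\<integral>\<^sup>+x. ennpowr (\<integral>\<^sup>+y. subordinated \<alpha> t (x - y) * h y \<partial>lborel) q \<partial>lborel)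
      \<le> ennreal ((C * t powr (- \<alpha> * \<kappa>) * H) powr q)"
    by (elim exE conjE)
  have "AE s in lborel. s > 0 \<longrightarrow> (\<forall>h\<in>borel_measurable borel. \<forall>H>0.
    (\<integral>\<^sup>+y. ennpowr (h y) r \<partial>lborel) \<le> ennreal (H powr r) \<longrightarrow>
    (\<integral>\<^sup>+x. ennpowr (\<integral>\<^sup>+y. ennreal (Y s (x - y)) * h y \<partial>lborel) q \<partial>lborel)
      \<le> ennreal ((\<alpha> * C * s powr (\<alpha> * (1 - \<kappa>) - 1) * H) powr q))"
    using kernel_Y_le_Y'[of G\<alpha>, OF p Y]
  proof eventually_elim
    fix s :: real
    assume AE: "AE x in lborel. s > 0 \<longrightarrow> ennreal (Y s x) \<le> Y' s x"
    show "s > 0 \<longrightarrow> (\<forall>h\<in>borel_measurable borel. \<forall>H>0.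
      (\<integral>\<^sup>+y. ennpowr (h y) r \<partial>lborel) \<le> ennreal (H powr r) \<longrightarrow>
      (\<integral>\<^sup>+x. ennpowr (\<integral>\<^sup>+y. ennreal (Y s (x - y)) * h y \<partial>lborel) q \<partial>lborel)
        \<le> ennreal ((\<alpha> * C * s powr (\<alpha> * (1 - \<kappa>) - 1) * H) powr q))"
    proof (intro impI ballI allI)
      fix h :: "real^'n \<Rightarrow> ennreal" and H :: real
      assume s: "s > 0" and [measurable]: "h \<in> borel_measurable borel" and H: "H > 0"
        and hH: "(\<integral>\<^sup>+y. ennpowr (h y) r \<partial>lborel) \<le> ennreal (H powr r)"
      let ?c = "\<alpha> * s powr (\<alpha> - 1)"
      have le: "(\<integral>\<^sup>+y. ennreal (Y s (x - y)) * h y \<partial>lborel) \<le> ennreal ?c * (\<integral>\<^sup>+y. subordinated \<alpha> s (x - y) * h y \<partial>lborel)" for x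
      proof -
        have "AE y in lborel. ennreal (Y s (x - y)) \<le> Y' s (x - y)"
          using AE_reflect[OF AE, of x] s by simp
        hence "(\<integral>\<^sup>+y. ennreal (Y s (x - y)) * h y \<partial>lborel) \<le> (\<integral>\<^sup>+y. Y' s (x - y) * h y \<partial>lborel)"
          by (intro nn_integral_mono_AE) (auto elim!: eventually_mono intro: mult_right_mono)
        also have "\<dots> = (\<integral>\<^sup>+y. ennreal ?c * (subordinated \<alpha> s (x - y) * h y) \<partial>lborel)"
          using s by (intro nn_integral_cong) (simp add: Y'_def mult.assoc)
        also have "\<dots> = ennreal ?c * (\<integral>\<^sup>+y. subordinated \<alpha> s (x - y) * h y \<partial>lborel)"
          by (rule nn_integral_cmult) measurable
        finally show ?thesis .
      qed
      have "(\<integral>\<^sup>+x. ennpowr (\<integral>\<^sup>+y. ennreal (Y s (x - y)) * h y \<partial>lborel) q \<partial>lborel)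
        \<le> (\<integral>\<^sup>+x. ennreal (?c powr q) * ennpowr (\<integral>\<^sup>+y. subordinated \<alpha> s (x - y) * h y \<partial>lborel) q \<partial>lborel)"
      proof (rule nn_integral_mono)
        fix x
        have "ennpowr (\<integral>\<^sup>+y. ennreal (Y s (x - y)) * h y \<partial>lborel) q
          \<le> ennpowr (ennreal ?c * (\<integral>\<^sup>+y. subordinated \<alpha> s (x - y) * h y \<partial>lborel)) q"
          using r by (intro ennpowr_mono le) auto
        thus "ennpowr (\<integral>\<^sup>+y. ennreal (Y s (x - y)) * h y \<partial>lborel) q
          \<le> ennreal (?c powr q) * ennpowr (\<integral>\<^sup>+y. subordinated \<alpha> s (x - y) * h y \<partial>lborel) q"
          using \<alpha> by (simp add: ennpowr_mult)
      qed
      also have "\<dots> = ennreal (?c powr q) * (\<integral>\<^sup>+x. ennpowr (\<integral>\<^sup>+y. subordinated \<alpha> s (x - y) * h y \<partial>lborel) q \<partial>lborel)"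
        by (rule nn_integral_cmult) measurable
      also have "\<dots> \<le> ennreal (?c powr q) * ennreal ((C * s powr (- \<alpha> * \<kappa>) * H) powr q)"
        using C(2) s H hH by (intro mult_left_mono) auto
      also have "\<dots> = ennreal ((?c * (C * s powr (- \<alpha> * \<kappa>) * H)) powr q)"
        using C(1) H \<alpha> by (subst (2) powr_mult) (auto simp flip: ennreal_mult)
      also have "?c * (C * s powr (- \<alpha> * \<kappa>) * H) = \<alpha> * C * (s powr (\<alpha> - 1) * s powr (- \<alpha> * \<kappa>)) * H"
        by (simp only: mult_ac)
      also have "s powr (\<alpha> - 1) * s powr (- \<alpha> * \<kappa>) = s powr (\<alpha> * (1 - \<kappa>) - 1)"
        by (simp add: algebra_simps flip: powr_add)
      finally show "(\<integral>\<^sup>+x. ennpowr (\<integral>\<^sup>+y. ennreal (Y s (x - y)) * h y \<partial>lborel) q \<partial>lborel)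
        \<le> ennreal ((\<alpha> * C * s powr (\<alpha> * (1 - \<kappa>) - 1) * H) powr q)" .
    qed
  qed
  moreover have "\<alpha> * C > 0" using \<alpha> C(1) by simp
  ultimately show ?thesis by (intro exI[of _ "\<alpha> * C"] conjI)
qed

end

subsection \<open>The main theorem\<close>

lemma osgood_phi_growth:
  assumes k: "k > 1" and \<phi>0: "\<phi>0 > 2 powr (1 / (k - 1))"
  shows "\<phi>0 * 2 ^ i \<le> osgood_phi k \<phi>0 i"
proof (induction i)
  case (Suc i)
  let ?\<phi> = "osgood_phi k \<phi>0 i"
  have pos: "\<phi>0 > 0" using \<phi>0 by (rule less_trans[rotated]) simp
  have "\<phi>0 * 1 \<le> \<phi>0 * 2 ^ i" using pos by (intro mult_left_mono) auto
  hence \<phi>: "\<phi>0 \<le> ?\<phi>" using Suc by simp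
  \<comment> \<open>The role of the threshold for \<phi>0: every term has (k - 1)-th power at least
    2, so each step at least doubles.\<close>
  have "2 = (2 powr (1 / (k - 1))) powr (k - 1)" using k by (simp add: powr_powr)
  also have "\<dots> \<le> ?\<phi> powr (k - 1)" using k \<phi> \<phi>0 by (intro powr_mono2) auto
  finally have "?\<phi> * 2 \<le> ?\<phi> * ?\<phi> powr (k - 1)" using pos \<phi> by (intro mult_left_mono) auto
  also have "\<dots> = ?\<phi> powr k" using pos \<phi> by (simp add: powr_diff)
  finally show ?case using Suc by simp
qed simp

text \<open>On a plateau the value is below \<phi> i = \<phi> (i - 1) powr k \<le> s powr k. On a
  ramp it is below \<phi> (i + 1) = \<phi> i powr k, while s > \<phi> i / 2; this is the source of
  the factor 2 powr k.\<close>

lemma osgood_fun_le: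
  assumes k: "k > 1" and \<phi>0: "\<phi>0 > 2 powr (1 / (k - 1))" and s: "s \<ge> 0"
  shows "osgood_fun k \<phi>0 s \<le> 2 powr k * s powr k"
proof -
  define \<phi> where "\<phi> = osgood_phi k \<phi>0"
  have pos: "\<phi>0 > 0" using \<phi>0 by (rule less_trans[rotated]) simp
  have \<phi>_pos: "\<phi> i > 0" for i
    unfolding \<phi>_def using pos by (intro less_le_trans[OF _ osgood_phi_growth[OF k \<phi>0]]) simp
  have step: "\<phi> (Suc i) = \<phi> i powr k" for i by (simp add: \<phi>_def)
  \<comment> \<open>Some term lies above s, so the \<open>LEAST\<close> in the definition is
    attained.\<close>
  obtain N :: nat where "s / \<phi>0 < 2 ^ N" using real_arch_pow[of 2 "s / \<phi>0"] by auto
  hence "s \<le> \<phi> N"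
    using osgood_phi_growth[OF k \<phi>0, of N] pos unfolding \<phi>_def by (simp add: field_simps)
  define i where "i = (LEAST i. s \<le> \<phi> i)"
  have i: "s \<le> \<phi> i" unfolding i_def using \<open>s \<le> \<phi> N\<close> by (rule LeastI)
  have sk: "s powr k \<le> 2 powr k * s powr k"
    using k by (simp add: mult_le_cancel_right1 ge_one_powr_ge_zero)
  have eq: "osgood_fun k \<phi>0 s = (if i = 0 then (1 - \<phi>0 powr (1 - k)) * s powr k
      else if s \<le> \<phi> i / 2 then \<phi> i - \<phi> (i - 1)
      else (\<phi> i - \<phi> (i - 1)) + ((\<phi> (i + 1) - \<phi> i) - (\<phi> i - \<phi> (i - 1))) * ((s - \<phi> i / 2) / (\<phi> i / 2)))"
    unfolding osgood_fun_def Let_def \<phi>_def i_def ..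
  show ?thesis
  proof (cases "i = 0")
    case True
    have "(1 - \<phi>0 powr (1 - k)) * s powr k \<le> 1 * s powr k" by (intro mult_right_mono) auto
    thus ?thesis using True sk by (simp add: eq)
  next
    case False
    then obtain j where j: "i = Suc j" by (cases i) auto
    have "\<not> s \<le> \<phi> j" using not_less_Least[of j "\<lambda>i. s \<le> \<phi> i"] j unfolding i_def by simp
    hence "\<phi> j < s" by simp
    show ?thesis
    proof (cases "s \<le> \<phi> i / 2")
      case True
      have "\<phi> i = \<phi> j powr k" using j step by simp
      also have "\<dots> \<le> s powr k" using \<open>\<phi> j < s\<close> \<phi>_pos[of j] k by (intro powr_mono2) auto
      finally have "\<phi> i - \<phi> j \<le> s powr k" using \<phi>_pos[of j] by linarith
      thus ?thesis using True j sk by (simp add: eq)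
    next
      case half: False
      define l where "l = (s - \<phi> i / 2) / (\<phi> i / 2)"
      have l: "0 \<le> l" "l \<le> 1" using half i \<phi>_pos[of i] by (auto simp: l_def field_simps)
      have next_le: "\<phi> i \<le> \<phi> (Suc i)"
      proof -
        have "1 \<le> \<phi> i"
        proof -
          have "1 = 1 * (1::real)" by simp
          also have "1 \<le> 2 powr (1 / (k - 1))" using k by (intro ge_one_powr_ge_zero) auto
          hence "1 * (1::real) \<le> \<phi>0 * 2 ^ i" using \<phi>0 by (intro mult_mono) auto
          also have "\<dots> \<le> \<phi> i" using osgood_phi_growth[OF k \<phi>0] by (simp add: \<phi>_def)
          finally show ?thesis .
        qed
        hence "\<phi> i powr 1 \<le> \<phi> i powr k" using k by (intro powr_mono) auto
        thus ?thesis using \<phi>_pos[of i] by (simp add: step)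
      qed
      have "osgood_fun k \<phi>0 s = (\<phi> i - \<phi> (i - 1)) + ((\<phi> (i + 1) - \<phi> i) - (\<phi> i - \<phi> (i - 1))) * l"
        using False half unfolding eq l_def by simp
      \<comment> \<open>As a convex combination: both end values may now be replaced by the common
        bound \<open>\<phi> (Suc i)\<close>.\<close>
      also have "\<dots> = (1 - l) * (\<phi> i - \<phi> j) + l * (\<phi> (Suc i) - \<phi> i)"
        using j by (simp add: algebra_simps)
      also have "\<dots> \<le> (1 - l) * \<phi> (Suc i) + l * \<phi> (Suc i)"
        using l next_le \<phi>_pos[of j] \<phi>_pos[of i] by (intro add_mono mult_left_mono) linarith+
      also have "\<dots> = \<phi> i powr k" by (simp add: algebra_simps step)
      also have "\<dots> \<le> (2 * s) powr k" using half \<phi>_pos[of i] k by (intro powr_mono2) auto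
      also have "\<dots> = 2 powr k * s powr k" using s by (simp add: powr_mult)
      finally show ?thesis .
    qed
  qed
qed

lemma osgood_type_le:
  assumes "k > 1" "osgood_type k f"
  shows "\<exists>C>0. \<forall>s\<ge>0. f s \<le> C * s powr k"
proof -
  obtain \<phi>0 c C where \<phi>0: "\<phi>0 > 2 powr (1 / (k - 1))" and C: "C > 0"
    and f: "\<forall>s\<ge>0. c * osgood_fun k \<phi>0 s \<le> f s \<and> f s \<le> C * osgood_fun k \<phi>0 s"
    using assms(2) unfolding osgood_type_def by blast
  have "f s \<le> (C * 2 powr k) * s powr k" if "s \<ge> 0" for s
  proof -
    have "f s \<le> C * osgood_fun k \<phi>0 s" using f that by blast
    also have "\<dots> \<le> C * (2 powr k * s powr k)"
      using C osgood_fun_le[OF assms(1) \<phi>0 that] by (intro mult_left_mono) auto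
    finally show ?thesis by (simp add: mult.assoc)
  qed
  moreover have "C * 2 powr k > 0" using C by simp
  ultimately show ?thesis by blast
qed

section \<open>The nonlinearity on [0, \<infinity>]\<close>

lemma
  assumes f: "continuous_on {0..} f" "mono_on {0..} f"
  shows measurable_ext_fun: "ext_fun f \<in> borel_measurable borel"
    and ext_fun_mono: "v \<le> w \<Longrightarrow> ext_fun f v \<le> ext_fun f w"
    and ext_fun_SUP: "incseq u \<Longrightarrow> (SUP n. u n) < \<top> \<Longrightarrow> (SUP n. ext_fun f (u n)) = ext_fun f (SUP n. u n)"
proof -
  \<comment> \<open>Constant continuation to negative arguments turns continuity on the closed half
    line into continuity, hence Borel measurability, on the whole line.\<close>
  define g where "g x = f (max 0 x)" for x
  have g: "continuous_on UNIV g"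
    unfolding g_def by (rule continuous_on_compose2[OF f(1)]) (auto intro!: continuous_intros)
  hence [measurable]: "g \<in> borel_measurable borel" by (rule borel_measurable_continuous_onI)
  have ext: "ext_fun f v = (if v = \<infinity> then \<infinity> else ennreal (g (enn2real v)))" for v
    by (simp add: ext_fun_def g_def max_absorb2)
  show "ext_fun f \<in> borel_measurable borel"
    unfolding ext by measurable
  show mono: "ext_fun f v \<le> ext_fun f w" if "v \<le> w" for v w
    using that mono_onD[OF f(2)]
    by (cases v; cases w) (auto simp: ext_fun_def top_unique intro!: ennreal_leI)
  show "(SUP n. ext_fun f (u n)) = ext_fun f (SUP n. u n)" if u: "incseq u" and fin: "(SUP n. u n) < \<top>"
  proof -
    have un: "u n < \<top>" for n
      using fin by (rule le_less_trans[rotated]) (rule SUP_upper, simp)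
    have "u \<longlonglongrightarrow> ennreal (enn2real (SUP n. u n))"
      using LIMSEQ_SUP[OF u] fin by simp
    hence "(\<lambda>n. enn2real (u n)) \<longlonglongrightarrow> enn2real (SUP n. u n)"
      by (rule tendsto_enn2real) simp
    hence "(\<lambda>n. g (enn2real (u n))) \<longlonglongrightarrow> g (enn2real (SUP n. u n))"
      using g by (intro isCont_tendsto_compose[of _ g]) (auto simp: continuous_on_eq_continuous_at)
    hence "(\<lambda>n. ext_fun f (u n)) \<longlonglongrightarrow> ext_fun f (SUP n. u n)"
      using un fin tendsto_ennrealI by (simp add: ext less_imp_neq del: Sup_eq_top_iff SUP_eq_top_iff)
    moreover have "incseq (\<lambda>n. ext_fun f (u n))"
      using u by (auto simp: incseq_def intro: mono)
    hence "(\<lambda>n. ext_fun f (u n)) \<longlonglongrightarrow> (SUP n. ext_fun f (u n))" by (rule LIMSEQ_SUP)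
    ultimately show ?thesis by (rule LIMSEQ_unique[rotated])
  qed
qed

lemma ext_fun_le:
  assumes "C > 0" "\<forall>s\<ge>0. f s \<le> C * s powr k"
  shows "ext_fun f v \<le> ennreal C * ennpowr v k"
proof (cases v)
  case (real x)
  hence "f x \<le> C * x powr k" using assms by blast
  thus ?thesis using real assms(1) by (simp add: ext_fun_def ennreal_leI flip: ennreal_mult)
qed (use assms in \<open>simp add: ennreal_mult_top\<close>)

section \<open>From the hypotheses to the locales\<close>

lemma spectralI:
  fixes \<nu> :: "(real^'n) measure"
  assumes "0 < \<beta>" "\<beta> < 2" and \<nu>: "spectral_measure_pos_density \<nu>"
    and pos: "\<forall>\<theta>\<in>sphere 0 1. omega \<beta> \<nu> \<theta> > 0" and C: "C_on_sphere (Suc m) (omega \<beta> \<nu>)"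
  shows "\<exists>c0. spectral \<beta> \<nu> c0"
proof -
  obtain F V where V: "open V" "sphere 0 1 \<subseteq> V" and F: "C_on (Suc m) V F" "\<forall>\<theta>\<in>sphere 0 1. F \<theta> = omega \<beta> \<nu> \<theta>"
    using C unfolding C_on_sphere_def by blast
  \<comment> \<open>\<open>C_on (Suc m)\<close> unfolds to differentiability on V. By continuity F
    attains its minimum on the compact sphere; there it agrees with \<open>omega\<close>, so the
    minimum is positive and serves as c0.\<close>
  have "continuous_on (sphere 0 1) F"
    using F(1) V(2) by (auto intro!: continuous_at_imp_continuous_on differentiable_imp_continuous_within)
  moreover have "sphere 0 1 \<noteq> ({} :: (real^'n) set)"
    by (metis ex_in_conv sphere_eq_empty zero_le_one not_le)
  ultimately obtain \<theta>0 where \<theta>0: "\<theta>0 \<in> sphere 0 1" "\<forall>\<theta>\<in>sphere 0 1. F \<theta>0 \<le> F \<theta>"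
    using continuous_attains_inf[of "sphere 0 1" F] by auto
  have "spectral \<beta> \<nu> (F \<theta>0)"
  proof (rule spectral.intro)
    show "finite_measure \<nu>" "sets \<nu> = sets (restrict_space borel (sphere 0 1))"
      using \<nu> unfolding spectral_measure_pos_density_def surface_measure_def by auto
  qed (use assms \<theta>0 F in auto)
  thus ?thesis by blast
qed

lemma stable_lawI:
  assumes "0 < \<alpha>" "\<alpha> < 1" "stable_density \<alpha> G\<alpha>"
  shows "stable_law \<alpha> (G\<alpha> 1)"
proof
  have meas [measurable]: "G\<alpha> 1 \<in> borel_measurable borel" and nonneg: "\<And>s. s > 0 \<Longrightarrow> 0 \<le> G\<alpha> 1 s"
    and L: "\<And>r. r \<ge> 0 \<Longrightarrow> set_integrable lborel {0<..} (\<lambda>s. exp (- r * s) * G\<alpha> 1 s)"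
      "\<And>r. r \<ge> 0 \<Longrightarrow> (LINT s:{0<..}|lborel. exp (- r * s) * G\<alpha> 1 s) = exp (- 1 * r powr \<alpha>)"
    using assms(3) unfolding stable_density_def by auto
  show "G\<alpha> 1 \<in> borel_measurable borel" by (rule meas)
  show "0 \<le> G\<alpha> 1 s" if "s > 0" for s using that by (rule nonneg)
  fix r :: real assume r: "r \<ge> 0"
  have "(\<integral>\<^sup>+s\<in>{0<..}. ennreal (exp (- r * s)) * ennreal (G\<alpha> 1 s) \<partial>lborel)
    = (\<integral>\<^sup>+s. ennreal (indicator {0<..} s *\<^sub>R (exp (- r * s) * G\<alpha> 1 s)) \<partial>lborel)"
    using nonneg by (intro nn_integral_cong) (auto simp: indicator_def ennreal_mult)
  also have "\<dots> = ennreal (\<integral>s. indicator {0<..} s *\<^sub>R (exp (- r * s) * G\<alpha> 1 s) \<partial>lborel)"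
    using L(1)[OF r] nonneg unfolding set_integrable_def
    by (intro nn_integral_eq_integral) (auto simp: indicator_def)
  also have "\<dots> = ennreal (exp (- (r powr \<alpha>)))"
    using L(2)[OF r] by (simp add: set_lebesgue_integral_def)
  finally show "(\<integral>\<^sup>+s\<in>{0<..}. ennreal (exp (- r * s)) * ennreal (G\<alpha> 1 s) \<partial>lborel) = ennreal (exp (- (r powr \<alpha>)))" .
qed (use assms in auto)

theorem theorem4p1:
  fixes \<alpha> \<beta> k q q' :: real
    and \<nu> :: "(real^'n) measure"
    and f :: "real \<Rightarrow> real"
    and G\<alpha> :: "real \<Rightarrow> real \<Rightarrow> real"
    and Y :: "real \<Rightarrow> real^'n \<Rightarrow> real"
  assumes "0 < \<alpha>" "\<alpha> < 1" "0 < \<beta>" "\<beta> < 2"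
    and "spectral_measure_pos_density \<nu>"
    and "\<forall>\<theta>\<in>sphere 0 1. omega \<beta> \<nu> \<theta> > 0"
    and "C_on_sphere (CARD('n) + 1 + nat \<lfloor>\<beta>\<rfloor>) (omega \<beta> \<nu>)"
    and "stable_density \<alpha> G\<alpha>"
    and "is_kernel_Y \<alpha> (kernel_Z \<alpha> \<beta> \<nu> G\<alpha>) Y"
    and "local_lipschitz (UNIV::real set) {0..} (\<lambda>_. f)"
    and "mono_on {0..} f"
    and "f 0 = 0" and "\<forall>s>0. f s > 0"
    and "k > 1" and "osgood_type k f"
    and "q' = real CARD('n) / \<beta> * (k - 1)" and "q' \<ge> 1"
    and "max (real CARD('n) / \<beta>) (max k (real CARD('n) * (k - 1) / \<beta>)) < q"
    and "q < \<alpha> * real CARD('n) * k * (k - 1) / \<beta>"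
  shows "\<exists>\<epsilon>>0. \<forall>u0 :: real^'n \<Rightarrow> real.
           u0 \<in> borel_measurable borel \<and> (\<forall>x. u0 x \<ge> 0) \<and>
           Lp_norm q' (\<lambda>x. ennreal (u0 x)) \<le> ennreal \<epsilon> \<longrightarrow>
           (\<exists>u. global_integral_solution (kernel_Z \<alpha> \<beta> \<nu> G\<alpha>) Y f u0 u \<and> Linf_loc_Lp q u)"
proof -
  obtain c0 where "spectral \<beta> \<nu> c0"
    using spectralI[OF assms(3-6), of "CARD('n) + nat \<lfloor>\<beta>\<rfloor>"] assms(7) by auto
  then interpret spectral \<beta> \<nu> c0 .
  interpret stable_law \<alpha> "G\<alpha> 1" using assms(1,2,8) by (rule stable_lawI)
  interpret kernels \<beta> \<nu> c0 \<alpha> "G\<alpha> 1" ..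
  \<comment> \<open>From here on d is the dimension divided by \<beta>, so that q' = d (k -
    1).\<close>
  define d where "d = real CARD('n) / \<beta>"
  have d: "d > 0" using assms(3) by (simp add: d_def)
  have k: "k > 1" and q': "q' = d * (k - 1)" "q' \<ge> 1" and q: "d < q" "k < q" "q' < q" "q < \<alpha> * k * q'"
    using assms by (auto simp: d_def mult_ac)
  have q1: "q > 1" using q k by linarith
  \<comment> \<open>\<kappa> measures the loss of Z from \<open>L\<^sub>q\<^sub>'\<close> to
    \<open>L\<^sub>q\<close>, and \<open>\<kappa>Y\<close> that of Y from
    \<open>L\<^sub>q\<^sub>/\<^sub>k\<close>, where f (u) lies for u in \<open>L\<^sub>q\<close>.
    Accordingly - \<theta> and \<rho> - 1 are the exponents of t in the two kernel bounds.\<close>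
  define \<kappa> where "\<kappa> = d * (1 / q' - 1 / q)"
  define \<kappa>Y where "\<kappa>Y = d * (1 / (q / k) - 1 / q)"
  define \<theta> where "\<theta> = \<alpha> * \<kappa>"
  define \<rho> where "\<rho> = \<alpha> * (1 - \<kappa>Y)"
  have \<kappa>_d: "\<kappa> = real CARD('n) / \<beta> * (1 / q' - 1 / q)" and \<kappa>Y_d: "\<kappa>Y = real CARD('n) / \<beta> * (1 / (q / k) - 1 / q)"
    by (simp_all add: \<kappa>_def \<kappa>Y_def d_def)
  have \<kappa>_eq: "\<kappa> = 1 / (k - 1) - d / q" using q' d k by (simp add: \<kappa>_def field_simps)
  have \<kappa>Y_eq: "\<kappa>Y = d * (k - 1) / q" using q1 k by (simp add: \<kappa>Y_def field_simps)
  \<comment> \<open>The upper bound on q in the form in which it limits \<kappa> = 1 / (k - 1) - d /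
    q; together with \<alpha> < 1 it yields \<kappa> < 1 / k.\<close>
  have dq: "d / q > 1 / (\<alpha> * k * (k - 1))"
  proof -
    have "q < d * (\<alpha> * k * (k - 1))" using q(4) q'(1) by (simp add: mult_ac)
    thus ?thesis using q1 k assms(1) by (simp add: field_simps)
  qed
  have "\<kappa> < (1 - 1 / (\<alpha> * k)) / (k - 1)"
    using dq k assms(1) unfolding \<kappa>_eq by (simp add: diff_divide_distrib)
  also have "1 - 1 / (\<alpha> * k) \<le> 1 - 1 / k"
    using k assms(1,2) by (intro diff_left_mono divide_left_mono) auto
  hence "(1 - 1 / (\<alpha> * k)) / (k - 1) \<le> (1 - 1 / k) / (k - 1)"
    using k by (intro divide_right_mono) auto
  also have "(1 - 1 / k) / (k - 1) = 1 / k" using k by (simp add: field_simps)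
  finally have \<kappa>k: "\<kappa> < 1 / k" .
  hence \<kappa>1: "\<kappa> < 1" using k by (smt (verit) divide_le_eq_1)
  have "k * \<kappa> < 1" using \<kappa>k k by (simp add: field_simps)
  hence k\<theta>: "k * \<theta> < 1"
  proof -
    have "\<kappa> > 0" using d q' q by (simp add: \<kappa>_def frac_less2)
    hence "\<alpha> * (k * \<kappa>) < 1 * 1" using \<open>k * \<kappa> < 1\<close> assms(1,2) k by (intro mult_strict_mono) auto
    thus ?thesis by (simp add: \<theta>_def mult_ac)
  qed
  \<comment> \<open>By q' = d (k - 1), \<open>\<kappa>Y\<close> equals q' / q.\<close>
  have \<kappa>Y1: "\<kappa>Y < 1" using q q' q1 by (simp add: \<kappa>Y_eq)
  have \<rho>: "\<rho> > 0" using \<kappa>Y1 assms(1) by (simp add: \<rho>_def)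
  \<comment> \<open>The scale invariance of the problem in \<open>L\<^sub>q\<^sub>'\<close>: the
    choice of q' gives (k - 1) \<kappa> = 1 - \<open>\<kappa>Y\<close>, whatever q is.\<close>
  have scaling: "\<rho> - k * \<theta> = - \<theta>"
  proof -
    have "(k - 1) * \<kappa> = 1 - \<kappa>Y" using k unfolding \<kappa>_eq \<kappa>Y_eq by (simp add: field_simps)
    hence "(k - 1) * \<theta> = \<rho>" unfolding \<theta>_def \<rho>_def by (metis mult.left_commute)
    thus ?thesis by (simp add: algebra_simps)
  qed
  have cont: "continuous_on {0..} f" using assms(15) by (simp add: osgood_type_def)
  obtain Cf where Cf: "Cf > 0" "\<forall>s\<ge>0. f s \<le> Cf * s powr k"
    using osgood_type_le[OF k assms(15)] by blast
  obtain CZ where CZ: "CZ > 0" "\<forall>u0\<in>borel_measurable borel. \<forall>H>0. \<forall>t>0. (\<forall>x. 0 \<le> u0 x) \<longrightarrow>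
    (\<integral>\<^sup>+y. ennpowr (ennreal (u0 y)) q' \<partial>lborel) \<le> ennreal (H powr q') \<longrightarrow>
    (\<integral>\<^sup>+x. ennpowr (\<integral>\<^sup>+y. ennreal (kernel_Z \<alpha> \<beta> \<nu> G\<alpha> t (x - y) * u0 y) \<partial>lborel) q \<partial>lborel)
      \<le> ennreal ((CZ * H * t powr (- (\<alpha> * \<kappa>))) powr q)"
    using kernel_Z_bound[of G\<alpha> q' q \<kappa>, OF refl q'(2) less_imp_le[OF q(3)] \<kappa>_d \<kappa>1]
    by (elim exE conjE)
  have "1 \<le> q / k" "q / k \<le> q" using q k q1 by (auto simp: field_simps)
  from kernel_Y_bound[of G\<alpha> Y, OF refl assms(9) this \<kappa>Y_d \<kappa>Y1]
  obtain CY where CY: "CY > 0" "AE s in lborel. s > 0 \<longrightarrow> (\<forall>h\<in>borel_measurable borel. \<forall>H>0.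
    (\<integral>\<^sup>+y. ennpowr (h y) (q / k) \<partial>lborel) \<le> ennreal (H powr (q / k)) \<longrightarrow>
    (\<integral>\<^sup>+x. ennpowr (\<integral>\<^sup>+y. ennreal (Y s (x - y)) * h y \<partial>lborel) q \<partial>lborel)
      \<le> ennreal ((CY * s powr (\<rho> - 1) * H) powr q))"
    unfolding \<rho>_def by (elim exE conjE)
  \<comment> \<open>M solves D M powr k = M / 4, possible because k > 1, and \<epsilon> below is
    chosen with CZ \<epsilon> = M / 4. The free term and the Duhamel term then contribute M / 4
    each, and \<open>small\<close> holds with equality.\<close>
  define D where "D = CY * Cf * Beta \<rho> (1 - k * \<theta>)"
  have D: "D > 0" using CY(1) Cf(1) \<rho> k\<theta> by (simp add: D_def Beta_def Gamma_real_pos)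
  define M where "M = (1 / (4 * D)) powr (1 / (k - 1))"
  have M: "M > 0" using D by (simp add: M_def)
  have "M powr (k - 1) = 1 / (4 * D)" using D k by (simp add: M_def powr_powr)
  moreover have "M powr k = M * M powr (k - 1)" using M by (simp add: powr_diff)
  ultimately have DM: "D * M powr k = M / 4" using D by simp
  define \<epsilon> where "\<epsilon> = M / (4 * CZ)"
  have \<epsilon>: "\<epsilon> > 0" using M CZ(1) by (simp add: \<epsilon>_def)
  have Y_pair: "(\<lambda>z. Y (fst z) (snd z)) \<in> borel_measurable (borel \<Otimes>\<^sub>M borel)"
    using assms(9) unfolding is_kernel_Y_def borel_prod by (simp add: case_prod_beta')
  have Z_pair: "(\<lambda>z. kernel_Z \<alpha> \<beta> \<nu> G\<alpha> (fst z) (snd z)) \<in> borel_measurable (borel \<Otimes>\<^sub>M borel)"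
    unfolding kernel_Z_def set_lebesgue_integral_def by measurable
  show ?thesis
  proof (intro exI[of _ \<epsilon>] conjI allI impI, rule \<epsilon>, elim conjE)
    fix u0 :: "real^'n \<Rightarrow> real"
    assume u0 [measurable]: "u0 \<in> borel_measurable borel" and u0_nonneg: "\<forall>x. u0 x \<ge> 0"
      and u0_norm: "Lp_norm q' (\<lambda>x. ennreal (u0 x)) \<le> ennreal \<epsilon>"
    \<comment> \<open>The bound \<epsilon> is kept in place of the norm of u0, which may vanish,
      since the kernel estimate asks for H > 0.\<close>
    have u0_int: "(\<integral>\<^sup>+y. ennpowr (ennreal (u0 y)) q' \<partial>lborel) \<le> ennreal (\<epsilon> powr q')"
      using u0_norm q'(2) \<epsilon> by (simp add: Lp_norm_def ennpowr_le_iff)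
    define a where "a t x = (\<integral>\<^sup>+y. ennreal (kernel_Z \<alpha> \<beta> \<nu> G\<alpha> t (x - y) * u0 y) \<partial>lborel)" for t x
    have Z_meas [measurable]: "(\<lambda>z. kernel_Z \<alpha> \<beta> \<nu> G\<alpha> (g z) (h z)) \<in> borel_measurable N"
      if [measurable]: "g \<in> borel_measurable N" "h \<in> borel_measurable N" for g h and N :: "'c measure"
      using measurable_compose[OF _ Z_pair, of "\<lambda>z. (g z, h z)" N] by simp
    interpret integral_equation a "\<lambda>s x. ennreal (Y s x)" "ext_fun f" "CZ * \<epsilon>" CY Cf M \<rho> \<theta> k q
    proof
      show "(\<lambda>z. a (fst z) (snd z)) \<in> borel_measurable (borel \<Otimes>\<^sub>M borel)"
        unfolding a_def by measurable
      show "(\<lambda>z. ennreal (Y (fst z) (snd z))) \<in> borel_measurable (borel \<Otimes>\<^sub>M borel)"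
        using Y_pair by measurable
      show "2 * (CZ * \<epsilon> + CY * Cf * M powr k * Beta \<rho> (1 - k * \<theta>)) \<le> M"
      proof -
        have "CZ * \<epsilon> = M / 4" using CZ(1) by (simp add: \<epsilon>_def)
        moreover have "CY * Cf * M powr k * Beta \<rho> (1 - k * \<theta>) = M / 4"
          using DM by (simp add: D_def mult_ac)
        ultimately show ?thesis using M by simp
      qed
      show "(\<integral>\<^sup>+x. ennpowr (a t x) q \<partial>lborel) \<le> ennreal ((CZ * \<epsilon> * t powr (- \<theta>)) powr q)" if "t > 0" for t
        unfolding a_def \<theta>_def using CZ(2)[rule_format, OF u0 \<epsilon> that _ u0_int] u0_nonneg by simp
    qed (use measurable_ext_fun[OF cont assms(11)] ext_fun_mono[OF cont assms(11)] ext_fun_SUP[OF cont assms(11)]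
        ext_fun_le[OF Cf] CZ(1) \<epsilon> CY Cf(1) M \<rho> k k\<theta> q1 scaling in auto)
    have eq: "solution t x = (\<integral>\<^sup>+y. ennreal (kernel_Z \<alpha> \<beta> \<nu> G\<alpha> t (x - y) * u0 y) \<partial>lborel) +
        (\<integral>\<^sup>+s\<in>{0<..<t}. (\<integral>\<^sup>+y. ennreal (Y (t - s) (x - y)) * ext_fun f (solution s y) \<partial>lborel) \<partial>lborel)" for t x
      using solution_eq[of t x] unfolding Duhamel_def a_def .
    have sol_meas: "(\<lambda>(t, x). solution t x) \<in> borel_measurable borel"
    proof -
      have "(\<lambda>z. solution (fst z) (snd z)) \<in> borel_measurable (borel \<Otimes>\<^sub>M borel)" by measurable
      thus ?thesis unfolding borel_prod by (simp add: case_prod_beta')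
    qed
    have fin: "AE z in lborel. (case z of (t, x) \<Rightarrow> t > 0 \<longrightarrow> solution t x < \<infinity>)"
    proof -
      have "AE z in lborel \<Otimes>\<^sub>M lborel. (case z of (t, x) \<Rightarrow> t > 0 \<longrightarrow> solution t x < \<infinity>)"
      proof (rule lborel_pair.AE_pair_measure)
        show "{z \<in> space (lborel \<Otimes>\<^sub>M lborel). case z of (t, x) \<Rightarrow> t > 0 \<longrightarrow> solution t x < \<infinity>} \<in> sets (lborel \<Otimes>\<^sub>M lborel)"
          by measurable
        show "AE t in lborel. AE x in lborel. case (t, x) of (t, x) \<Rightarrow> t > 0 \<longrightarrow> solution t x < \<infinity>"
        proof (rule AE_I2)
          fix t :: real
          show "AE x in lborel. case (t, x) of (t, x) \<Rightarrow> t > 0 \<longrightarrow> solution t x < \<infinity>"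
            using solution_finite[of t] by (cases "t > 0") (auto elim!: eventually_mono)
        qed
      qed
      thus ?thesis unfolding lborel_prod .
    qed
    have "global_integral_solution (kernel_Z \<alpha> \<beta> \<nu> G\<alpha>) Y f u0 solution"
      unfolding global_integral_solution_def integral_solution_def
    proof (intro allI impI conjI)
      fix T :: real assume "T > 0"
      show "(\<lambda>(t, x). solution t x) \<in> borel_measurable (restrict_space borel ({0..<T} \<times> UNIV))"
        by (rule measurable_restrict_space1[OF sol_meas])
      show "AE (t, x) in lborel. t \<in> {0<..<T} \<longrightarrow> solution t x < \<infinity>"
        using fin by eventually_elim auto
      show "AE (t, x) in lborel. t \<in> {0<..<T} \<longrightarrow>
        solution t x = (\<integral>\<^sup>+y. ennreal (kernel_Z \<alpha> \<beta> \<nu> G\<alpha> t (x - y) * u0 y) \<partial>lborel) +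
          (\<integral>\<^sup>+s\<in>{0<..<t}. (\<integral>\<^sup>+y. ennreal (Y (t - s) (x - y)) * ext_fun f (solution s y) \<partial>lborel) \<partial>lborel)"
        by (rule AE_I2, clarify) (rule eq)
    qed
    moreover have "Linf_loc_Lp q solution"
      unfolding Linf_loc_Lp_def
    proof (intro conjI allI impI)
      show "(\<lambda>(t, x). solution t x) \<in> borel_measurable (restrict_space borel ({0<..} \<times> UNIV))"
        by (rule measurable_restrict_space1[OF sol_meas])
    next
      fix K :: "real set" assume "compact K \<and> K \<subseteq> {0<..}"
      hence K: "compact K" "K \<subseteq> {0<..}" by auto
      \<comment> \<open>The weight is singular only at t = 0, from which the compact set K keeps a
        positive distance.\<close>
      have "\<exists>b. \<forall>t\<in>K. t powr (- \<theta>) \<le> b"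
      proof -
        have "continuous_on K (\<lambda>t. t powr (- \<theta>))" using K by (intro continuous_intros) auto
        hence "bounded ((\<lambda>t. t powr (- \<theta>)) ` K)"
          using K(1) by (intro compact_imp_bounded compact_continuous_image)
        thus ?thesis unfolding bounded_iff by force
      qed
      then obtain b where b: "\<forall>t\<in>K. t powr (- \<theta>) \<le> b" ..
      show "\<exists>C::real. AE t in lborel. t \<in> K \<longrightarrow> Lp_norm q (solution t) \<le> ennreal C"
      proof (intro exI[of _ "M * b"] AE_I2 impI)
        fix t assume t: "t \<in> K"
        hence "t > 0" using K by auto
        have "Lp_norm q (solution t) \<le> ennpowr (ennreal ((M * t powr (- \<theta>)) powr q)) (1 / q)"
          unfolding Lp_norm_def using q1 by (intro ennpowr_mono solution_bound \<open>t > 0\<close>) auto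
        also have "\<dots> = ennreal (M * t powr (- \<theta>))" using q1 M by (simp add: powr_powr)
        also have "\<dots> \<le> ennreal (M * b)" using b t M by (intro ennreal_leI mult_left_mono) auto
        finally show "Lp_norm q (solution t) \<le> ennreal (M * b)" .
      qed
    qed
    ultimately show "\<exists>u. global_integral_solution (kernel_Z \<alpha> \<beta> \<nu> G\<alpha>) Y f u0 u \<and> Linf_loc_Lp q u"
      by blast
  qed
qed

end
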